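(* Let $\overline M$ be a $7$-manifold with a $G_2$-structure with fundamental three-form $\varphi$, metric $\langle\cdot,\cdot\rangle$, cross product $P$ and Levi-Civita connection $\overline\nabla$. The minimal $G_2$-connection is $\widetilde\nabla^{G_2}=\overline\nabla+\xi^{G_2}$, where $$\xi^{G_2}_XY=-\frac13\sum_{i\in\mathbb Z_7}\overline r(\varphi)(X,e_i)\,P(e_i,Y)$$ for all vectors $X,Y$ (with $\{e_0,\dots,e_6\}$ a Cayley frame), and $\overline r(\varphi)(X,Y)=\frac14\langle\overline\nabla_X\varphi,\ Y\lrcorner *\varphi\rangle$. Moreover, the bilinear form $\overline r(\varphi)$ is expressed in terms of $d\varphi$ and $d^*\varphi$ by $$4\,\overline r(\varphi)(X,Y)=\langle X\lrcorner d\varphi,\ Y\lrcorner *\varphi\rangle-\langle Y\lrcorner(X\wedge *\varphi),\ d\varphi\rangle+2\,d^*\varphi(X,Y).$$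
   Context: A $G_2$-structure on a Riemannian $7$-manifold $(\overline M,\langle\cdot,\cdot\rangle)$ is given by a global three-form $\varphi$ such that locally there is an orthonormal frame $\{e_0,\dots,e_6\}$ (a Cayley frame, indices in $\mathbb Z_7$) with $\varphi=\sum_{i\in\mathbb Z_7}e_i\wedge e_{i+1}\wedge e_{i+3}$ (vectors are identified with one-forms via the metric). $P$ is defined by $\langle P(x,y),z\rangle=\varphi(x,y,z)$. The orientation is $e_0\wedge\dots\wedge e_6$, and $*\varphi$ is the Hodge dual, $*\varphi=-\sum_{i\in\mathbb Z_7}e_{i+2}\wedge e_{i+4}\wedge e_{i+5}\wedge e_{i+6}$. $d^*\varphi=-\sum_ie_i\lrcorner\overline\nabla_{e_i}\varphi$ is the coderivative. The inner product of $p$-forms is $\langle a,b\rangle=\frac1{p!}\sum a(e_{i_1},\dots,e_{i_p})b(e_{i_1},\dots,e_{i_p})$; $\lrcorner$ is the interior product. Let $\mathfrak g_2\subset\mathfrak{so}(7)\cong\Lambda^2T^*\overline M$ be the stabiliser algebra of $\varphi$ and $\mathfrak g_2^\perp$ its orthogonal complement in $\mathfrak{so}(7)$. The minimal $G_2$-connection is the unique metric connection $\widetilde\nabla$ with $\widetilde\nabla\varphi=0$ such that $\xi_X=\widetilde\nabla_X-\overline\nabla_X$ lies in $\mathfrak g_2^\perp$ for every $X$. *)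

theory Defs
  imports "HOL-Analysis.Analysis"
begin

type_synonym vec7 = "real ^ 7"

text \<open>The set \<open>S\<close> is meant to be open. For finite-dimensional domains this is \<open>C\<^sup>k\<close>, because the
  derivative is \<open>C\<^sup>k\<close> as soon as all directional derivatives are.\<close>

primrec Ck_on ::
  "nat \<Rightarrow> ('a::real_normed_vector \<Rightarrow> 'b::real_normed_vector) \<Rightarrow> 'a set \<Rightarrow> bool" where
  "Ck_on 0 f S \<longleftrightarrow> continuous_on S f"
| "Ck_on (Suc k) f S \<longleftrightarrow>
     (\<forall>x\<in>S. f differentiable (at x)) \<and> (\<forall>v. Ck_on k (\<lambda>x. frechet_derivative f (at x) v) S)"

definition smooth_on ::
  "('a::real_normed_vector \<Rightarrow> 'b::real_normed_vector) \<Rightarrow> 'a set \<Rightarrow> bool" where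
  "smooth_on f S \<longleftrightarrow> (\<forall>k. Ck_on k f S)"

text \<open>A manifold is a whole (Hausdorff, second countable) type together with a smooth atlas. A chart
  is a pair of its domain and its coordinate map; off the domain the map is irrelevant.\<close>

type_synonym 'm chart = "'m set \<times> ('m \<Rightarrow> vec7)"

definition smooth_atlas ::
  "'m::{t2_space, second_countable_topology} chart set \<Rightarrow> bool" where
  "smooth_atlas A \<longleftrightarrow>
     (\<Union>(U, c)\<in>A. U) = UNIV \<and>
     (\<forall>(U, c)\<in>A. open U \<and> open (c ` U) \<and> inj_on c U \<and>
        continuous_on U c \<and> continuous_on (c ` U) (inv_into U c)) \<and>
     (\<forall>(U, c)\<in>A. \<forall>(V, d)\<in>A. smooth_on (d \<circ> inv_into U c) (c ` (U \<inter> V)))"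

definition chart_at :: "'m chart set \<Rightarrow> 'm \<Rightarrow> 'm chart" where
  "chart_at A p = (SOME C. C \<in> A \<and> p \<in> fst C)"

abbreviation chart_inv :: "'m chart \<Rightarrow> vec7 \<Rightarrow> 'm" where
  "chart_inv C \<equiv> inv_into (fst C) (snd C)"

text \<open>The tangent space at \<open>p\<close> is identified with \<open>real ^ 7\<close> by means of the preferred chart
  \<open>chart_at A p\<close>. A vector field is therefore a function \<open>'m \<Rightarrow> vec7\<close>, but its values at different
  points refer to different charts. The function \<open>chart_components\<close> passes from the preferred chart
  at \<open>q\<close> to the chart \<open>C\<close>.\<close>

definition chart_components :: "'m chart set \<Rightarrow> 'm chart \<Rightarrow> 'm \<Rightarrow> vec7 \<Rightarrow> vec7" where
  "chart_components A C q v =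
     frechet_derivative (snd C \<circ> chart_inv (chart_at A q)) (at (snd (chart_at A q) q)) v"

definition field_in_chart :: "'m chart set \<Rightarrow> 'm chart \<Rightarrow> ('m \<Rightarrow> vec7) \<Rightarrow> vec7 \<Rightarrow> vec7" where
  "field_in_chart A C Y x = chart_components A C (chart_inv C x) (Y (chart_inv C x))"

definition smooth_field_on ::
  "'m::topological_space chart set \<Rightarrow> 'm set \<Rightarrow> ('m \<Rightarrow> vec7) \<Rightarrow> bool" where
  "smooth_field_on A W Y \<longleftrightarrow>
     open W \<and> (\<forall>C\<in>A. smooth_on (field_in_chart A C Y) (snd C ` (fst C \<inter> W)))"

definition smooth_fun_on ::
  "'m::topological_space chart set \<Rightarrow> 'm set \<Rightarrow> ('m \<Rightarrow> real) \<Rightarrow> bool" where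
  "smooth_fun_on A W f \<longleftrightarrow>
     open W \<and> (\<forall>C\<in>A. smooth_on (f \<circ> chart_inv C) (snd C ` (fst C \<inter> W)))"

text \<open>\<open>dir_deriv A p v f\<close> is the derivative of the function \<open>f\<close> along the tangent vector \<open>v\<close> at \<open>p\<close>.\<close>

definition dir_deriv :: "'m chart set \<Rightarrow> 'm \<Rightarrow> vec7 \<Rightarrow> ('m \<Rightarrow> real) \<Rightarrow> real" where
  "dir_deriv A p v f =
     frechet_derivative (f \<circ> chart_inv (chart_at A p)) (at (snd (chart_at A p) p)) v"

text \<open>The components in the preferred chart at \<open>p\<close> represent \<open>X\<close> and \<open>Y\<close> near \<open>p\<close>; at \<open>p\<close> itself
  they are \<open>X p\<close> and \<open>Y p\<close>.\<close>

definition lie_bracket ::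
  "'m chart set \<Rightarrow> ('m \<Rightarrow> vec7) \<Rightarrow> ('m \<Rightarrow> vec7) \<Rightarrow> 'm \<Rightarrow> vec7" where
  "lie_bracket A X Y p =
     (let C = chart_at A p in
        frechet_derivative (field_in_chart A C Y) (at (snd C p)) (X p)
      - frechet_derivative (field_in_chart A C X) (at (snd C p)) (Y p))"

text \<open>The local field which has constant components \<open>v\<close> in the preferred chart at \<open>p\<close>. It is smooth
  on the domain of that chart, it takes the value \<open>v\<close> at \<open>p\<close>, and any two such fields commute.\<close>

definition coord_field :: "'m chart set \<Rightarrow> 'm \<Rightarrow> vec7 \<Rightarrow> 'm \<Rightarrow> vec7" where
  "coord_field A p v q =
     frechet_derivative (snd (chart_at A q) \<circ> chart_inv (chart_at A p)) (at (snd (chart_at A p) q)) v"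

text \<open>A \<open>k\<close>-form at a point is a function on lists of tangent vectors; only its values on lists of
  length \<open>k\<close> matter.\<close>

type_synonym form = "vec7 list \<Rightarrow> real"

definition alternating_form :: "nat \<Rightarrow> form \<Rightarrow> bool" where
  "alternating_form k a \<longleftrightarrow>
     (\<forall>vs. length vs = k \<longrightarrow>
        (\<forall>i<k. linear (\<lambda>u. a (vs[i := u]))) \<and>
        (\<forall>i<k. \<forall>j<k. i \<noteq> j \<and> vs ! i = vs ! j \<longrightarrow> a vs = 0))"

definition smooth_form ::
  "'m::topological_space chart set \<Rightarrow> nat \<Rightarrow> ('m \<Rightarrow> form) \<Rightarrow> bool" where
  "smooth_form A k \<alpha> \<longleftrightarrow>
     (\<forall>p. alternating_form k (\<alpha> p)) \<and>
     (\<forall>W Ys. open W \<and> length Ys = k \<and> (\<forall>Y\<in>set Ys. smooth_field_on A W Y) \<longrightarrow>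
        smooth_fun_on A W (\<lambda>q. \<alpha> q (map (\<lambda>Y. Y q) Ys)))"

definition omit :: "nat \<Rightarrow> 'a list \<Rightarrow> 'a list" where
  "omit i xs = take i xs @ drop (Suc i) xs"

definition interior_prod :: "vec7 \<Rightarrow> form \<Rightarrow> form" where
  "interior_prod x a = (\<lambda>vs. a (x # vs))"

text \<open>\<open>x \<and> a\<close> for a vector \<open>x\<close>, regarded as a one-form by means of the inner product \<open>h\<close>.\<close>

definition vec_wedge :: "(vec7 \<Rightarrow> vec7 \<Rightarrow> real) \<Rightarrow> vec7 \<Rightarrow> form \<Rightarrow> form" where
  "vec_wedge h x a = (\<lambda>vs. \<Sum>i<length vs. (- 1) ^ i * h x (vs ! i) * a (omit i vs))"

text \<open>\<open>x\<^sub>1 \<and> \<dots> \<and> x\<^sub>k\<close>, which sends \<open>v\<^sub>1, \<dots>, v\<^sub>k\<close> to the determinant of \<open>h x\<^sub>i v\<^sub>j\<close>.\<close>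

definition wedge_vecs :: "(vec7 \<Rightarrow> vec7 \<Rightarrow> real) \<Rightarrow> vec7 list \<Rightarrow> form" where
  "wedge_vecs h xs = foldr (vec_wedge h) xs (\<lambda>_. 1)"

text \<open>Frames are indexed by the numeral type \<open>7\<close>, whose arithmetic is that of the integers modulo 7.
  Seven orthonormal vectors automatically form a basis.\<close>

definition orthonormal_frame :: "(vec7 \<Rightarrow> vec7 \<Rightarrow> real) \<Rightarrow> (7 \<Rightarrow> vec7) \<Rightarrow> bool" where
  "orthonormal_frame h e \<longleftrightarrow> (\<forall>i j. h (e i) (e j) = (if i = j then 1 else 0))"

definition some_orthonormal_frame :: "(vec7 \<Rightarrow> vec7 \<Rightarrow> real) \<Rightarrow> 7 \<Rightarrow> vec7" where
  "some_orthonormal_frame h = (SOME e. orthonormal_frame h e)"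

text \<open>Independent of the chosen orthonormal frame.\<close>

definition form_inner :: "(vec7 \<Rightarrow> vec7 \<Rightarrow> real) \<Rightarrow> nat \<Rightarrow> form \<Rightarrow> form \<Rightarrow> real" where
  "form_inner h k a b =
     (let e = some_orthonormal_frame h in
        1 / fact k * (\<Sum>I | length I = k. a (map e I) * b (map e I)))"

text \<open>\<open>f\<close> is the three-form at the point under consideration.\<close>

definition cayley_frame :: "(vec7 \<Rightarrow> vec7 \<Rightarrow> real) \<Rightarrow> form \<Rightarrow> (7 \<Rightarrow> vec7) \<Rightarrow> bool" where
  "cayley_frame h f e \<longleftrightarrow>
     orthonormal_frame h e \<and>
     (\<forall>vs. length vs = 3 \<longrightarrow> f vs = (\<Sum>i\<in>UNIV. wedge_vecs h [e i, e (i + 1), e (i + 3)] vs))"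

text \<open>The volume form of the orientation given by Cayley frames. All Cayley frames at a point induce
  the same orientation, so the choice is immaterial.\<close>

definition g2_volume :: "(vec7 \<Rightarrow> vec7 \<Rightarrow> real) \<Rightarrow> form \<Rightarrow> form" where
  "g2_volume h f =
     (let e = (SOME e. cayley_frame h f e) in wedge_vecs h (map e [0, 1, 2, 3, 4, 5, 6]))"

text \<open>The Hodge dual of the \<open>k\<close>-form \<open>a\<close> with respect to the inner product \<open>h\<close> and the volume form
  \<open>vol\<close>. The convention is \<open>b \<and> *a = \<langle>b, a\<rangle> vol\<close>.\<close>

definition hodge :: "(vec7 \<Rightarrow> vec7 \<Rightarrow> real) \<Rightarrow> form \<Rightarrow> nat \<Rightarrow> form \<Rightarrow> form" where
  "hodge h vol k a = (\<lambda>vs. form_inner h k a (\<lambda>us. vol (us @ vs)))"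

definition riemannian_metric ::
  "'m::topological_space chart set \<Rightarrow> ('m \<Rightarrow> vec7 \<Rightarrow> vec7 \<Rightarrow> real) \<Rightarrow> bool" where
  "riemannian_metric A g \<longleftrightarrow>
     (\<forall>p. bilinear (g p) \<and> (\<forall>x y. g p x y = g p y x) \<and> (\<forall>x. x \<noteq> 0 \<longrightarrow> g p x x > 0)) \<and>
     (\<forall>W X Y. smooth_field_on A W X \<and> smooth_field_on A W Y \<longrightarrow>
        smooth_fun_on A W (\<lambda>q. g q (X q) (Y q)))"

text \<open>\<open>D p v Y\<close> is the covariant derivative along the tangent vector \<open>v\<close> at \<open>p\<close> of a field \<open>Y\<close> that
  is smooth near \<open>p\<close>; for other \<open>Y\<close> the value is irrelevant.\<close>

type_synonym 'm connection = "'m \<Rightarrow> vec7 \<Rightarrow> ('m \<Rightarrow> vec7) \<Rightarrow> vec7"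

definition affine_connection ::
  "'m::topological_space chart set \<Rightarrow> 'm connection \<Rightarrow> bool" where
  "affine_connection A D \<longleftrightarrow>
     (\<forall>W Y. smooth_field_on A W Y \<longrightarrow>
        (\<forall>p\<in>W. linear (\<lambda>v. D p v Y)) \<and>
        (\<forall>p\<in>W. \<forall>v Z. smooth_field_on A W Z \<longrightarrow>
            D p v (\<lambda>q. Y q + Z q) = D p v Y + D p v Z) \<and>
        (\<forall>p\<in>W. \<forall>v f. smooth_fun_on A W f \<longrightarrow>
            D p v (\<lambda>q. f q *\<^sub>R Y q) = dir_deriv A p v f *\<^sub>R Y p + f p *\<^sub>R D p v Y) \<and>
        (\<forall>p\<in>W. \<forall>v Z. (\<forall>q\<in>W. Z q = Y q) \<longrightarrow> D p v Z = D p v Y) \<and>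
        (\<forall>X. smooth_field_on A W X \<longrightarrow> smooth_field_on A W (\<lambda>q. D q (X q) Y)))"

definition metric_connection ::
  "'m::topological_space chart set \<Rightarrow> ('m \<Rightarrow> vec7 \<Rightarrow> vec7 \<Rightarrow> real) \<Rightarrow> 'm connection \<Rightarrow> bool" where
  "metric_connection A g D \<longleftrightarrow>
     affine_connection A D \<and>
     (\<forall>W Y Z. smooth_field_on A W Y \<and> smooth_field_on A W Z \<longrightarrow>
        (\<forall>p\<in>W. \<forall>v. dir_deriv A p v (\<lambda>q. g q (Y q) (Z q)) =
            g p (D p v Y) (Z p) + g p (Y p) (D p v Z)))"

definition levi_civita ::
  "'m::topological_space chart set \<Rightarrow> ('m \<Rightarrow> vec7 \<Rightarrow> vec7 \<Rightarrow> real) \<Rightarrow> 'm connection \<Rightarrow> bool" where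
  "levi_civita A g D \<longleftrightarrow>
     metric_connection A g D \<and>
     (\<forall>W X Y. smooth_field_on A W X \<and> smooth_field_on A W Y \<longrightarrow>
        (\<forall>p\<in>W. D p (X p) Y - D p (Y p) X = lie_bracket A X Y p))"

text \<open>Covariant and exterior derivatives of forms are tensorial, so they may be computed on the
  coordinate fields of the preferred chart. For the exterior derivative the brackets in the
  invariant formula then vanish.\<close>

definition cov_deriv_form ::
  "'m chart set \<Rightarrow> 'm connection \<Rightarrow> ('m \<Rightarrow> form) \<Rightarrow> 'm \<Rightarrow> vec7 \<Rightarrow> form" where
  "cov_deriv_form A D \<alpha> p v = (\<lambda>vs.
     dir_deriv A p v (\<lambda>q. \<alpha> q (map (\<lambda>u. coord_field A p u q) vs))
     - (\<Sum>i<length vs. \<alpha> p (vs[i := D p v (coord_field A p (vs ! i))])))"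

definition ext_deriv :: "'m chart set \<Rightarrow> ('m \<Rightarrow> form) \<Rightarrow> 'm \<Rightarrow> form" where
  "ext_deriv A \<alpha> p = (\<lambda>vs.
     \<Sum>i<length vs. (- 1) ^ i *
       dir_deriv A p (vs ! i) (\<lambda>q. \<alpha> q (map (\<lambda>u. coord_field A p u q) (omit i vs))))"

definition coderiv ::
  "'m chart set \<Rightarrow> ('m \<Rightarrow> vec7 \<Rightarrow> vec7 \<Rightarrow> real) \<Rightarrow> 'm connection \<Rightarrow> ('m \<Rightarrow> form) \<Rightarrow> 'm \<Rightarrow> form" where
  "coderiv A g D \<alpha> p =
     (let e = some_orthonormal_frame (g p) in
        (\<lambda>vs. - (\<Sum>i\<in>UNIV. interior_prod (e i) (cov_deriv_form A D \<alpha> p (e i)) vs)))"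

definition g2_structure ::
  "'m::topological_space chart set \<Rightarrow> ('m \<Rightarrow> vec7 \<Rightarrow> vec7 \<Rightarrow> real) \<Rightarrow> ('m \<Rightarrow> form) \<Rightarrow> bool" where
  "g2_structure A g \<phi> \<longleftrightarrow>
     smooth_form A 3 \<phi> \<and>
     (\<forall>p. \<exists>W E. p \<in> W \<and> (\<forall>i. smooth_field_on A W (E i)) \<and>
        (\<forall>q\<in>W. cayley_frame (g q) (\<phi> q) (\<lambda>i. E i q)))"

definition cross_prod :: "(vec7 \<Rightarrow> vec7 \<Rightarrow> real) \<Rightarrow> form \<Rightarrow> vec7 \<Rightarrow> vec7 \<Rightarrow> vec7" where
  "cross_prod h f x y = (THE w. \<forall>z. h w z = f [x, y, z])"

definition star_phi ::
  "('m \<Rightarrow> vec7 \<Rightarrow> vec7 \<Rightarrow> real) \<Rightarrow> ('m \<Rightarrow> form) \<Rightarrow> 'm \<Rightarrow> form" where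
  "star_phi g \<phi> p = hodge (g p) (g2_volume (g p) (\<phi> p)) 3 (\<phi> p)"

definition r_form ::
  "'m chart set \<Rightarrow> ('m \<Rightarrow> vec7 \<Rightarrow> vec7 \<Rightarrow> real) \<Rightarrow> ('m \<Rightarrow> form) \<Rightarrow> 'm connection \<Rightarrow>
     'm \<Rightarrow> vec7 \<Rightarrow> vec7 \<Rightarrow> real" where
  "r_form A g \<phi> D p x y =
     1 / 4 * form_inner (g p) 3 (cov_deriv_form A D \<phi> p x) (interior_prod y (star_phi g \<phi> p))"

definition so_alg :: "(vec7 \<Rightarrow> vec7 \<Rightarrow> real) \<Rightarrow> (vec7 \<Rightarrow> vec7) set" where
  "so_alg h = {B. linear B \<and> (\<forall>x y. h (B x) y = - h x (B y))}"

definition g2_alg :: "(vec7 \<Rightarrow> vec7 \<Rightarrow> real) \<Rightarrow> form \<Rightarrow> (vec7 \<Rightarrow> vec7) set" where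
  "g2_alg h f =
     {B \<in> so_alg h. \<forall>x y z. f [B x, y, z] + f [x, B y, z] + f [x, y, B z] = 0}"

definition two_form_of :: "(vec7 \<Rightarrow> vec7 \<Rightarrow> real) \<Rightarrow> (vec7 \<Rightarrow> vec7) \<Rightarrow> form" where
  "two_form_of h B = (\<lambda>vs. h (B (vs ! 0)) (vs ! 1))"

definition g2_perp :: "(vec7 \<Rightarrow> vec7 \<Rightarrow> real) \<Rightarrow> form \<Rightarrow> (vec7 \<Rightarrow> vec7) set" where
  "g2_perp h f =
     {B \<in> so_alg h. \<forall>C\<in>g2_alg h f. form_inner h 2 (two_form_of h B) (two_form_of h C) = 0}"

text \<open>The difference of two connections is tensorial, so it may be computed at a vector \<open>y\<close> by means
  of the coordinate field through \<open>y\<close>. The connection \<open>L\<close> is the Levi-Civita connection.\<close>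

definition minimal_g2_connection ::
  "'m::topological_space chart set \<Rightarrow> ('m \<Rightarrow> vec7 \<Rightarrow> vec7 \<Rightarrow> real) \<Rightarrow> ('m \<Rightarrow> form) \<Rightarrow>
     'm connection \<Rightarrow> 'm connection \<Rightarrow> bool" where
  "minimal_g2_connection A g \<phi> L D \<longleftrightarrow>
     metric_connection A g D \<and>
     (\<forall>p v vs. length vs = 3 \<longrightarrow> cov_deriv_form A D \<phi> p v vs = 0) \<and>
     (\<forall>p v. (\<lambda>y. D p v (coord_field A p y) - L p v (coord_field A p y)) \<in> g2_perp (g p) (\<phi> p))"

definition xi_g2 ::
  "'m chart set \<Rightarrow> ('m \<Rightarrow> vec7 \<Rightarrow> vec7 \<Rightarrow> real) \<Rightarrow> ('m \<Rightarrow> form) \<Rightarrow> 'm connection \<Rightarrow>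
     'm \<Rightarrow> (7 \<Rightarrow> vec7) \<Rightarrow> vec7 \<Rightarrow> vec7 \<Rightarrow> vec7" where
  "xi_g2 A g \<phi> L p e x y =
     - (1 / 3) *\<^sub>R (\<Sum>i\<in>UNIV. r_form A g \<phi> L p x (e i) *\<^sub>R cross_prod (g p) (\<phi> p) (e i) y)"

end

theory Submission
  imports Defs
begin

text \<open>In a local Cayley frame the three-form has constant coefficients, so \<open>\<nabla>\<^sub>X \<phi>\<close> is the action on
  \<open>\<phi>\<close> of a skew endomorphism. Contraction identities between the coefficients of \<open>\<phi>\<close> and \<open>*\<phi>\<close>
  show that such an action always equals \<open>\<Sum>\<^sub>i r(X, e\<^sub>i) e\<^sub>i \<lrcorner> *\<phi>\<close>, and that the action of
  \<open>P(e\<^sub>i, \<cdot>)\<close> is \<open>- 3 e\<^sub>i \<lrcorner> *\<phi>\<close>. Hence \<open>\<xi>\<^sub>X\<close> acts on \<open>\<phi>\<close> as \<open>\<nabla>\<^sub>X \<phi>\<close>, so that adding it to \<open>\<nabla>\<^sub>X\<close>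
  makes \<open>\<phi>\<close> parallel. It is orthogonal to the stabiliser of \<open>\<phi>\<close>, because contracting \<open>\<phi>\<close> with an element of
  the stabiliser gives zero. It is unique, because the difference of two solutions lies both in
  the stabiliser and in its complement. The formula for \<open>r\<close> in terms of \<open>d\<phi>\<close> and \<open>d\<^sup>*\<phi>\<close> follows by
  expressing everything through \<open>r\<close> and contracting \<open>*\<phi>\<close> with itself.\<close>

section \<open>The coefficients of the three-form and of its dual\<close>

text \<open>The coefficients of the dual are introduced through the contraction of two copies of the
  three-form. This makes them computable and yields a frame-free expression for the dual. The
  central identity, \<open>fano\<close> contracted with \<open>fano_star\<close>, has 7^5 instances;
  antisymmetry and the affine symmetries of the Fano plane cut it down to one pair of indices and 35
  increasing triples. The factor -3 is a sum of three contractions of \<open>fano\<close> with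
  itself, each equal to minus the dual up to Kronecker terms that cancel; its inverse is the -1/3 of
  the theorem. On the manifold the obstacle is choice: inner products, the volume form and the
  frames \<open>e\<close> of the theorem are picked point by point, without any smoothness. Hence
  every sum over a frame is shown to be independent of the frame and then evaluated in a smooth
  local Cayley frame. Connections act on locally defined fields, so these local frames can be
  differentiated directly, without cutoff functions.\<close>

lemma UNIV_7: "UNIV = {0,1,2,3,4,5,6::7}"
  by (rule sym, rule card_subset_eq) simp_all

lemma sum_7: "(\<Sum>i\<in>UNIV. f i) = f 0 + f 1 + f 2 + f 3 + f 4 + f 5 + f (6::7)"
  for f :: "7 \<Rightarrow> 'a::comm_monoid_add"
  unfolding UNIV_7 by (simp add: add.assoc)

lemma all_7: "(\<forall>i::7. P i) \<longleftrightarrow> P 0 \<and> P 1 \<and> P 2 \<and> P 3 \<and> P 4 \<and> P 5 \<and> P 6"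
proof -
  have "(\<forall>i::7. P i) \<longleftrightarrow> (\<forall>i\<in>UNIV. P i)" by simp
  also have "\<dots> \<longleftrightarrow> (P 0 \<and> P 1 \<and> P 2 \<and> P 3 \<and> P 4 \<and> P 5 \<and> P 6)"
    unfolding UNIV_7 by simp
  finally show ?thesis .
qed

definition kron :: "7 \<Rightarrow> 7 \<Rightarrow> real" where
  "kron i j = (if i = j then 1 else 0)"

text \<open>Each summand is the determinant that one term of the three-form takes on three frame
  vectors, expanded in the same order as in \<open>wedge_vecs_3\<close>.\<close>

definition fano :: "7 \<Rightarrow> 7 \<Rightarrow> 7 \<Rightarrow> real" where
  "fano i j k = (\<Sum>l\<in>UNIV.
     kron l i * (kron (l + 1) j * kron (l + 3) k - kron (l + 1) k * kron (l + 3) j)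
   - kron l j * (kron (l + 1) i * kron (l + 3) k - kron (l + 1) k * kron (l + 3) i)
   + kron l k * (kron (l + 1) i * kron (l + 3) j - kron (l + 1) j * kron (l + 3) i))"

lemma kron_shift: "kron (i + s) (j + s) = kron i j"
  by (simp add: kron_def)

lemma kron_sym: "kron i j = kron j i"
  by (auto simp add: kron_def)

lemma fano_swap12: "fano j i k = - fano i j k"
  unfolding fano_def sum_negf[symmetric] by (rule sum.cong) (simp_all add: algebra_simps)

lemma fano_swap23: "fano i k j = - fano i j k"
  unfolding fano_def sum_negf[symmetric] by (rule sum.cong) (simp_all add: algebra_simps)

lemma fano_cyc: "fano j k i = fano i j k"
  using fano_swap12[of j i k] fano_swap23[of j i k] by simp

lemma sum_shift_7: "(\<Sum>l\<in>UNIV. F (l + s)) = (\<Sum>l\<in>UNIV. F l)" for s :: 7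
  by (rule sum.reindex_bij_witness[of _ "\<lambda>l. l - s" "\<lambda>l. l + s"]) simp_all

lemma fano_shift: "fano (i + s) (j + s) (k + s) = fano i j k"
proof -
  have *: "kron (l + s + m) (n + s) = kron (l + m) n" for l m n
    by (simp add: kron_def algebra_simps)
  show ?thesis
    unfolding fano_def[of "i + s"]
    by (subst sum_shift_7[of _ s, symmetric]) (simp add: fano_def kron_shift *)
qed

text \<open>The index 0 lies on the three lines (0, 1, 3), (6, 0, 2) and (4, 5, 0). Together with
  \<open>fano_eq\<close> this table determines all coefficients, so the finite checks below fix the
  first index to 0.\<close>

lemma fano_0: "fano 0 j k = (if j = 0 then 0
   else if j = 1 then kron k 3
   else if j = 2 then kron k 6
   else if j = 3 then - kron k 1
   else if j = 4 then kron k 5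
   else if j = 5 then - kron k 4
   else - kron k 2)"
proof -
  have "\<forall>j k. fano 0 j k = (if j = 0 then 0
   else if j = 1 then kron k 3
   else if j = 2 then kron k 6
   else if j = 3 then - kron k 1
   else if j = 4 then kron k 5
   else if j = 5 then - kron k 4
   else - kron k 2)"
    unfolding all_7 fano_def sum_7 kron_def by simp
  then show ?thesis by blast
qed

lemma fano_eq: "fano i j k = fano 0 (j - i) (k - i)"
  using fano_shift[of 0 i "j - i" "k - i"] by simp

text \<open>The coefficients of the dual four-form are defined by the contraction of two copies of the
  three-form; \<open>star_e\<close> below identifies them with those of the Hodge dual.\<close>

definition fano_star :: "7 \<Rightarrow> 7 \<Rightarrow> 7 \<Rightarrow> 7 \<Rightarrow> real" where
  "fano_star a b c d =
     kron a c * kron b d - kron a d * kron b c - (\<Sum>k\<in>UNIV. fano a b k * fano c d k)"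

lemma fano_star_shift: "fano_star (a + s) (b + s) (c + s) (d + s) = fano_star a b c d"
proof -
  have "(\<Sum>k\<in>UNIV. fano (a + s) (b + s) k * fano (c + s) (d + s) k)
      = (\<Sum>k\<in>UNIV. fano a b k * fano c d k)"
    by (subst sum_shift_7[of _ s, symmetric]) (simp add: fano_shift)
  then show ?thesis by (simp add: fano_star_def kron_shift)
qed

lemma fano_star_eq: "fano_star i j k l = fano_star 0 (j - i) (k - i) (l - i)"
  using fano_star_shift[of 0 i "j - i" "k - i" "l - i"] by simp

lemma fano_star_swap12: "fano_star b a c d = - fano_star a b c d"
  unfolding fano_star_def using fano_swap12[of b a] by (simp add: sum_negf algebra_simps kron_sym)

lemma fano_star_swap34: "fano_star a b d c = - fano_star a b c d"
  unfolding fano_star_def using fano_swap12[of c d] by (simp add: sum_negf algebra_simps kron_sym)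

lemma fano_star_swap_pairs: "fano_star c d a b = fano_star a b c d"
  unfolding fano_star_def by (simp add: algebra_simps kron_sym)

lemma sum_kron: "(\<Sum>k\<in>UNIV. kron k i * f k) = f i"  "(\<Sum>k\<in>UNIV. kron i k * f k) = f i"
  "(\<Sum>k\<in>UNIV. f k * kron k i) = f i"  "(\<Sum>k\<in>UNIV. f k * kron i k) = f i"
  unfolding kron_def by (simp_all add: if_distrib[of "\<lambda>x. x * _"] if_distrib[of "\<lambda>x. _ * x"] cong:
      if_cong)

lemma sum_fano_0: "(\<Sum>k\<in>UNIV. fano 0 j k * f k) = (if j = 0 then 0
   else if j = 1 then f 3
   else if j = 2 then f 6
   else if j = 3 then - f 1
   else if j = 4 then f 5
   else if j = 5 then - f 4
   else - f 2)"
  by (simp add: fano_0 sum_kron sum_negf)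

lemma fano_star_0: "fano_star 0 j k l = kron 0 k * kron j l - kron 0 l * kron j k
   - (if j = 0 then 0
   else if j = 1 then fano 0 (k - 3) (l - 3)
   else if j = 2 then fano 0 (k - 6) (l - 6)
   else if j = 3 then - fano 0 (k - 1) (l - 1)
   else if j = 4 then fano 0 (k - 5) (l - 5)
   else if j = 5 then - fano 0 (k - 4) (l - 4)
   else - fano 0 (k - 2) (l - 2))"
  unfolding fano_star_def sum_fano_0 fano_eq[symmetric] fano_cyc[of k l] ..

text \<open>Antisymmetry within the first and within the last pair of indices is visible in the
  definition. Antisymmetry across the pairs is where the special structure of the three-form enters;
  it is checked on all index triples.\<close>

lemma fano_star_swap23_0: "fano_star 0 c b d = - fano_star 0 b c d"
proof -
  have "\<forall>b c d. fano_star 0 c b d = - fano_star 0 b c d"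
    unfolding fano_star_0 fano_0 all_7 by (simp add: kron_def)
  then show ?thesis by blast
qed

lemma fano_star_swap23: "fano_star a c b d = - fano_star a b c d"
  unfolding fano_star_eq[of a c b d] fano_star_eq[of a b c d] by (rule fano_star_swap23_0)

text \<open>Adjacent transpositions sort the arguments up to sign, and repeated arguments give zero.
  For the index type \<open>7\<close> this reduces 343 cases to 35.\<close>

lemma alternating3_zero:
  fixes T :: "'a::linorder \<Rightarrow> 'a \<Rightarrow> 'a \<Rightarrow> real"
  assumes "\<And>a b c. T b a c = - T a b c" "\<And>a b c. T a c b = - T a b c"
    and "\<And>a b c. a < b \<Longrightarrow> b < c \<Longrightarrow> T a b c = 0"
  shows "T a b c = 0"
proof -
  have e1: "T a a c = 0" for a c using assms(1)[of a a c] by simp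
  have e2: "T a b b = 0" for a b using assms(2)[of a b b] by simp
  have *: "T a b c = 0" if "b < c" for a b c
    using assms(1)[of a b c] assms(2)[of b a c] assms(3) e1 e2 that
    by (metis add.inverse_inverse linorder_less_linear neg_0_equal_iff_equal)
  show ?thesis
    by (metis * assms(2) e2 linorder_less_linear neg_0_equal_iff_equal)
qed

lemma fano_same [simp]: "fano i i k = 0" "fano i k i = 0" "fano k i i = 0"
  using fano_swap12[of i i k] fano_swap23[of k i i] fano_cyc[of i k i] by simp_all

lemma fano_star_same [simp]: "fano_star i i k l = 0" "fano_star k i i l = 0" "fano_star k l i i = 0"
  using fano_star_swap12[of i i k l] fano_star_swap23[of k i i l] fano_star_swap34[of k l i i]
      by simp_all

lemma fano_star_cyc: "fano_star b c d a = - fano_star a b c d"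
  using fano_star_swap12[of a b c d] fano_star_swap23[of b a c d] fano_star_swap34[of b c a d]
      by simp

text \<open>The order on \<open>7\<close> is that of the representatives 0 to 6. It serves only to
  enumerate increasing tuples of indices.\<close>

lemma less_7:
  "0 < (1::7)" "0 < (2::7)" "0 < (3::7)" "0 < (4::7)" "0 < (5::7)" "0 < (6::7)"
  "1 < (2::7)" "1 < (3::7)" "1 < (4::7)" "1 < (5::7)" "1 < (6::7)"
  "2 < (3::7)" "2 < (4::7)" "2 < (5::7)" "2 < (6::7)" "3 < (4::7)" "3 < (5::7)" "3 < (6::7)"
  "4 < (5::7)" "4 < (6::7)" "5 < (6::7)"
  by (simp_all add: less_bit1_def bit1.Rep_numeral bit1.Rep_0 bit1.Rep_1)

lemmas less_7_simps = less_7 less_7[THEN order_less_not_sym]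

lemma all_greater_7:
  "(\<forall>i. (6::7) < i \<longrightarrow> P i) \<longleftrightarrow> True"
  "(\<forall>i. (5::7) < i \<longrightarrow> P i) \<longleftrightarrow> P 6"
  "(\<forall>i. (4::7) < i \<longrightarrow> P i) \<longleftrightarrow> P 5 \<and> P 6"
  "(\<forall>i. (3::7) < i \<longrightarrow> P i) \<longleftrightarrow> P 4 \<and> P 5 \<and> P 6"
  "(\<forall>i. (2::7) < i \<longrightarrow> P i) \<longleftrightarrow> P 3 \<and> P 4 \<and> P 5 \<and> P 6"
  "(\<forall>i. (1::7) < i \<longrightarrow> P i) \<longleftrightarrow> P 2 \<and> P 3 \<and> P 4 \<and> P 5 \<and> P 6"
  "(\<forall>i. (0::7) < i \<longrightarrow> P i) \<longleftrightarrow> P 1 \<and> P 2 \<and> P 3 \<and> P 4 \<and> P 5 \<and> P 6"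
  unfolding all_7 by (simp_all add: less_7_simps)

lemma numeral_7: "7 = (0::7)" "8 = (1::7)" "10 = (3::7)" "12 = (5::7)"
  by simp_all

text \<open>Doubling sends the line (l, l + 1, l + 3) to (m + 1, m + 3, m) with m = 2 l - 1, a
  cyclic and hence even rearrangement of another line: 2 is a multiplier of the difference set {0,
  1, 3}.\<close>

lemma fano_double: "fano (2 * i) (2 * j) (2 * k) = fano i j k"
proof -
  have "\<forall>j k. fano 0 (2 * j) (2 * k) = fano 0 j k"
    unfolding all_7 fano_0 kron_def by simp
  then show ?thesis
    unfolding fano_eq[of i j k] fano_eq[of "2 * i" "2 * j" "2 * k"] right_diff_distrib[symmetric]
        by blast
qed

lemma double_eq_iff: "2 * i = 2 * j \<longleftrightarrow> i = j" for i j :: 7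
proof
  assume "2 * i = 2 * j"
  \<comment> \<open>4 is the inverse of 2 modulo 7.\<close>
  then have "4 * (2 * i) = 4 * (2 * j)" by simp
  then show "i = j" by (simp add: mult.assoc[symmetric] numeral_7)
qed simp

lemma kron_double: "kron (2 * i) (2 * j) = kron i j"
  by (simp add: kron_def double_eq_iff)

lemma sum_double_7: "(\<Sum>l\<in>UNIV. F (2 * l)) = (\<Sum>l\<in>UNIV. F (l::7))"
  by (rule sum.reindex_bij_witness[of _ "\<lambda>l. 4 * l" "\<lambda>l. 2 * l"])
      (simp_all add: mult.assoc[symmetric] numeral_7)

lemma fano_star_double: "fano_star (2 * i) (2 * j) (2 * k) (2 * l) = fano_star i j k l"
  unfolding fano_star_def by (subst sum_double_7[symmetric]) (simp add: fano_double kron_double)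

text \<open>The translations and the doubling of the indices modulo 7 preserve the three-form, and together
  with the exchange of \<open>i\<close> and \<open>j\<close> they reduce the contraction identity to the pair \<open>(0, 1)\<close>.\<close>

definition contraction_at :: "7 \<Rightarrow> 7 \<Rightarrow> bool" where
  "contraction_at i j \<longleftrightarrow> (\<forall>a b c.
    (\<Sum>k\<in>UNIV. fano i j k * fano_star a b c k) =
      kron i a * fano j b c - kron i b * fano j a c + kron i c * fano j a b
      - kron j a * fano i b c + kron j b * fano i a c - kron j c * fano i a b)"

lemma contraction_at_swap: "contraction_at i j \<Longrightarrow> contraction_at j i"
  unfolding contraction_at_def fano_swap12[of j i] by (simp add: sum_negf)

lemma contraction_at_shift:
  assumes "contraction_at i j"
  shows "contraction_at (i + s) (j + s)"
  unfolding contraction_at_def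
proof (intro allI)
  fix a b c
  have "(\<Sum>k\<in>UNIV. fano (i + s) (j + s) k * fano_star a b c k)
      = (\<Sum>k\<in>UNIV. fano i j k * fano_star (a - s) (b - s) (c - s) k)"
    using fano_star_shift[of "a - s" s "b - s" "c - s"]
    by (subst sum_shift_7[of _ s, symmetric]) (simp add: fano_shift)
  then show "(\<Sum>k\<in>UNIV. fano (i + s) (j + s) k * fano_star a b c k) =
      kron (i + s) a * fano (j + s) b c - kron (i + s) b * fano (j + s) a c
      + kron (i + s) c * fano (j + s) a b - kron (j + s) a * fano (i + s) b c
      + kron (j + s) b * fano (i + s) a c - kron (j + s) c * fano (i + s) a b"
    using assms[unfolded contraction_at_def, rule_format, of "a - s" "b - s" "c - s"]
      fano_shift[of i s "a - s" "b - s"] fano_shift[of i s "a - s" "c - s"] fano_shift[of i s "b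
          - s" "c - s"]
      fano_shift[of j s "a - s" "b - s"] fano_shift[of j s "a - s" "c - s"] fano_shift[of j s "b
          - s" "c - s"]
      kron_shift[of i s "a - s"] kron_shift[of i s "b - s"] kron_shift[of i s "c - s"]
      kron_shift[of j s "a - s"] kron_shift[of j s "b - s"] kron_shift[of j s "c - s"]
    by simp
qed

lemma contraction_at_double:
  assumes "contraction_at i j"
  shows "contraction_at (2 * i) (2 * j)"
  unfolding contraction_at_def
proof (intro allI)
  fix a b c :: 7
  define a' b' c' where "a' = 4 * a" "b' = 4 * b" "c' = 4 * c"
  have abc: "a = 2 * a'" "b = 2 * b'" "c = 2 * c'"
    by (simp_all add: a'_b'_c'_def mult.assoc[symmetric] numeral_7)
  show "(\<Sum>k\<in>UNIV. fano (2 * i) (2 * j) k * fano_star a b c k) =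
      kron (2 * i) a * fano (2 * j) b c - kron (2 * i) b * fano (2 * j) a c
      + kron (2 * i) c * fano (2 * j) a b - kron (2 * j) a * fano (2 * i) b c
      + kron (2 * j) b * fano (2 * i) a c - kron (2 * j) c * fano (2 * i) a b"
    using assms[unfolded contraction_at_def, rule_format, of a' b' c']
    unfolding abc by (subst sum_double_7[symmetric]) (simp add: fano_double fano_star_double
        kron_double)
qed

text \<open>The indices 0 and 1 lie on the line (0, 1, 3) only, so the sum collapses to its term k =
  3. \<open>T\<close> is the difference of the two sides, rewritten with first index 0; it
  alternates in a, b, c.\<close>

lemma contraction_at_0_1: "contraction_at 0 1"
proof -
  define T where "T a b c = - fano_star 0 (a - 3) (b - 3) (c - 3) -
    (kron 0 a * fano 0 (b - 1) (c - 1) - kron 0 b * fano 0 (a - 1) (c - 1)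
    + kron 0 c * fano 0 (a - 1) (b - 1) - kron 1 a * fano 0 b c + kron 1 b * fano 0 a c
    - kron 1 c * fano 0 a b)" for a b c
  have "T a b c = 0" for a b c
  proof (rule alternating3_zero[where T = T])
    show "T b a c = - T a b c" "T a c b = - T a b c" for a b c
      using fano_star_swap23[of 0 "a - 3" "b - 3" "c - 3"] fano_star_swap34[of 0 "a - 3" "b
          - 3" "c - 3"]
        fano_swap23[of 0 a b] fano_swap23[of 0 b c] fano_swap23[of 0 "a - 1" "b - 1"]
        fano_swap23[of 0 "b - 1" "c - 1"]
      by (auto simp: T_def)
    have "\<forall>b. a < b \<longrightarrow> (\<forall>c. b < c \<longrightarrow> T a b c = 0)" if "a = m" "m \<in> {0, 1, 2, 3, 4, 5, 6}" for a m
      using that(2) unfolding T_def that(1)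
      by (elim insertE emptyE; hypsubst; simp only: all_greater_7 simp_thms)
        (simp_all add: fano_0 fano_star_0 kron_def)
    then show "a < b \<Longrightarrow> b < c \<Longrightarrow> T a b c = 0" for a b c
      unfolding UNIV_7[symmetric] by blast
  qed
  then show ?thesis
    unfolding contraction_at_def sum_fano_0 T_def fano_eq[of 1]
    by (simp add: fano_star_cyc[of _ _ _ 3] fano_star_eq[of 3])
qed

lemma fano_fano_star:
  "(\<Sum>k\<in>UNIV. fano i j k * fano_star a b c k) =
    kron i a * fano j b c - kron i b * fano j a c + kron i c * fano j a b
    - kron j a * fano i b c + kron j b * fano i a c - kron j c * fano i a b"
proof -
  note 1 = contraction_at_0_1
  have 2: "contraction_at 0 2" using contraction_at_double[OF 1] by simp
  have 4: "contraction_at 0 4" using contraction_at_double[OF 2] by simp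
  \<comment> \<open>Doubling moves only within the quadratic residues 1, 2, 4 and within the
    non-residues 6, 5, 3. Exchanging the pair and translating it by 6 changes the difference 1 to
    -1, which links the two classes.\<close>
  have 6: "contraction_at 0 6" using contraction_at_shift[OF contraction_at_swap[OF 1], of 6]
      by (simp add: numeral_7)
  have 5: "contraction_at 0 5" using contraction_at_double[OF 6] by (simp add: numeral_7)
  have 3: "contraction_at 0 3" using contraction_at_double[OF 5] by (simp add: numeral_7)
  have 0: "contraction_at 0 0" by (simp add: contraction_at_def)
  have "\<forall>j. contraction_at 0 j" unfolding all_7 using 0 1 2 3 4 5 6 by simp
  then have "contraction_at i j"
    using contraction_at_shift[of 0 "j - i" i] by simp
  then show ?thesis by (simp add: contraction_at_def)
qed

section \<open>Contractions of the dual with the three-form and with itself\<close>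

lemma sum_kron_diag: "(\<Sum>k\<in>UNIV. kron k k) = 7"
  by (simp add: kron_def)

lemma fano_fano:
  "(\<Sum>k\<in>UNIV. fano a b k * fano c d k) = kron a c * kron b d - kron a d * kron b c
      - fano_star a b c d"
  by (simp add: fano_star_def)

text \<open>In the trace of \<open>fano_fano_star\<close> three Kronecker terms give
  \<open>fano k a b\<close> once each, and the trace of the Kronecker symbol gives it -7 times; 1 +
  1 + 1 - 7 = -4.\<close>

lemma fano_fano_star2:
  "(\<Sum>c\<in>UNIV. \<Sum>d\<in>UNIV. fano k c d * fano_star a b c d) = - 4 * fano a b k"
  unfolding fano_fano_star
  by (simp add: sum.distrib sum_subtractf sum_kron flip: sum_distrib_left sum_distrib_right)
    (simp add: sum_kron_diag kron_sym sum_kron fano_cyc fano_swap12[of b a] fano_swap23[of a k b])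

text \<open>Only the second factor is expanded by its definition. Its Kronecker terms reproduce
  \<open>fano_star\<close> twice, and its product of two \<open>fano\<close> contracts with the
  first factor through \<open>fano_fano_star2\<close>.\<close>

lemma fano_star_fano_star:
  "(\<Sum>c\<in>UNIV. \<Sum>d\<in>UNIV. fano_star a b c d * fano_star i j c d) =
    4 * (kron a i * kron b j - kron a j * kron b i) - 2 * fano_star a b i j"
proof -
  have "(\<Sum>c\<in>UNIV. \<Sum>d\<in>UNIV. fano_star a b c d * fano_star i j c d) =
    (\<Sum>c\<in>UNIV. \<Sum>d\<in>UNIV. fano_star a b c d * (kron i c * kron j d))
   - (\<Sum>c\<in>UNIV. \<Sum>d\<in>UNIV. fano_star a b c d * (kron i d * kron j c))
   - (\<Sum>c\<in>UNIV. \<Sum>d\<in>UNIV. \<Sum>k\<in>UNIV. fano_star a b c d * (fano i j k * fano c d k))"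
    unfolding fano_star_def[of i j] by (simp add: right_diff_distrib sum_subtractf sum_distrib_left)
  also have "(\<Sum>c\<in>UNIV. \<Sum>d\<in>UNIV. fano_star a b c d * (kron i c * kron j d)) = fano_star a b i j"
    by (simp add: mult.assoc[symmetric] numeral_7 sum_kron)
  also have "(\<Sum>c\<in>UNIV. \<Sum>d\<in>UNIV. fano_star a b c d * (kron i d * kron j c)) = fano_star a b j i"
    by (simp add: mult.assoc[symmetric] numeral_7 sum_kron mult.commute[of "kron i _"])
  also have "(\<Sum>c\<in>UNIV. \<Sum>d\<in>UNIV. \<Sum>k\<in>UNIV. fano_star a b c d * (fano i j k * fano c d k))
      = (\<Sum>k\<in>UNIV. \<Sum>c\<in>UNIV. \<Sum>d\<in>UNIV. fano i j k * (fano k c d * fano_star a b c d))"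
    by (subst (2) sum.swap, subst sum.swap) (simp add: fano_cyc mult_ac)
  also have "\<dots> = (\<Sum>k\<in>UNIV. fano i j k * (- 4 * fano a b k))"
    unfolding fano_fano_star2[symmetric] by (simp only: sum_distrib_left)
  also have "\<dots> = - 4 * (\<Sum>k\<in>UNIV. fano i j k * fano a b k)"
    by (simp add: sum_distrib_left mult_ac)
  finally show ?thesis
    unfolding fano_fano using fano_star_swap34[of a b i j]
        by (simp add: fano_star_swap_pairs[of i j a b] kron_sym algebra_simps)
qed

text \<open>This is a trace of the preceding identity: the Kronecker terms give 4 * (7 - 1), and the
  \<open>fano_star\<close> terms have a repeated index.\<close>

lemma fano_star_fano_star3:
  "(\<Sum>b\<in>UNIV. \<Sum>c\<in>UNIV. \<Sum>d\<in>UNIV. fano_star a b c d * fano_star i b c d) = 24 * kron a i"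
  unfolding fano_star_fano_star using fano_star_swap23[of a i b b for b]
  by (simp add: sum_subtractf sum_kron_diag right_diff_distrib sum_kron kron_sym flip:
      sum_distrib_left)

section \<open>The action of skew endomorphisms in coordinates\<close>

lemma sum3_rot:
  "(\<Sum>a\<in>A. \<Sum>b\<in>B. \<Sum>c\<in>C. f a b c) = (\<Sum>c\<in>C. \<Sum>a\<in>A. \<Sum>b\<in>B. f a b c)"
proof -
  have "(\<Sum>a\<in>A. \<Sum>b\<in>B. \<Sum>c\<in>C. f a b c) = (\<Sum>a\<in>A. \<Sum>c\<in>C. \<Sum>b\<in>B. f a b c)"
    by (rule sum.cong[OF refl]) (rule sum.swap)
  also have "\<dots> = (\<Sum>c\<in>C. \<Sum>a\<in>A. \<Sum>b\<in>B. f a b c)"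
    by (rule sum.swap)
  finally show ?thesis .
qed

definition skew :: "(7 \<Rightarrow> 7 \<Rightarrow> real) \<Rightarrow> bool" where
  "skew A \<longleftrightarrow> (\<forall>a b. A b a = - A a b)"

text \<open>The derivation action of an endomorphism on the three-form; \<open>A a d\<close> is the
  component along \<open>e d\<close> of the image of \<open>e a\<close>.\<close>

definition der_fano :: "(7 \<Rightarrow> 7 \<Rightarrow> real) \<Rightarrow> 7 \<Rightarrow> 7 \<Rightarrow> 7 \<Rightarrow> real" where
  "der_fano A a b c =
    (\<Sum>d\<in>UNIV. A a d * fano d b c + A b d * fano a d c + A c d * fano a b d)"

text \<open>After renaming indices, the three slots contribute equally because both factors are
  antisymmetric; each contributes -4 by \<open>fano_fano_star2\<close>.\<close>

lemma sum_der_fano_star: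
  "(\<Sum>a\<in>UNIV. \<Sum>b\<in>UNIV. \<Sum>c\<in>UNIV. der_fano A a b c * fano_star k a b c) =
    - 12 * (\<Sum>a\<in>UNIV. \<Sum>d\<in>UNIV. A a d * fano k a d)"
proof -
  let ?S = "\<Sum>a\<in>UNIV. \<Sum>b\<in>UNIV. \<Sum>c\<in>UNIV. \<Sum>d\<in>UNIV. A a d * fano d b c * fano_star k a b c"
  have "?S = (\<Sum>a\<in>UNIV. \<Sum>d\<in>UNIV. \<Sum>b\<in>UNIV. \<Sum>c\<in>UNIV. A a d * fano d b c * fano_star k a b c)"
    by (rule sum.cong[OF refl]) (rule sum3_rot)
  also have "\<dots> = (\<Sum>a\<in>UNIV. \<Sum>d\<in>UNIV. A a d * (- 4 * fano k a d))"
    unfolding fano_fano_star2[symmetric] by (simp only: sum_distrib_left mult.assoc)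
  also have "\<dots> = - 4 * (\<Sum>a\<in>UNIV. \<Sum>d\<in>UNIV. A a d * fano k a d)"
    by (simp add: sum_distrib_left mult_ac)
  finally have S: "?S = - 4 * (\<Sum>a\<in>UNIV. \<Sum>d\<in>UNIV. A a d * fano k a d)" .
  have "(\<Sum>a\<in>UNIV. \<Sum>b\<in>UNIV. \<Sum>c\<in>UNIV. \<Sum>d\<in>UNIV. A b d * fano a d c * fano_star k a b c)
      = (\<Sum>b\<in>UNIV. \<Sum>a\<in>UNIV. \<Sum>c\<in>UNIV. \<Sum>d\<in>UNIV. A b d * fano a d c * fano_star k a b c)"
    by (rule sum.swap)
  also have "\<dots> = ?S"
  proof (intro sum.cong refl)
    fix a b c d
    show "A a d * fano b d c * fano_star k b a c = A a d * fano d b c * fano_star k a b c"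
      using fano_swap12[of d b c] fano_star_swap23[of k a b c] by simp
  qed
  finally have S2: "(\<Sum>a\<in>UNIV. \<Sum>b\<in>UNIV. \<Sum>c\<in>UNIV. \<Sum>d\<in>UNIV. A b d * fano a d c * fano_star k a b c)
      = ?S" .
  have "(\<Sum>a\<in>UNIV. \<Sum>b\<in>UNIV. \<Sum>c\<in>UNIV. \<Sum>d\<in>UNIV. A c d * fano a b d * fano_star k a b c)
      = (\<Sum>c\<in>UNIV. \<Sum>a\<in>UNIV. \<Sum>b\<in>UNIV. \<Sum>d\<in>UNIV. A c d * fano a b d * fano_star k a b c)"
    by (rule sum3_rot)
  also have "\<dots> = ?S"
  proof (intro sum.cong refl)
    fix a b c d
    show "A a d * fano b c d * fano_star k b c a = A a d * fano d b c * fano_star k a b c"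
      using fano_cyc[of b c d] fano_star_swap23[of k b a c] fano_star_swap34[of k b c a] by simp
  qed
  finally have S3: "(\<Sum>a\<in>UNIV. \<Sum>b\<in>UNIV. \<Sum>c\<in>UNIV. \<Sum>d\<in>UNIV. A c d * fano a b d * fano_star k a b c)
      = ?S" .
  have "(\<Sum>a\<in>UNIV. \<Sum>b\<in>UNIV. \<Sum>c\<in>UNIV. der_fano A a b c * fano_star k a b c) = ?S
      + (\<Sum>a\<in>UNIV. \<Sum>b\<in>UNIV. \<Sum>c\<in>UNIV. \<Sum>d\<in>UNIV. A b d * fano a d c * fano_star k a b c)
      + (\<Sum>a\<in>UNIV. \<Sum>b\<in>UNIV. \<Sum>c\<in>UNIV. \<Sum>d\<in>UNIV. A c d * fano a b d * fano_star k a b c)"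
    unfolding der_fano_def sum_distrib_right by (simp only: distrib_right sum.distrib)
  then show ?thesis unfolding S2 S3 S by simp
qed

text \<open>The constant makes this the form \<open>r\<close> of the theorem: 1/4 from its
  definition, 1/3! from the inner product of three-forms and -12 from
  \<open>sum_der_fano_star\<close>.\<close>

definition r_fano :: "(7 \<Rightarrow> 7 \<Rightarrow> real) \<Rightarrow> 7 \<Rightarrow> real" where
  "r_fano A k = - (1 / 2) * (\<Sum>a\<in>UNIV. \<Sum>d\<in>UNIV. A a d * fano k a d)"

text \<open>Inserting \<open>r_fano\<close> turns the right side into \<open>A\<close> contracted
  with \<open>fano_fano_star\<close>. The six resulting terms form three pairs, equal by skewness,
  which absorbs the factor 1/2.\<close>

lemma der_fano_decomp:
  assumes "skew A"
  shows "der_fano A a b c = (\<Sum>k\<in>UNIV. r_fano A k * fano_star k a b c)"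
proof -
  have sk: "A i j = - A j i" for i j using assms unfolding skew_def by blast
  have "(\<Sum>k\<in>UNIV. r_fano A k * fano_star k a b c) =
     (\<Sum>k\<in>UNIV. \<Sum>i\<in>UNIV. \<Sum>j\<in>UNIV. 1 / 2 * A i j * (fano i j k * fano_star a b c k))"
    unfolding r_fano_def sum_distrib_left sum_distrib_right
  proof (intro sum.cong refl)
    fix k i j
    show "- (1 / 2) * (A i j * fano k i j) * fano_star k a b c
        = 1 / 2 * A i j * (fano i j k * fano_star a b c k)"
      using fano_cyc[of i j k] fano_star_cyc[of a b c k] by simp
  qed
  also have "\<dots> = (\<Sum>i\<in>UNIV. \<Sum>j\<in>UNIV. 1 / 2 * A i j * (\<Sum>k\<in>UNIV. fano i j k * fano_star a b c k))"
    unfolding sum_distrib_left by (rule sum3_rot[symmetric])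
  also have "\<dots> = 1 / 2 * (\<Sum>i\<in>UNIV. \<Sum>j\<in>UNIV.
        A i j * (kron i a * fano j b c) - A i j * (kron i b * fano j a c)
      + A i j * (kron i c * fano j a b) - A i j * (kron j a * fano i b c)
      + A i j * (kron j b * fano i a c) - A i j * (kron j c * fano i a b))"
    unfolding fano_fano_star sum_distrib_left
    by (intro sum.cong refl) (simp add: algebra_simps)
  also have "\<dots> = 1 / 2 * (
      (\<Sum>i\<in>UNIV. \<Sum>j\<in>UNIV. A i j * (kron i a * fano j b c)) - (\<Sum>i\<in>UNIV. \<Sum>j\<in>UNIV. A i j *
          (kron i b * fano j a c))
    + (\<Sum>i\<in>UNIV. \<Sum>j\<in>UNIV. A i j * (kron i c * fano j a b)) - (\<Sum>i\<in>UNIV. \<Sum>j\<in>UNIV. A i j *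
        (kron j a * fano i b c))
    + (\<Sum>i\<in>UNIV. \<Sum>j\<in>UNIV. A i j * (kron j b * fano i a c)) - (\<Sum>i\<in>UNIV. \<Sum>j\<in>UNIV. A i j *
        (kron j c * fano i a b)))"
    by (simp only: sum.distrib sum_subtractf)
  finally have eq: "(\<Sum>k\<in>UNIV. r_fano A k * fano_star k a b c) = \<dots>" .
  have 1: "(\<Sum>i\<in>UNIV. \<Sum>j\<in>UNIV. A i j * (kron i m * F j)) = (\<Sum>j\<in>UNIV. A m j * F j)" for m F
    by (subst sum.swap) (simp add: sum_kron mult.left_commute[of _ "kron _ _"])
  have 2: "(\<Sum>i\<in>UNIV. \<Sum>j\<in>UNIV. A i j * (kron j m * F i)) = (\<Sum>i\<in>UNIV. - (A m i * F i))" for m F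
  proof (rule sum.cong[OF refl])
    fix i show "(\<Sum>j\<in>UNIV. A i j * (kron j m * F i)) = - (A m i * F i)"
      using sk[of i m] by (simp add: sum_kron mult.left_commute[of _ "kron _ _"])
  qed
  have "(\<Sum>k\<in>UNIV. r_fano A k * fano_star k a b c) =
      (\<Sum>d\<in>UNIV. A a d * fano d b c - A b d * fano d a c + A c d * fano d a b)"
    unfolding eq 1 2 by (simp add: sum_negf sum.distrib sum_subtractf)
  also have "\<dots> = der_fano A a b c"
    unfolding der_fano_def
  proof (rule sum.cong[OF refl])
    fix d show "A a d * fano d b c - A b d * fano d a c + A c d * fano d a b =
      A a d * fano d b c + A b d * fano a d c + A c d * fano a b d"
      using fano_swap12[of a d c] fano_cyc[of a b d] by simp
  qed
  finally show ?thesis ..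
qed

lemma der_fano_cross:
  "der_fano (\<lambda>a b. - (1 / 3) * (\<Sum>i\<in>UNIV. r i * fano i a b)) a b c
      = (\<Sum>i\<in>UNIV. r i * fano_star i a b c)"
proof -
  \<comment> \<open>Rewritten so that a, b, c rotate cyclically, the three products have Kronecker
    parts that cancel, and the rotations leave \<open>fano_star i a b c\<close> unchanged.\<close>
  have *: "(\<Sum>d\<in>UNIV. fano i a d * fano d b c + fano i b d * fano a d c + fano i c d * fano a b d)
    = - 3 * fano_star i a b c" for i
  proof -
    have "(\<Sum>d\<in>UNIV. fano i a d * fano d b c + fano i b d * fano a d c + fano i c d * fano a b d)
      = (\<Sum>d\<in>UNIV. fano i a d * fano b c d) + (\<Sum>d\<in>UNIV. fano i b d * fano c a d) +
          (\<Sum>d\<in>UNIV. fano i c d * fano a b d)"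
      unfolding sum.distrib[symmetric]
    proof (rule sum.cong[OF refl])
      fix d show "fano i a d * fano d b c + fano i b d * fano a d c + fano i c d * fano a b d =
        fano i a d * fano b c d + fano i b d * fano c a d + fano i c d * fano a b d"
        using fano_cyc[of b c d] fano_cyc[of a d c] by simp
    qed
    also have "\<dots> = - 3 * fano_star i a b c"
      unfolding fano_fano using fano_star_swap34[of i b c a] fano_star_swap23[of i b a c]
        fano_star_swap23[of i c a b] fano_star_swap34[of i a c b]
      by (simp add: kron_sym)
    finally show ?thesis .
  qed
  have "der_fano (\<lambda>a b. - (1 / 3) * (\<Sum>i\<in>UNIV. r i * fano i a b)) a b c =
     (\<Sum>d\<in>UNIV. \<Sum>i\<in>UNIV. - (1 / 3) * r i * (fano i a d * fano d b c + fano i b d * fano a d c +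
         fano i c d * fano a b d))"
    unfolding der_fano_def sum_distrib_left sum_distrib_right sum.distrib[symmetric]
    by (intro sum.cong refl) (simp add: algebra_simps)
  also have "\<dots> = (\<Sum>i\<in>UNIV. - (1 / 3) * r i * (\<Sum>d\<in>UNIV. (fano i a d * fano d b c
      + fano i b d * fano a d c + fano i c d * fano a b d)))"
    unfolding sum_distrib_left by (rule sum.swap)
  also have "\<dots> = (\<Sum>i\<in>UNIV. r i * fano_star i a b c)"
    unfolding * by simp
  finally show ?thesis .
qed

lemma sum4_rot:
  "(\<Sum>a\<in>A. \<Sum>b\<in>B. \<Sum>c\<in>C. \<Sum>d\<in>D. f a b c d) = (\<Sum>d\<in>D. \<Sum>a\<in>A. \<Sum>b\<in>B. \<Sum>c\<in>C. f a b c d)"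
proof -
  have "(\<Sum>a\<in>A. \<Sum>b\<in>B. \<Sum>c\<in>C. \<Sum>d\<in>D. f a b c d) = (\<Sum>a\<in>A. \<Sum>d\<in>D. \<Sum>b\<in>B. \<Sum>c\<in>C. f a b c d)"
    by (rule sum.cong[OF refl]) (rule sum3_rot)
  also have "\<dots> = (\<Sum>d\<in>D. \<Sum>a\<in>A. \<Sum>b\<in>B. \<Sum>c\<in>C. f a b c d)"
    by (rule sum.swap)
  finally show ?thesis .
qed

section \<open>Contractions of \<open>N\<close>, the components of the covariant derivative of the
  three-form\<close>

context
  fixes r :: "7 \<Rightarrow> 7 \<Rightarrow> real" and N :: "7 \<Rightarrow> 7 \<Rightarrow> 7 \<Rightarrow> 7 \<Rightarrow> real"
  assumes N: "\<And>i a b c. N i a b c = (\<Sum>k\<in>UNIV. r i k * fano_star k a b c)"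
begin

lemma N_swap12: "N i b a c = - N i a b c"
  unfolding N sum_negf[symmetric] fano_star_swap23[of _ b a] by simp

lemma N_swap23: "N i a c b = - N i a b c"
  unfolding N sum_negf[symmetric] fano_star_swap34[of _ a c b] by simp

lemma sum_N_star: "(\<Sum>a\<in>UNIV. \<Sum>b\<in>UNIV. \<Sum>c\<in>UNIV. N x a b c * fano_star y a b c) = 24 * r x y"
proof -
  have "(\<Sum>a\<in>UNIV. \<Sum>b\<in>UNIV. \<Sum>c\<in>UNIV. N x a b c * fano_star y a b c)
      = (\<Sum>a\<in>UNIV. \<Sum>b\<in>UNIV. \<Sum>c\<in>UNIV. \<Sum>k\<in>UNIV. r x k * (fano_star k a b c * fano_star y a b c))"
    unfolding N sum_distrib_right by (simp add: mult.assoc)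
  also have
      "\<dots> = (\<Sum>k\<in>UNIV. r x k * (\<Sum>a\<in>UNIV. \<Sum>b\<in>UNIV. \<Sum>c\<in>UNIV. fano_star k a b c * fano_star y a b c))"
    unfolding sum_distrib_left by (rule sum4_rot)
  also have "\<dots> = 24 * r x y"
    unfolding fano_star_fano_star3
        by (simp add: mult.left_commute[of _ 24] sum_kron flip: sum_distrib_left)
  finally show ?thesis .
qed

text \<open>The mixed contraction, in which the direction of differentiation is summed against the
  dual. The Kronecker terms of \<open>fano_star_fano_star\<close> give \<open>r x y\<close> and the
  trace of \<open>r\<close>; the remaining term gives the divergence \<open>N a a x y\<close>, which
  is minus the coderivative.\<close>

lemma sum_N_star':
  "(\<Sum>a\<in>UNIV. \<Sum>b\<in>UNIV. \<Sum>c\<in>UNIV. N a x b c * fano_star y a b c) =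
    4 * r x y - 4 * kron x y * (\<Sum>a\<in>UNIV. r a a) - 2 * (\<Sum>a\<in>UNIV. N a a x y)"
proof -
  have "(\<Sum>a\<in>UNIV. \<Sum>b\<in>UNIV. \<Sum>c\<in>UNIV. N a x b c * fano_star y a b c)
      = (\<Sum>a\<in>UNIV. \<Sum>b\<in>UNIV. \<Sum>c\<in>UNIV. \<Sum>k\<in>UNIV. r a k * (fano_star k x b c * fano_star y a b c))"
    unfolding N sum_distrib_right by (simp add: mult.assoc)
  also have
      "\<dots> = (\<Sum>a\<in>UNIV. \<Sum>k\<in>UNIV. r a k * (\<Sum>b\<in>UNIV. \<Sum>c\<in>UNIV. fano_star k x b c * fano_star y a b c))"
    unfolding sum_distrib_left by (rule sum.cong[OF refl]) (rule sum3_rot)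
  also have "\<dots> = (\<Sum>a\<in>UNIV. \<Sum>k\<in>UNIV. kron k y * (kron x a * (4 * r a k))
      - kron k a * (4 * kron x y * r a k) - 2 * (r a k * fano_star k a x y))"
    unfolding fano_star_fano_star
  proof (intro sum.cong refl)
    fix a k show "r a k * (4 * (kron k y * kron x a - kron k a * kron x y) - 2 * fano_star k x y a)
      = kron k y * (kron x a * (4 * r a k)) - kron k a * (4 * kron x y * r a k) - 2 *
          (r a k * fano_star k a x y)"
      using fano_star_swap34[of k x a y] fano_star_swap23[of k a x y] by (simp add: algebra_simps)
  qed
  also have "\<dots> = (\<Sum>a\<in>UNIV. kron x a * (4 * r a y) - 4 * kron x y * r a a - 2 * N a a x y)"
    unfolding sum_subtractf N by (simp only: sum_kron sum_distrib_left)
  also have "\<dots> = 4 * r x y - 4 * kron x y * (\<Sum>a\<in>UNIV. r a a) - 2 * (\<Sum>a\<in>UNIV. N a a x y)"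
    by (simp only: sum_subtractf sum_kron sum_distrib_left)
  finally show ?thesis .
qed

text \<open>Of the four terms of the exterior derivative, the one differentiating along x is a full
  contraction; by antisymmetry each of the other three is minus the mixed contraction.\<close>

lemma sum_ext_star:
  "(\<Sum>a\<in>UNIV. \<Sum>b\<in>UNIV. \<Sum>c\<in>UNIV. (N x a b c - N a x b c + N b x a c - N c x a b) * fano_star y a b c)
   = 24 * r x y - 3 * (\<Sum>a\<in>UNIV. \<Sum>b\<in>UNIV. \<Sum>c\<in>UNIV. N a x b c * fano_star y a b c)"
proof -
  let ?Z = "\<Sum>a\<in>UNIV. \<Sum>b\<in>UNIV. \<Sum>c\<in>UNIV. N a x b c * fano_star y a b c"
  have "(\<Sum>a\<in>UNIV. \<Sum>b\<in>UNIV. \<Sum>c\<in>UNIV. N b x a c * fano_star y a b c) =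
     (\<Sum>b\<in>UNIV. \<Sum>a\<in>UNIV. \<Sum>c\<in>UNIV. N b x a c * fano_star y a b c)"
    by (rule sum.swap)
  also have "\<dots> = - ?Z"
    unfolding sum_negf[symmetric]
  proof (intro sum.cong refl)
    fix a b c show "N a x b c * fano_star y b a c = - (N a x b c * fano_star y a b c)"
      using fano_star_swap23[of y b a c] by simp
  qed
  finally have 1: "(\<Sum>a\<in>UNIV. \<Sum>b\<in>UNIV. \<Sum>c\<in>UNIV. N b x a c * fano_star y a b c) = - ?Z" .
  have "(\<Sum>a\<in>UNIV. \<Sum>b\<in>UNIV. \<Sum>c\<in>UNIV. N c x a b * fano_star y a b c) =
     (\<Sum>c\<in>UNIV. \<Sum>a\<in>UNIV. \<Sum>b\<in>UNIV. N c x a b * fano_star y a b c)"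
    by (rule sum3_rot)
  also have "\<dots> = ?Z"
  proof (intro sum.cong refl)
    fix a b c show "N a x b c * fano_star y b c a = N a x b c * fano_star y a b c"
      using fano_star_swap34[of y b c a] fano_star_swap23[of y b a c] by simp
  qed
  finally have 2: "(\<Sum>a\<in>UNIV. \<Sum>b\<in>UNIV. \<Sum>c\<in>UNIV. N c x a b * fano_star y a b c) = ?Z" .
  show ?thesis
    unfolding left_diff_distrib distrib_right sum.distrib sum_subtractf 1 2 sum_N_star by simp
qed

text \<open>\<open>W\<close> has the components of the interior product of \<open>e y\<close> with
  \<open>e x\<close> wedge the dual. Its first two terms give full contractions, and each of the
  last three gives the mixed contraction.\<close>

lemma sum_wedge_N:
  fixes x y
  defines "W \<equiv> \<lambda>a b c d. kron x y * fano_star a b c d - kron x a * fano_star y b c d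
      + kron x b * fano_star y a c d - kron x c * fano_star y a b d + kron x d * fano_star y a b c"
  shows "(\<Sum>a\<in>UNIV. \<Sum>b\<in>UNIV. \<Sum>c\<in>UNIV. \<Sum>d\<in>UNIV. W a b c d * N a b c d) =
    24 * kron x y * (\<Sum>a\<in>UNIV. r a a) - 24 * r x y
    + 3 * (\<Sum>a\<in>UNIV. \<Sum>b\<in>UNIV. \<Sum>c\<in>UNIV. N a x b c * fano_star y a b c)"
proof -
  let ?Z = "\<Sum>a\<in>UNIV. \<Sum>b\<in>UNIV. \<Sum>c\<in>UNIV. N a x b c * fano_star y a b c"
  have "(\<Sum>a\<in>UNIV. \<Sum>b\<in>UNIV. \<Sum>c\<in>UNIV. \<Sum>d\<in>UNIV. W a b c d * N a b c d) =
     (\<Sum>a\<in>UNIV. \<Sum>b\<in>UNIV. \<Sum>c\<in>UNIV. \<Sum>d\<in>UNIV. kron x y * (N a b c d * fano_star a b c d)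
      - kron x a * (N a b c d * fano_star y b c d) + kron x b * (N a b c d * fano_star y a c d)
      + kron x c * (N a c b d * fano_star y a b d) + kron x d * (N a d b c * fano_star y a b c))"
  proof (intro sum.cong refl)
    fix a b c d
    show "W a b c d * N a b c d = kron x y * (N a b c d * fano_star a b c d)
      - kron x a * (N a b c d * fano_star y b c d) + kron x b * (N a b c d * fano_star y a c d)
      + kron x c * (N a c b d * fano_star y a b d) + kron x d * (N a d b c * fano_star y a b c)"
      unfolding W_def N_swap12[of a c b d] using N_swap12[of a d b c] N_swap23[of a b d c]
      by (simp add: algebra_simps)
  qed
  also have "\<dots> = kron x y * (\<Sum>a\<in>UNIV. 24 * r a a) - 24 * r x y + ?Z + ?Z + ?Z"
    unfolding sum.distrib sum_subtractf
    by (simp only: sum_distrib_left[symmetric] sum_kron sum_N_star)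
  finally show ?thesis by (simp flip: sum_distrib_left)
qed

text \<open>An alternating \<open>W\<close> sees only the alternating part of \<open>N\<close>, so
  the four terms of the exterior derivative contribute equally.\<close>

lemma sum_wedge_ext:
  fixes W :: "7 \<Rightarrow> 7 \<Rightarrow> 7 \<Rightarrow> 7 \<Rightarrow> real"
  assumes W1: "\<And>a b c d. W b a c d = - W a b c d" and W2: "\<And>a b c d. W a c b d = - W a b c d"
    and W3: "\<And>a b c d. W a b d c = - W a b c d"
  shows "(\<Sum>a\<in>UNIV. \<Sum>b\<in>UNIV. \<Sum>c\<in>UNIV. \<Sum>d\<in>UNIV. W a b c d * (N a b c d - N b a c d + N c a b d
      - N d a b c))
    = 4 * (\<Sum>a\<in>UNIV. \<Sum>b\<in>UNIV. \<Sum>c\<in>UNIV. \<Sum>d\<in>UNIV. W a b c d * N a b c d)"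
proof -
  let ?S = "\<Sum>a\<in>UNIV. \<Sum>b\<in>UNIV. \<Sum>c\<in>UNIV. \<Sum>d\<in>UNIV. W a b c d * N a b c d"
  have "(\<Sum>a\<in>UNIV. \<Sum>b\<in>UNIV. \<Sum>c\<in>UNIV. \<Sum>d\<in>UNIV. W a b c d * N b a c d)
     = (\<Sum>b\<in>UNIV. \<Sum>a\<in>UNIV. \<Sum>c\<in>UNIV. \<Sum>d\<in>UNIV. W a b c d * N b a c d)"
    by (rule sum.swap)
  also have "\<dots> = - ?S"
    unfolding sum_negf[symmetric]
  proof (intro sum.cong refl)
    fix a b c d show "W b a c d * N a b c d = - (W a b c d * N a b c d)"
      using W1[of a b c d] by simp
  qed
  finally have 1: "(\<Sum>a\<in>UNIV. \<Sum>b\<in>UNIV. \<Sum>c\<in>UNIV. \<Sum>d\<in>UNIV. W a b c d * N b a c d) = - ?S" .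
  have "(\<Sum>a\<in>UNIV. \<Sum>b\<in>UNIV. \<Sum>c\<in>UNIV. \<Sum>d\<in>UNIV. W a b c d * N c a b d)
     = (\<Sum>c\<in>UNIV. \<Sum>a\<in>UNIV. \<Sum>b\<in>UNIV. \<Sum>d\<in>UNIV. W a b c d * N c a b d)"
    by (rule sum3_rot)
  also have "\<dots> = ?S"
  proof (intro sum.cong refl)
    fix a b c d show "W b c a d * N a b c d = W a b c d * N a b c d"
      using W1[of a b c d] W2[of b a c d] by simp
  qed
  finally have 2: "(\<Sum>a\<in>UNIV. \<Sum>b\<in>UNIV. \<Sum>c\<in>UNIV. \<Sum>d\<in>UNIV. W a b c d * N c a b d) = ?S" .
  have "(\<Sum>a\<in>UNIV. \<Sum>b\<in>UNIV. \<Sum>c\<in>UNIV. \<Sum>d\<in>UNIV. W a b c d * N d a b c)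
     = (\<Sum>d\<in>UNIV. \<Sum>a\<in>UNIV. \<Sum>b\<in>UNIV. \<Sum>c\<in>UNIV. W a b c d * N d a b c)"
    by (rule sum4_rot)
  also have "\<dots> = - ?S"
    unfolding sum_negf[symmetric]
  proof (intro sum.cong refl)
    fix a b c d show "W b c d a * N a b c d = - (W a b c d * N a b c d)"
      using W1[of a b c d] W2[of b a c d] W3[of b c a d] by simp
  qed
  finally have 3: "(\<Sum>a\<in>UNIV. \<Sum>b\<in>UNIV. \<Sum>c\<in>UNIV. \<Sum>d\<in>UNIV. W a b c d * N d a b c) = - ?S" .
  show ?thesis
    unfolding right_diff_distrib distrib_left sum.distrib sum_subtractf 1 2 3 by simp
qed

text \<open>Write Z for the mixed contraction, S for the trace of \<open>N\<close>, t for the trace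
  of \<open>r\<close> and \<delta> for \<open>kron x y\<close>. The right side is (4 r - Z/2) + (4 r
  - 4 \<delta> t - Z/2) - 2 S, and Z = 4 r - 4 \<delta> t - 2 S leaves 4 r. The factors 1/6 and 1/24
  are those of the inner products of three-forms and four-forms.\<close>

lemma r_from_ext:
  fixes x y
  defines "d \<equiv> \<lambda>a b c d. N a b c d - N b a c d + N c a b d - N d a b c"
  defines "W \<equiv> \<lambda>a b c d. kron x y * fano_star a b c d - kron x a * fano_star y b c d
      + kron x b * fano_star y a c d - kron x c * fano_star y a b d + kron x d * fano_star y a b c"
  shows "4 * r x y = 1 / 6 * (\<Sum>a\<in>UNIV. \<Sum>b\<in>UNIV. \<Sum>c\<in>UNIV. d x a b c * fano_star y a b c)
    - 1 / 24 * (\<Sum>a\<in>UNIV. \<Sum>b\<in>UNIV. \<Sum>c\<in>UNIV. \<Sum>e\<in>UNIV. W a b c e * d a b c e)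
    - 2 * (\<Sum>i\<in>UNIV. N i i x y)"
proof -
  have W1: "W b a c d = - W a b c d" and W2: "W a c b d = - W a b c d"
      and W3: "W a b d c = - W a b c d"
    for a b c d
    unfolding W_def
    using fano_star_swap12[of a b c d] fano_star_swap23[of y a b d] fano_star_swap23[of y a b c]
      fano_star_swap23[of a b c d] fano_star_swap23[of y b c d] fano_star_swap34[of y a b c]
      fano_star_swap34[of a b c d] fano_star_swap34[of y b c d] fano_star_swap34[of y a c d]
    by simp_all
  have "(\<Sum>a\<in>UNIV. \<Sum>b\<in>UNIV. \<Sum>c\<in>UNIV. \<Sum>e\<in>UNIV. W a b c e * d a b c e)
    = 4 * (\<Sum>a\<in>UNIV. \<Sum>b\<in>UNIV. \<Sum>c\<in>UNIV. \<Sum>d\<in>UNIV. W a b c d * N a b c d)"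
    unfolding d_def by (rule sum_wedge_ext) (rule W1 W2 W3)+
  then show ?thesis
    unfolding W_def sum_wedge_N d_def sum_ext_star sum_N_star'
    by (simp add: add_divide_distrib diff_divide_distrib)
qed

end

section \<open>Alternating forms and orthonormal frames\<close>

lemma alternating_form_linear:
  assumes "alternating_form k a" "Suc (length pre + length post) = k"
  shows "linear (\<lambda>u. a (pre @ u # post))"
proof -
  have "linear (\<lambda>u. a ((pre @ 0 # post)[length pre := u]))"
    using assms(1)[unfolded alternating_form_def, rule_format, of "pre @ 0 # post",
      THEN conjunct1, rule_format, of "length pre"] assms(2) by simp
  then show ?thesis by simp
qed

lemma alternating_form_zero:
  assumes "alternating_form k a" "length vs = k" "i < k" "j < k" "i \<noteq> j" "vs ! i = vs ! j"
  shows "a vs = 0"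
  using assms unfolding alternating_form_def by blast

text \<open>Polarisation: the value on two equal neighbours x + y vanishes, and so do its diagonal
  terms.\<close>

lemma alternating_form_swap:
  assumes "alternating_form k a" "length pre + length post + 2 = k"
  shows "a (pre @ x # y # post) = - a (pre @ y # x # post)"
proof -
  define G where "G u v = a (pre @ u # v # post)" for u v
  have l1: "linear (\<lambda>u. G u v)" for v
    using alternating_form_linear[OF assms(1), of pre "v # post"] assms(2) by (simp add: G_def)
  have l2: "linear (\<lambda>v. G u v)" for u
    using alternating_form_linear[OF assms(1), of "pre @ [u]" post] assms(2) by (simp add: G_def)
  have z: "G u u = 0" for u
    unfolding G_def using assms(2)
    by (intro alternating_form_zero[OF assms(1), of _ "length pre" "Suc (length pre)"])
      (simp_all add: nth_append)
  have "G (x + y) (x + y) = G x x + G y x + (G x y + G y y)"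
    by (simp add: linear_add[OF l1] linear_add[OF l2])
  then show ?thesis by (simp add: z G_def)
qed

lemma alternating_form_move:
  assumes "alternating_form k a" "length pre + length mid + length post + 1 = k"
  shows "a (pre @ x # mid @ post) = (- 1) ^ length mid * a (pre @ mid @ x # post)"
  using assms(2)
proof (induction mid arbitrary: pre)
  case (Cons y mid)
  have "a (pre @ x # (y # mid) @ post) = - a ((pre @ [y]) @ x # mid @ post)"
    using alternating_form_swap[OF assms(1), of pre "mid @ post" x y] Cons.prems by simp
  also have "\<dots> = - ((- 1) ^ length mid * a ((pre @ [y]) @ mid @ x # post))"
    using Cons.IH[of "pre @ [y]"] Cons.prems by simp
  finally show ?case by simp
qed simp

lemma length_omit [simp]: "i < length vs \<Longrightarrow> length (omit i vs) = length vs - 1"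
  by (simp add: omit_def)

lemma nth_omit:
  assumes "i < length vs" "l < length vs - 1"
  shows "omit i vs ! l = (if l < i then vs ! l else vs ! Suc l)"
  using assms by (simp add: omit_def nth_append)

lemma omit_update_same: "omit i (vs[i := u]) = omit i vs"
  by (simp add: omit_def)

lemma omit_update_less: "j < i \<Longrightarrow> i < length vs \<Longrightarrow> omit j (vs[i := u]) = (omit j vs)[i - 1 := u]"
  by (cases i) (auto simp: omit_def list_update_append drop_update_swap)

lemma omit_update_greater: "i < j \<Longrightarrow> j < length vs \<Longrightarrow> omit j (vs[i := u]) = (omit j vs)[i := u]"
  by (simp add: omit_def list_update_append take_update_swap)

lemma omit_append: "omit (length pre) (pre @ x # post) = pre @ post"
  by (simp add: omit_def)

text \<open>If positions i < j carry the same vector, every term deleting another position still has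
  a repeated argument. The two remaining terms differ by moving that vector past j - i - 1 entries,
  and with the signs of positions i and j they cancel.\<close>

lemma alternating_vec_wedge:
  assumes h: "linear (h x)" and a: "alternating_form k a"
  shows "alternating_form (Suc k) (vec_wedge h x a)"
  unfolding alternating_form_def
proof (intro allI impI conjI)
  fix vs :: "vec7 list" and i assume vs: "length vs = Suc k" and i: "i < Suc k"
  have "linear (\<lambda>u. (- 1) ^ j * h x (vs[i := u] ! j) * a (omit j (vs[i := u])))" if j: "j < Suc k"
      for j
  proof -
    consider "j = i" | "j < i" | "i < j" by linarith
    then show ?thesis
    proof cases
      case 1
      have "linear (\<lambda>u. ((- 1) ^ i * a (omit i vs)) *\<^sub>R h x u)"
        by (intro linear_compose_scale_right h)
      then show ?thesis using 1 i vs by (simp add: omit_update_same mult_ac)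
    next
      case 2
      have "linear (\<lambda>u. a ((omit j vs)[i - 1 := u]))"
        using a vs i 2 unfolding alternating_form_def by simp
      then have "linear (\<lambda>u. ((- 1) ^ j * h x (vs ! j)) *\<^sub>R a ((omit j vs)[i - 1 := u]))"
        by (rule linear_compose_scale_right)
      then show ?thesis using 2 i vs by (simp add: omit_update_less mult_ac)
    next
      case 3
      have "linear (\<lambda>u. a ((omit j vs)[i := u]))"
        using a vs i 3 j unfolding alternating_form_def by simp
      then have "linear (\<lambda>u. ((- 1) ^ j * h x (vs ! j)) *\<^sub>R a ((omit j vs)[i := u]))"
        by (rule linear_compose_scale_right)
      then show ?thesis using 3 i j vs by (simp add: omit_update_greater mult_ac)
    qed
  qed
  then show "linear (\<lambda>u. vec_wedge h x a (vs[i := u]))"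
    unfolding vec_wedge_def length_list_update vs by (intro linear_compose_sum) simp
next
  fix vs :: "vec7 list" and i j assume vs: "length vs = Suc k" and i: "i < Suc k" and j: "j < Suc k"
    and eq: "i \<noteq> j \<and> vs ! i = vs ! j"
  have *: "vec_wedge h x a vs = 0" if ij: "i < j" "j < Suc k" "vs ! i = vs ! j" for i j
  proof -
    let ?t = "\<lambda>m. (- 1) ^ m * h x (vs ! m) * a (omit m vs)"
    have z: "?t m = 0" if "m \<in> {..<Suc k} - {i, j}" for m
    proof -
      have "a (omit m vs) = 0"
        \<comment> \<open>Positions behind the deleted one drop by one.\<close>
        using that ij vs
        by (intro alternating_form_zero[OF a, of _ "if i < m then i else i
            - 1" "if j < m then j else j - 1"])
          (auto simp: nth_omit)
      then show ?thesis by simp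
    qed
    define pre mid post where "pre = take i vs" "mid = take (j - i - 1) (drop (Suc i) vs)"
        "post = drop (Suc j) vs"
    have vs_eq: "vs = pre @ vs ! i # mid @ vs ! i # post"
    proof -
      have "drop (Suc i) vs = mid @ drop (j - i - 1) (drop (Suc i) vs)"
        by (simp only: pre_mid_post_def append_take_drop_id)
      also have "drop (j - i - 1) (drop (Suc i) vs) = drop j vs" using ij by simp
      also have "drop j vs = vs ! i # post"
        using ij vs by (simp add: pre_mid_post_def Cons_nth_drop_Suc)
      finally show ?thesis
        using id_take_nth_drop[of i vs] ij vs by (simp add: pre_mid_post_def)
    qed
    have len: "length pre = i" "length mid = j - i - 1" "length post = k - j"
      using ij vs by (auto simp: pre_mid_post_def)
    have oi: "omit i vs = pre @ mid @ vs ! i # post"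
      by (subst vs_eq) (use omit_append[of pre] len in simp)
    have oj: "omit j vs = pre @ vs ! i # mid @ post"
      by (subst vs_eq) (use omit_append[of "pre @ vs ! i # mid" "vs ! i" post] len ij in simp)
    have m: "a (omit j vs) = (- 1) ^ (j - i - 1) * a (omit i vs)"
      unfolding oi oj using alternating_form_move[OF a, of pre mid post "vs ! i"] len ij by simp
    have "(- 1) ^ j * (- 1) ^ (j - i - 1) = - ((- 1) ^ i :: real)"
    proof -
      have "(- 1) ^ j = (- 1 :: real) ^ (Suc i + (j - i - 1))" using ij by simp
      then show ?thesis by (simp add: power_add mult.assoc flip: power_mult_distrib)
    qed
    moreover have "?t j = ((- 1) ^ j * (- 1) ^ (j - i - 1)) * (h x (vs ! i) * a (omit i vs))"
      using ij m by (simp add: mult_ac)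
    ultimately have "?t j = - ?t i" by simp
    moreover have "vec_wedge h x a vs = (\<Sum>m<Suc k. ?t m)"
      by (simp add: vec_wedge_def vs)
    moreover have "\<dots> = sum ?t {i, j}"
      by (rule sum.mono_neutral_right) (use ij z in auto)
    ultimately show ?thesis using ij by simp
  qed
  show "vec_wedge h x a vs = 0"
    using *[of i j] *[of j i] eq i j by (metis linorder_less_linear)
qed

lemma alternating_wedge_vecs:
  assumes "\<And>x. linear (h x)"
  shows "alternating_form (length xs) (wedge_vecs h xs)"
proof (induction xs)
  case Nil
  then show ?case by (simp add: alternating_form_def)
next
  case (Cons x xs)
  then show ?case using alternating_vec_wedge[OF assms] by (simp add: wedge_vecs_def)
qed

section \<open>Inner products of forms are independent of the orthonormal frame\<close>

definition multilinear_form :: "nat \<Rightarrow> form \<Rightarrow> bool" where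
  "multilinear_form k a \<longleftrightarrow> (\<forall>vs. length vs = k \<longrightarrow> (\<forall>i<k. linear (\<lambda>u. a (vs[i := u]))))"

lemma alternating_imp_multilinear: "alternating_form k a \<Longrightarrow> multilinear_form k a"
  by (simp add: alternating_form_def multilinear_form_def)

lemma multilinear_interior_prod:
  assumes "multilinear_form (Suc k) a" shows "multilinear_form k (interior_prod x a)"
  unfolding multilinear_form_def
proof (intro allI impI)
  fix vs :: "vec7 list" and i assume "length vs = k" "i < k"
  then have "linear (\<lambda>u. a ((x # vs)[Suc i := u]))"
    using assms unfolding multilinear_form_def by (metis Suc_less_eq length_Cons)
  then show "linear (\<lambda>u. interior_prod x a (vs[i := u]))"
    by (simp add: interior_prod_def)
qed

lemma multilinear_form_Cons:
  assumes "multilinear_form (Suc k) a" "length vs = k" shows "linear (\<lambda>u. a (u # vs))"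
proof -
  have "linear (\<lambda>u. a ((0 # vs)[0 := u]))"
    using assms unfolding multilinear_form_def by (metis length_Cons zero_less_Suc)
  then show ?thesis by simp
qed

lemma sum_lists_Suc:
  "(\<Sum>I | length I = Suc k. F I) = (\<Sum>i\<in>UNIV. \<Sum>I | length I = k. F (i # I))"
      for F :: "'a::finite list \<Rightarrow> real"
proof -
  have eq: "{I. length I = Suc k} = (\<lambda>(i, I). i # I) ` (UNIV \<times> {I :: 'a list. length I = k})"
    by (auto simp: length_Suc_conv image_iff)
  show ?thesis
    unfolding eq sum.cartesian_product
    by (subst sum.reindex) (auto simp: inj_on_def case_prod_beta)
qed

lemma sum_lists_0: "(\<Sum>I | length I = 0. F I) = F []"
  by simp

locale frame =
  fixes h :: "vec7 \<Rightarrow> vec7 \<Rightarrow> real"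
  assumes bil: "bilinear h" and sym: "\<And>x y. h x y = h y x"
begin

lemma lin1: "linear (\<lambda>x. h x y)" and lin2: "linear (h x)"
  using bil by (simp_all add: bilinear_def)

lemma orthonormal_expand:
  assumes e: "orthonormal_frame h e"
  shows "v = (\<Sum>i\<in>UNIV. h v (e i) *\<^sub>R e i)"
proof -
  have he: "h (e i) (e j) = (if i = j then 1 else 0)" for i j
    using e unfolding orthonormal_frame_def by blast
  have hc: "h (\<Sum>i\<in>UNIV. c i *\<^sub>R e i) (e j) = c j" for c j
    unfolding linear_sum[OF lin1] linear_cmul[OF lin1] he
    by (simp add: if_distrib cong: if_cong)
  have inj: "inj e"
  proof (rule injI)
    fix i j assume "e i = e j"
    then show "i = j" using e unfolding orthonormal_frame_def by (metis zero_neq_one)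
  qed
  have ind: "independent (range e)"
  proof
    assume "dependent (range e)"
    then obtain u where u: "\<exists>v\<in>range e. u v \<noteq> 0" "(\<Sum>v\<in>range e. u v *\<^sub>R v) = 0"
      by (auto simp: dependent_finite)
    then have "(\<Sum>i\<in>UNIV. u (e i) *\<^sub>R e i) = 0"
      by (simp add: sum.reindex[OF inj])
    then have "u (e j) = 0" for j
      using hc[of "\<lambda>i. u (e i)" j] linear_0[OF lin1] by simp
    then show False using u(1) by blast
  qed
  have "card (range e) = 7" by (simp add: card_image[OF inj])
  then have "UNIV \<subseteq> span (range e)"
    by (intro card_ge_dim_independent ind) (simp_all add: dim_UNIV)
  then have "v \<in> span (range e)" by blast
  then obtain u where "v = (\<Sum>w\<in>range e. u w *\<^sub>R w)"
    by (auto simp: span_finite)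
  then have v: "v = (\<Sum>i\<in>UNIV. u (e i) *\<^sub>R e i)"
    by (simp add: sum.reindex[OF inj])
  have "h v (e i) = u (e i)" for i unfolding v by (rule hc)
  then show ?thesis using v by simp
qed

text \<open>The trace of a bilinear map is invariant because the matrix
  \<open>h (e i) (e' j)\<close> between the two frames has orthonormal columns, which is the fact
  \<open>d\<close> below.\<close>

lemma sum_frame_bilinear:
  fixes B :: "vec7 \<Rightarrow> vec7 \<Rightarrow> 'b::real_vector"
  assumes e: "orthonormal_frame h e" and e': "orthonormal_frame h e'"
    and B1: "\<And>y. linear (\<lambda>x. B x y)" and B2: "\<And>x. linear (B x)"
  shows "(\<Sum>i\<in>UNIV. B (e i) (e i)) = (\<Sum>i\<in>UNIV. B (e' i) (e' i))"
proof -
  have "h (e' j) (e' k) = (\<Sum>i\<in>UNIV. h (e i) (e' j) * h (e i) (e' k))" for j k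
    by (subst orthonormal_expand[OF e, of "e' j"])
      (simp add: linear_sum[OF lin1] linear_cmul[OF lin1] sym[of "e' j"])
  then have d: "(\<Sum>i\<in>UNIV. h (e i) (e' j) * h (e i) (e' k)) = (if j = k then 1 else 0)" for j k
    using e' unfolding orthonormal_frame_def by metis
  have "(\<Sum>i\<in>UNIV. B (e i) (e i)) = (\<Sum>i\<in>UNIV. \<Sum>j\<in>UNIV. \<Sum>k\<in>UNIV. (h (e i) (e' j) * h (e i) (e' k))
      *\<^sub>R B (e' j) (e' k))"
  proof (rule sum.cong[OF refl])
    fix i
    have "B (e i) (e i) = B (\<Sum>j\<in>UNIV. h (e i) (e' j) *\<^sub>R e' j) (\<Sum>k\<in>UNIV. h (e i) (e' k) *\<^sub>R e' k)"
      using orthonormal_expand[OF e', of "e i"] by simp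
    then show
        "B (e i) (e i) = (\<Sum>j\<in>UNIV. \<Sum>k\<in>UNIV. (h (e i) (e' j) * h (e i) (e' k)) *\<^sub>R B (e' j) (e' k))"
      by (subst sum.swap) (simp add: linear_sum[OF B1] linear_cmul[OF B1] linear_sum[OF B2]
          linear_cmul[OF B2] scaleR_sum_right mult.commute)
  qed
  also have "\<dots> = (\<Sum>j\<in>UNIV. \<Sum>k\<in>UNIV. \<Sum>i\<in>UNIV. (h (e i) (e' j) * h (e i) (e' k)) *\<^sub>R B (e' j) (e' k))"
    by (subst sum.swap, rule sum.cong[OF refl], rule sum.swap)
  also have "\<dots> = (\<Sum>j\<in>UNIV. B (e' j) (e' j))"
    unfolding scaleR_sum_left[symmetric] d
    by (simp add: if_distrib[of "\<lambda>c. c *\<^sub>R _"] cong: if_cong)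
  finally show ?thesis .
qed

text \<open>The frame is exchanged slot by slot: the induction hypothesis, applied to interior
  products, treats the last k slots, and \<open>sum_frame_bilinear\<close> treats the first.\<close>

lemma sum_frame_forms:
  assumes e: "orthonormal_frame h e" and e': "orthonormal_frame h e'"
    and "multilinear_form k a" "multilinear_form k b"
  shows "(\<Sum>I | length I = k. a (map e I) * b (map e I)) = (\<Sum>I | length I
      = k. a (map e' I) * b (map e' I))"
  using assms(3,4)
proof (induction k arbitrary: a b)
  case (Suc k)
  have "(\<Sum>I | length I = Suc k. a (map e I) * b (map e I))
      = (\<Sum>i\<in>UNIV. \<Sum>I | length I = k. interior_prod (e i) a (map e I) * interior_prod (e i) b
          (map e I))"
    by (simp add: sum_lists_Suc interior_prod_def)
  also have "\<dots> = (\<Sum>i\<in>UNIV. \<Sum>I | length I = k. a (e i # map e' I) * b (e i # map e' I))"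
    unfolding Suc.IH[OF Suc.prems[THEN multilinear_interior_prod]] by (simp add: interior_prod_def)
  also have "\<dots> = (\<Sum>I | length I = k. \<Sum>i\<in>UNIV. a (e i # map e' I) * b (e i # map e' I))"
    by (rule sum.swap)
  also have "\<dots> = (\<Sum>I | length I = k. \<Sum>i\<in>UNIV. a (e' i # map e' I) * b (e' i # map e' I))"
  proof (rule sum.cong[OF refl])
    fix I :: "7 list" assume "I \<in> {I. length I = k}"
    then have l: "linear (\<lambda>u. a (u # map e' I))" "linear (\<lambda>u. b (u # map e' I))"
      using Suc.prems by (auto intro!: multilinear_form_Cons)
    show "(\<Sum>i\<in>UNIV. a (e i # map e' I) * b (e i # map e' I))
        = (\<Sum>i\<in>UNIV. a (e' i # map e' I) * b (e' i # map e' I))"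
    proof (rule sum_frame_bilinear[OF e e', where B = "\<lambda>x y. a (x # map e' I) * b (y # map e' I)"])
      show "linear (\<lambda>x. a (x # map e' I) * b (y # map e' I))" for y
        using linear_compose_scale_right[OF l(1), of "b (y # map e' I)"] by (simp add: mult.commute)
      show "linear (\<lambda>y. a (x # map e' I) * b (y # map e' I))" for x
        using linear_compose_scale_right[OF l(2), of "a (x # map e' I)"] by simp
    qed
  qed
  also have "\<dots> = (\<Sum>i\<in>UNIV. \<Sum>I | length I = k. a (e' i # map e' I) * b (e' i # map e' I))"
    by (rule sum.swap)
  finally show ?case by (simp add: sum_lists_Suc)
qed simp

lemma some_orthonormal_frame:
  "orthonormal_frame h e \<Longrightarrow> orthonormal_frame h (some_orthonormal_frame h)"
  unfolding some_orthonormal_frame_def by (rule someI[of "orthonormal_frame h"])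

text \<open>This replaces the frame chosen inside \<open>form_inner\<close> by the Cayley frame at
  hand.\<close>

lemma form_inner_frame:
  assumes e: "orthonormal_frame h e" and "multilinear_form k a" "multilinear_form k b"
  shows "form_inner h k a b = 1 / fact k * (\<Sum>I | length I = k. a (map e I) * b (map e I))"
  unfolding form_inner_def Let_def
  using sum_frame_forms[OF some_orthonormal_frame[OF e] e assms(2,3)] by simp

end

section \<open>The Hodge dual of the three-form\<close>

lemma wedge_vecs_3:
  "wedge_vecs h [x, y, z] [u, v, w] =
    h x u * (h y v * h z w - h y w * h z v) - h x v * (h y u * h z w - h y w * h z u)
    + h x w * (h y u * h z v - h y v * h z u)"
  by (simp add: wedge_vecs_def vec_wedge_def omit_def lessThan_Suc algebra_simps)

lemma sum_lists_2: "(\<Sum>I | length I = 2. F I) = (\<Sum>a\<in>UNIV. \<Sum>b\<in>UNIV. F [a, b])"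
    for F :: "'a::finite list \<Rightarrow> real"
  unfolding numeral_2_eq_2 sum_lists_Suc sum_lists_0 ..

lemma sum_lists_3: "(\<Sum>I | length I = 3. F I) = (\<Sum>a\<in>UNIV. \<Sum>b\<in>UNIV. \<Sum>c\<in>UNIV. F [a, b, c])"
    for F :: "'a::finite list \<Rightarrow> real"
  unfolding numeral_3_eq_3 sum_lists_Suc sum_lists_0 ..

lemma sum_lists_4:
    "(\<Sum>I | length I = 4. F I) = (\<Sum>a\<in>UNIV. \<Sum>b\<in>UNIV. \<Sum>c\<in>UNIV. \<Sum>d\<in>UNIV. F [a, b, c, d])"
    for F :: "'a::finite list \<Rightarrow> real"
proof -
  have "4 = Suc (Suc (Suc (Suc 0)))" by simp
  then show ?thesis by (simp only: sum_lists_Suc sum_lists_0)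
qed

lemma length_3_conv: "length vs = 3 \<longleftrightarrow> (\<exists>u v w. vs = [u, v, w])"
  by (auto simp: numeral_3_eq_3 length_Suc_conv)

lemma length_4_conv: "length vs = 4 \<longleftrightarrow> (\<exists>u v w x. vs = [u, v, w, x])"
proof -
  have "4 = Suc (Suc (Suc (Suc 0)))" by simp
  then show ?thesis by (simp only: length_Suc_conv) auto
qed

lemma multilinear_3I:
  assumes "\<And>v w. linear (\<lambda>u. a [u, v, w])" "\<And>u w. linear (\<lambda>v. a [u, v, w])"
      "\<And>u v. linear (\<lambda>w. a [u, v, w])"
  shows "multilinear_form 3 a"
  unfolding multilinear_form_def length_3_conv using assms
      by (auto simp: numeral_3_eq_3 less_Suc_eq)

text \<open>The first argument is inserted into the increasing b, c, d by successive transpositions;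
  \<open>alternating3_zero\<close> then sorts the last three arguments.\<close>

lemma alternating4_zero:
  fixes T :: "'a::linorder \<Rightarrow> 'a \<Rightarrow> 'a \<Rightarrow> 'a \<Rightarrow> real"
  assumes T1: "\<And>a b c d. T b a c d = - T a b c d" and T2: "\<And>a b c d. T a c b d = - T a b c d"
    and T3: "\<And>a b c d. T a b d c = - T a b c d"
    and T0: "\<And>a b c d. a < b \<Longrightarrow> b < c \<Longrightarrow> c < d \<Longrightarrow> T a b c d = 0"
  shows "T a b c d = 0"
proof -
  have "T a b c d = 0" if "b < c" "c < d" for a b c d
  proof -
    have z: "T a a c d = 0" "T a b b d = 0" "T a b c c = 0" for a b c d
      using T1[of a a c d] T2[of a b b d] T3[of a b c c] by simp_all
    consider "a < b" | "a = b" | "b < a" "a < c" | "a = c" | "c < a" "a < d" | "a = d" | "d < a"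
        by fastforce
    then show ?thesis
    proof cases
      case 1 then show ?thesis using T0 that by blast
    next
      case 2 then show ?thesis using z by simp
    next
      case 3 then show ?thesis using T0[of b a c d] that T1[of a b c d] by simp
    next
      case 4 then show ?thesis using T1[of c b c d] z by simp
    next
      case 5 then show ?thesis using T0[of b c a d] that T1[of a b c d] T2[of b a c d] by simp
    next
      case 6 then show ?thesis using T1[of d b c d] T2[of b d c d] z by simp
    next
      case 7 then show ?thesis
          using T0[of b c d a] that T1[of a b c d] T2[of b a c d] T3[of b c a d] by simp
    qed
  qed
  then show ?thesis
    using alternating3_zero[where T = "T a"] T2 T3 by blast
qed

text \<open>A determinant of Kronecker symbols as a recursion that the simplifier can evaluate. If
  \<open>js\<close> rearranges the distinct list \<open>ms\<close>, the value is the sign of the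
  rearrangement.\<close>

fun perm_sign :: "7 list \<Rightarrow> 7 list \<Rightarrow> real" where
  "perm_sign [] js = 1"
| "perm_sign (m # ms) js =
    (if m \<in> set js then (- 1) ^ length (takeWhile (\<lambda>j. j \<noteq> m) js) * perm_sign ms
        (remove1 m js) else 0)"

context frame
begin

lemma linear_eq_on_frame:
  assumes e: "orthonormal_frame h e" and "linear F" "linear G" and "\<And>i. F (e i) = G (e i)"
  shows "F v = G v"
  by (subst (1 2) orthonormal_expand[OF e, of v]) (simp add: linear_sum assms linear_cmul)

lemma frame_eq_kron: "orthonormal_frame h e \<Longrightarrow> h (e i) (e j) = kron i j"
  by (simp add: orthonormal_frame_def kron_def)

lemma vec_wedge_frame:
  assumes e: "orthonormal_frame h e" and js: "distinct js"
  shows "vec_wedge h (e m) a (map e js) =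
    (if m \<in> set js then (- 1) ^ length (takeWhile (\<lambda>j. j \<noteq> m) js) * a (map e
        (remove1 m js)) else 0)"
proof (cases "m \<in> set js")
  case False
  then have "h (e m) (map e js ! i) = 0" if "i < length js" for i
    using that by (auto simp: frame_eq_kron[OF e] kron_def)
  then show ?thesis using False by (simp add: vec_wedge_def)
next
  case True
  then obtain pre post where js_eq: "js = pre @ m # post" and pre: "m \<notin> set pre"
    by (meson split_list_first)
  have z: "h (e m) (map e js ! i) = (if i = length pre then 1 else 0)" if "i < length js" for i
  proof -
    have "js ! i = m \<longleftrightarrow> i = length pre"
      using js that nth_eq_iff_index_eq[of js i "length pre"] unfolding js_eq by auto
    then show ?thesis using that by (auto simp: frame_eq_kron[OF e] kron_def)
  qed
  have "vec_wedge h (e m) a (map e js) = (\<Sum>i<length js. if i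
      = length pre then (- 1) ^ i * a (omit i (map e js)) else 0)"
    unfolding vec_wedge_def using z by (intro sum.cong) (auto simp del: nth_map)
  also have "\<dots> = (- 1) ^ length pre * a (omit (length pre) (map e js))"
    by (simp add: js_eq)
  also have "omit (length pre) (map e js) = map e (remove1 m js)"
    using omit_append[of "map e pre"] pre by (simp add: js_eq remove1_append)
  also have "length pre = length (takeWhile (\<lambda>j. j \<noteq> m) js)"
    using pre by (auto simp: js_eq takeWhile_append)
  finally show ?thesis using True by simp
qed

lemma wedge_vecs_frame:
  assumes e: "orthonormal_frame h e"
  shows "distinct js \<Longrightarrow> wedge_vecs h (map e ms) (map e js) = perm_sign ms js"
proof (induction ms arbitrary: js)
  case (Cons m ms)
  have "wedge_vecs h (map e (m # ms)) = vec_wedge h (e m) (wedge_vecs h (map e ms))"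
    by (simp add: wedge_vecs_def)
  then show ?case using Cons by (simp add: vec_wedge_frame[OF e] distinct_remove1)
qed (simp add: wedge_vecs_def)

lemma alternating_hodge:
  assumes vol: "alternating_form 7 vol"
  shows "alternating_form 4 (hodge h vol 3 a)"
  unfolding alternating_form_def
proof (intro allI impI conjI)
  fix vs :: "vec7 list" and i :: nat assume vs: "length vs = 4" "i < 4"
  have "linear (\<lambda>u. vol (us @ vs[i := u]))" if "length us = 3" for us
  proof -
    have "linear (\<lambda>u. vol ((us @ vs)[3 + i := u]))"
      using vol[unfolded alternating_form_def, rule_format, of "us @
          vs", THEN conjunct1, rule_format, of "3 + i"] vs that by simp
    then show ?thesis using that by (simp add: list_update_append)
  qed
  then show "linear (\<lambda>u. hodge h vol 3 a (vs[i := u]))"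
    unfolding hodge_def form_inner_def Let_def
    by (intro linear_compose_scale_right[where 'b = real, simplified real_scaleR_def]
        linear_compose_sum ballI) auto
next
  fix vs :: "vec7 list" and i j :: nat
  assume vs: "length vs = 4" "i < 4" "j < 4" "i \<noteq> j \<and> vs ! i = vs ! j"
  have "vol (us @ vs) = 0" if "length us = 3" for us
    using vs that by (intro alternating_form_zero[OF vol, of _ "3 + i" "3 + j"])
        (auto simp: nth_append)
  then show "hodge h vol 3 a vs = 0"
    unfolding hodge_def form_inner_def Let_def by simp
qed

end

text \<open>A summand survives only if its line is the complement of {a, b, c, d}. The check on
  increasing quadruples is where the orientation and the sign in the definition of
  \<open>fano_star\<close> are seen to agree.\<close>

lemma perm_sign_values:
  assumes "a < b" "b < c" "c < d"
  shows "(\<Sum>l\<in>UNIV. if distinct [l, l + 1, l + 3, a, b, c, d] then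
      perm_sign [0, 1, 2, 3, 4, 5, 6] [l, l + 1, l + 3, a, b, c, d] else 0) = fano_star a b c d"
proof -
  have "\<forall>b. m < b \<longrightarrow> (\<forall>c. b < c \<longrightarrow> (\<forall>d. c < d \<longrightarrow>
    (\<Sum>l\<in>UNIV. if distinct [l, l + 1, l + 3, m, b, c, d] then
      perm_sign [0, 1, 2, 3, 4, 5, 6] [l, l + 1, l + 3, m, b, c, d] else 0) = fano_star 0 (b - m)
          (c - m) (d - m)))"
    if "m \<in> {0, 1, 2, 3, 4, 5, 6}" for m
    using that
    by (elim insertE emptyE; hypsubst; simp only: all_greater_7 simp_thms)
      (simp_all add: fano_0 fano_star_0 kron_def sum_7 numeral_7)
  then show ?thesis
    using assms fano_star_eq[of a] unfolding UNIV_7[symmetric] by simp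
qed

lemma linear_scale_fun:
  fixes F :: "'a::real_vector \<Rightarrow> real"
  assumes "linear F" shows "linear (\<lambda>u. c * F u)" "linear (\<lambda>u. F u * c)"
  using linear_compose_scale_right[OF assms, of c] by (simp_all add: mult.commute)

locale cayley = frame +
  fixes f :: form and e :: "7 \<Rightarrow> vec7"
  assumes alt: "alternating_form 3 f" and cay: "cayley_frame h f e"
begin

lemma e_orth: "orthonormal_frame h e"
  using cay by (simp add: cayley_frame_def)

lemmas h_e = frame_eq_kron[OF e_orth]

lemma f_e: "f [e a, e b, e c] = fano a b c"
  using cay by (simp add: cayley_frame_def wedge_vecs_3 fano_def h_e)

lemma f_lin: "linear (\<lambda>u. f [u, v, w])" "linear (\<lambda>v. f [u, v, w])" "linear (\<lambda>w. f [u, v, w])"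
  using alternating_form_linear[OF alt, of "[]" "[v, w]"]
      alternating_form_linear[OF alt, of "[u]" "[w]"]
    alternating_form_linear[OF alt, of "[u, v]" "[]"] by simp_all

lemma f_swap: "f [v, u, w] = - f [u, v, w]" "f [u, w, v] = - f [u, v, w]"
  using alternating_form_swap[OF alt, of "[]" "[w]" v u]
      alternating_form_swap[OF alt, of "[u]" "[]" w v] by simp_all

lemmas f_multilinear = alternating_imp_multilinear[OF alt]

abbreviation vol_e :: form where
  "vol_e \<equiv> wedge_vecs h (map e [0, 1, 2, 3, 4, 5, 6])"

lemma alternating_vol_e: "alternating_form 7 vol_e"
proof -
  have "length (map e [0, 1, 2, 3, 4, 5, 6]) = 7" by simp
  then show ?thesis using alternating_wedge_vecs[of h "map e [0, 1, 2, 3, 4, 5, 6]", OF lin2]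
      by metis
qed

lemma vol_e_basis:
  assumes "length js = 7"
  shows "vol_e (map e js) = (if distinct js then perm_sign [0, 1, 2, 3, 4, 5, 6] js else 0)"
proof (cases "distinct js")
  case True
  then show ?thesis by (simp only: wedge_vecs_frame[OF e_orth True] if_True)
next
  case False
  then obtain m n where mn: "m < 7" "n < 7" "m \<noteq> n" "js ! m = js ! n"
    unfolding distinct_conv_nth assms by auto
  have "vol_e (map e js) = 0"
    using mn assms by (intro alternating_form_zero[OF alternating_vol_e _ mn(1-3)])
        (simp_all del: list.map(2))
  then show ?thesis using False by (simp only: if_False)
qed

lemma star_e: "hodge h vol_e 3 f [e a, e b, e c, e d] = fano_star a b c d"
proof -
  define V where "V i j k a b c d = vol_e (map e [i, j, k, a, b, c, d])" for i j k a b c d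
  have sw: "vol_e (pre @ y # x # post) = - vol_e (pre @ x # y # post)"
      if "length pre + length post = 5" for pre x y post
    by (rule alternating_form_swap[OF alternating_vol_e]) (use that in simp)
  have V1: "V j i k a b c d = - V i j k a b c d" for i j k a b c d
    using sw[of "[]" "map e [k, a, b, c, d]" "e j" "e i"] by (simp add: V_def)
  have V2: "V i k j a b c d = - V i j k a b c d" for i j k a b c d
    using sw[of "map e [i]" "map e [a, b, c, d]" "e k" "e j"] by (simp add: V_def)
  have V4: "V i j k b a c d = - V i j k a b c d" for i j k a b c d
    using sw[of "map e [i, j, k]" "map e [c, d]" "e b" "e a"] by (simp add: V_def)
  have V5: "V i j k a c b d = - V i j k a b c d" for i j k a b c d
    using sw[of "map e [i, j, k, a]" "map e [d]" "e c" "e b"] by (simp add: V_def)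
  have V6: "V i j k a b d c = - V i j k a b c d" for i j k a b c d
    using sw[of "map e [i, j, k, a, b]" "[]" "e d" "e c"] by (simp add: V_def)
  have V: "V i j k a b c d = (if distinct [i, j, k, a, b, c, d]
      then perm_sign [0, 1, 2, 3, 4, 5, 6] [i, j, k, a, b, c, d] else 0)" for i j k a b c d
    unfolding V_def by (rule vol_e_basis) simp
  have star: "hodge h vol_e 3 f (map e [a, b, c, d]) = (\<Sum>l\<in>UNIV. V l (l + 1) (l + 3) a b c d)"
      for a b c d
  proof -
    have "multilinear_form 3 (\<lambda>us. vol_e (us @ map e [a, b, c, d]))"
      using alternating_form_linear[OF alternating_vol_e, of "[]"]
        alternating_form_linear[OF alternating_vol_e, of "[_]"]
            alternating_form_linear[OF alternating_vol_e, of "[_, _]"]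
      by (intro multilinear_3I) simp_all
    then have "hodge h vol_e 3 f (map e [a, b, c, d]) =
        1 / 6 * (\<Sum>i\<in>UNIV. \<Sum>j\<in>UNIV. \<Sum>k\<in>UNIV. fano i j k * V i j k a b c d)"
      unfolding hodge_def
      by (subst form_inner_frame[OF e_orth f_multilinear])
        (simp_all add: sum_lists_3 f_e V_def fact_numeral)
    also have "(\<Sum>i\<in>UNIV. \<Sum>j\<in>UNIV. \<Sum>k\<in>UNIV. fano i j k * V i j k a b c d)
       = (\<Sum>i\<in>UNIV. \<Sum>j\<in>UNIV. \<Sum>k\<in>UNIV. \<Sum>l\<in>UNIV.
           kron l i * (kron (l + 1) j * (kron (l + 3) k * V i j k a b c d))
         - kron l i * (kron (l + 3) j * (kron (l + 1) k * V i j k a b c d))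
         - kron (l + 1) i * (kron l j * (kron (l + 3) k * V i j k a b c d))
         + kron (l + 3) i * (kron l j * (kron (l + 1) k * V i j k a b c d))
         + kron (l + 1) i * (kron (l + 3) j * (kron l k * V i j k a b c d))
         - kron (l + 3) i * (kron (l + 1) j * (kron l k * V i j k a b c d)))"
      unfolding fano_def sum_distrib_right
      by (intro sum.cong refl) (simp add: algebra_simps)
    also have "\<dots> = (\<Sum>l\<in>UNIV. \<Sum>i\<in>UNIV. \<Sum>j\<in>UNIV. \<Sum>k\<in>UNIV.
           kron l i * (kron (l + 1) j * (kron (l + 3) k * V i j k a b c d))
         - kron l i * (kron (l + 3) j * (kron (l + 1) k * V i j k a b c d))
         - kron (l + 1) i * (kron l j * (kron (l + 3) k * V i j k a b c d))
         + kron (l + 3) i * (kron l j * (kron (l + 1) k * V i j k a b c d))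
         + kron (l + 1) i * (kron (l + 3) j * (kron l k * V i j k a b c d))
         - kron (l + 3) i * (kron (l + 1) j * (kron l k * V i j k a b c d)))"
      by (rule sum4_rot)
    \<comment> \<open>The six terms of each determinant all equal \<open>V l (l + 1) (l + 3)\<close>
      once its arguments are reordered, which cancels 1/3!.\<close>
    also have "\<dots> = (\<Sum>l\<in>UNIV. 6 * V l (l + 1) (l + 3) a b c d)"
    proof (rule sum.cong[OF refl])
      fix l
      show "(\<Sum>i\<in>UNIV. \<Sum>j\<in>UNIV. \<Sum>k\<in>UNIV.
           kron l i * (kron (l + 1) j * (kron (l + 3) k * V i j k a b c d))
         - kron l i * (kron (l + 3) j * (kron (l + 1) k * V i j k a b c d))
         - kron (l + 1) i * (kron l j * (kron (l + 3) k * V i j k a b c d))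
         + kron (l + 3) i * (kron l j * (kron (l + 1) k * V i j k a b c d))
         + kron (l + 1) i * (kron (l + 3) j * (kron l k * V i j k a b c d))
         - kron (l + 3) i * (kron (l + 1) j * (kron l k * V i j k a b c d))) = 6 * V l (l + 1)
             (l + 3) a b c d"
        unfolding sum.distrib sum_subtractf
        unfolding sum_distrib_left[symmetric] sum_kron
        using V2[of l "l + 3" "l + 1" a b c d] V1[of "l + 1" l "l + 3" a b c d]
          V2[of "l + 1" l "l + 3" a b c d] V1[of "l + 3" l "l + 1" a b c d]
          V1[of "l + 3" "l + 1" l a b c d] by simp
    qed
    finally show ?thesis by (simp flip: sum_distrib_left)
  qed
  define T where "T a b c d = (\<Sum>l\<in>UNIV. V l (l + 1) (l + 3) a b c d) - fano_star a b c d"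
      for a b c d
  have "T a b c d = 0"
  proof (rule alternating4_zero[where T = T])
    show "T b a c d = - T a b c d" for a b c d
      unfolding T_def V4[of _ _ _ b a] fano_star_swap12[of b a] sum_negf by simp
    show "T a c b d = - T a b c d" for a b c d
      unfolding T_def V5[of _ _ _ a c b] fano_star_swap23[of a c b] sum_negf by simp
    show "T a b d c = - T a b c d" for a b c d
      unfolding T_def V6[of _ _ _ a b d c] fano_star_swap34[of a b d c] sum_negf by simp
    show "T a b c d = 0" if "a < b" "b < c" "c < d" for a b c d
      unfolding T_def V perm_sign_values[OF that] by simp
  qed
  then show ?thesis using star[of a b c d] by (simp add: T_def)
qed

text \<open>The right-hand side does not involve the Cayley frame, so all Cayley frames give the same dual.
  This replaces the argument that they induce the same orientation.\<close>

lemma star_formula: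
  assumes E: "orthonormal_frame h E"
  shows "hodge h vol_e 3 f [u, v, w, x] =
    h u w * h v x - h u x * h v w - (\<Sum>k\<in>UNIV. f [u, v, E k] * f [w, x, E k])"
proof -
  have "(\<Sum>k\<in>UNIV. f [u, v, E k] * f [w, x, E k]) = (\<Sum>k\<in>UNIV. f [u, v, e k] * f [w, x, e k])"
    by (rule sum_frame_bilinear[OF E e_orth, of "\<lambda>p q. f [u, v, p] * f [w, x, q]"]; intro
        linear_scale_fun f_lin)
  moreover
  let ?L = "\<lambda>u v w x. hodge h vol_e 3 f [u, v, w, x]"
  let ?R = "\<lambda>u v w x. h u w * h v x - h u x * h v w - (\<Sum>k\<in>UNIV. f [u, v, e k] * f [w, x, e k])"
  note alt4 = alternating_hodge[OF alternating_vol_e, of f]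
  have L: "linear (\<lambda>u. ?L u v w x)" "linear (\<lambda>v. ?L u v w x)" "linear (\<lambda>w. ?L u v w x)"
      "linear (\<lambda>x. ?L u v w x)" for u v w x
    using alternating_form_linear[OF alt4, of "[]" "[v, w, x]"]
        alternating_form_linear[OF alt4, of "[u]" "[w, x]"]
      alternating_form_linear[OF alt4, of "[u, v]" "[x]"]
          alternating_form_linear[OF alt4, of "[u, v, w]" "[]"] by simp_all
  have R: "linear (\<lambda>u. ?R u v w x)" "linear (\<lambda>v. ?R u v w x)" "linear (\<lambda>w. ?R u v w x)"
      "linear (\<lambda>x. ?R u v w x)" for u v w x
    by (intro linear_compose_sub linear_compose_sum ballI linear_scale_fun lin1 lin2 f_lin)+
  have 0: "?L (e a) (e b) (e c) (e d) = ?R (e a) (e b) (e c) (e d)" for a b c d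
    unfolding star_e by (simp add: f_e h_e fano_star_def)
  have 1: "?L u (e b) (e c) (e d) = ?R u (e b) (e c) (e d)" for u b c d
    by (rule linear_eq_on_frame[OF e_orth L(1) R(1)]) (rule 0)
  have 2: "?L u v (e c) (e d) = ?R u v (e c) (e d)" for u v c d
    by (rule linear_eq_on_frame[OF e_orth L(2) R(2)]) (rule 1)
  have 3: "?L u v w (e d) = ?R u v w (e d)" for u v w d
    by (rule linear_eq_on_frame[OF e_orth L(3) R(3)]) (rule 2)
  have "?L u v w x = ?R u v w x"
    by (rule linear_eq_on_frame[OF e_orth L(4) R(4)]) (rule 3)
  ultimately show ?thesis by simp
qed

definition star :: form where
  "star = hodge h (g2_volume h f) 3 f"

lemma some_cayley: "cayley h f (SOME e. cayley_frame h f e)"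
  by (intro cayley.intro cayley_axioms.intro frame_axioms alt)
      (rule someI[of "cayley_frame h f", OF cay])

lemma alternating_star: "alternating_form 4 star"
  unfolding star_def g2_volume_def Let_def
  by (rule alternating_hodge[OF cayley.alternating_vol_e[OF some_cayley]])

text \<open>The volume form in \<open>star\<close> belongs to a Cayley frame picked by
  \<open>SOME\<close>, in general different from \<open>e\<close>. Applying
  \<open>star_formula\<close> to the picked frame, with \<open>E\<close> taken to be
  \<open>e\<close>, carries the evaluation over to \<open>e\<close>.\<close>

lemma star_fano: "star [e a, e b, e c, e d] = fano_star a b c d"
  unfolding star_def g2_volume_def Let_def cayley.star_formula[OF some_cayley e_orth]
  by (simp add: f_e h_e fano_star_def)

end

lemma linear_form_inner:
  assumes "\<And>vs. length vs = k \<Longrightarrow> linear (\<lambda>x. a x vs)"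
  shows "linear (\<lambda>x. form_inner h k (a x) b)" "linear (\<lambda>x. form_inner h k b (a x))"
  unfolding form_inner_def Let_def
  by (intro linear_scale_fun linear_compose_sum ballI; use assms in simp)+

section \<open>Skew endomorphisms and the stabiliser in a Cayley frame\<close>

context cayley
begin

lemma sum_h_linear:
  fixes F :: "vec7 \<Rightarrow> real"
  assumes "linear F"
  shows "(\<Sum>d\<in>UNIV. h u (e d) * F (e d)) = F u"
proof -
  have "F u = F (\<Sum>d\<in>UNIV. h u (e d) *\<^sub>R e d)"
    using orthonormal_expand[OF e_orth, of u] by simp
  then show ?thesis by (simp add: linear_sum[OF assms] linear_cmul[OF assms])
qed

lemmas sum_h_f = f_lin[THEN sum_h_linear]

lemma sum_der_e:
  "f [B (e a), e b, e c] + f [e a, B (e b), e c] + f [e a, e b, B (e c)]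
    = der_fano (\<lambda>a d. h (B (e a)) (e d)) a b c"
  unfolding der_fano_def sum.distrib by (simp add: sum_h_f flip: f_e)

lemma so_alg_skew:
  assumes "B \<in> so_alg h"
  shows "skew (\<lambda>a d. h (B (e a)) (e d))"
  unfolding skew_def
proof (intro allI)
  fix a b
  from assms have "h (B (e b)) (e a) = - h (e b) (B (e a))" by (simp add: so_alg_def)
  then show "h (B (e b)) (e a) = - h (B (e a)) (e b)" using sym[of "e b"] by simp
qed

lemma so_alg_linear: "B \<in> so_alg h \<Longrightarrow> linear B"
  by (simp add: so_alg_def)

lemma multilinear_der:
  assumes "linear B"
  shows "linear (\<lambda>u. f [B u, v, w] + f [u, B v, w] + f [u, v, B w])"
    "linear (\<lambda>v. f [B u, v, w] + f [u, B v, w] + f [u, v, B w])"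
    "linear (\<lambda>w. f [B u, v, w] + f [u, B v, w] + f [u, v, B w])"
  using linear_compose[OF assms f_lin(1)] linear_compose[OF assms f_lin(2)]
      linear_compose[OF assms f_lin(3)]
  by (auto intro!: linear_compose_add f_lin simp: o_def)

lemma trilinear_eq_on_frame:
  assumes F: "\<And>v w. linear (\<lambda>u. F u v w)" "\<And>u w. linear (\<lambda>v. F u v w)" "\<And>u v. linear (\<lambda>w. F u v w)"
    and G: "\<And>v w. linear (\<lambda>u. G u v w)" "\<And>u w. linear (\<lambda>v. G u v w)" "\<And>u v. linear (\<lambda>w. G u v w)"
    and eq: "\<And>a b c. F (e a) (e b) (e c) = G (e a) (e b) (e c)"
  shows "F u v w = G u v w"
proof -
  have 1: "F u (e b) (e c) = G u (e b) (e c)" for u b c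
    by (rule linear_eq_on_frame[OF e_orth F(1) G(1)]) (rule eq)
  have 2: "F u v (e c) = G u v (e c)" for u v c
    by (rule linear_eq_on_frame[OF e_orth F(2) G(2)]) (rule 1)
  show ?thesis
    by (rule linear_eq_on_frame[OF e_orth F(3) G(3)]) (rule 2)
qed

lemma h_expand: "(\<And>i. h w (e i) = h w' (e i)) \<Longrightarrow> w = w'"
  using orthonormal_expand[OF e_orth, of w] orthonormal_expand[OF e_orth, of w'] by simp

lemma h_cross: "h (cross_prod h f x y) z = f [x, y, z]"
proof -
  \<comment> \<open>The vector with these components in the frame is the witness for the definite
    description; \<open>h_expand\<close> gives its uniqueness.\<close>
  let ?w = "\<Sum>k\<in>UNIV. f [x, y, e k] *\<^sub>R e k"
  have w: "\<forall>z. h ?w z = f [x, y, z]"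
  proof
    fix z
    show "h ?w z = f [x, y, z]"
    proof (rule linear_eq_on_frame[OF e_orth lin2 f_lin(3)])
      fix i show "h ?w (e i) = f [x, y, e i]"
        unfolding linear_sum[OF lin1] linear_cmul[OF lin1] h_e by (simp add: sum_kron)
    qed
  qed
  then have "cross_prod h f x y = ?w"
    unfolding cross_prod_def by (rule the_equality) (use w in \<open>auto intro: h_expand\<close>)
  then show ?thesis using w by simp
qed

lemma cross_lin: "linear (\<lambda>x. cross_prod h f x y)" "linear (\<lambda>y. cross_prod h f x y)"
proof -
  show "linear (\<lambda>x. cross_prod h f x y)"
    by (rule linearI; rule h_expand)
      (simp_all add: h_cross linear_add[OF lin1] linear_cmul[OF lin1] linear_add[OF f_lin(1)]
          linear_cmul[OF f_lin(1)])
  show "linear (\<lambda>y. cross_prod h f x y)"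
    by (rule linearI; rule h_expand)
      (simp_all add: h_cross linear_add[OF lin1] linear_cmul[OF lin1] linear_add[OF f_lin(2)]
          linear_cmul[OF f_lin(2)])
qed

lemma form_inner_two_form:
  assumes "linear B" "linear C"
  shows "form_inner h 2 (two_form_of h B) (two_form_of h C)
    = 1 / 2 * (\<Sum>a\<in>UNIV. \<Sum>b\<in>UNIV. h (B (e a)) (e b) * h (C (e a)) (e b))"
proof -
  have "multilinear_form 2 (two_form_of h B)" if "linear B" for B
    unfolding multilinear_form_def two_form_of_def
  proof (intro allI impI)
    fix vs :: "vec7 list" and i :: nat assume "length vs = 2" "i < 2"
    then consider "i = 0" | "i = 1" by linarith
    then show "linear (\<lambda>u. h (B (vs[i := u] ! 0)) (vs[i := u] ! 1))"
      using \<open>length vs = 2\<close> linear_compose[OF that lin1] lin2 by cases (auto simp: o_def)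
  qed
  from form_inner_frame[OF e_orth this[OF assms(1)] this[OF assms(2)]]
  show ?thesis by (simp add: sum_lists_2 two_form_of_def)
qed

text \<open>\<open>B\<close> is orthogonal to itself, so the squares of its components in the
  orthonormal frame sum to zero.\<close>

lemma g2_perp_inter:
  assumes "B \<in> g2_alg h f" "B \<in> g2_perp h f"
  shows "B y = 0"
proof -
  have so: "B \<in> so_alg h" using assms(2) by (simp add: g2_perp_def)
  have "form_inner h 2 (two_form_of h B) (two_form_of h B) = 0"
    using assms by (simp add: g2_perp_def)
  then have "(\<Sum>a\<in>UNIV. \<Sum>b\<in>UNIV. h (B (e a)) (e b) * h (B (e a)) (e b)) = 0"
    using form_inner_two_form so so_alg_linear by simp
  then have "h (B (e a)) (e b) = 0" for a b
    by (simp add: sum_nonneg_eq_0_iff sum_nonneg)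
  then have z: "B (e a) = 0" for a
    by (intro h_expand) (simp add: linear_0[OF lin1])
  show ?thesis
    by (rule linear_eq_on_frame[OF e_orth so_alg_linear[OF so], of "\<lambda>_. 0"])
        (simp_all add: z linear_zero)
qed

lemma star_linear1: "linear (\<lambda>u. star [u, v, w, x])"
  using alternating_form_linear[OF alternating_star, of "[]" "[v, w, x]"] by simp

end

section \<open>The intrinsic torsion at a point\<close>

text \<open>The problem at one point, reduced to linear algebra: \<open>T x\<close> stands for the
  covariant derivative of the three-form along x, and \<open>A x\<close> for a skew endomorphism
  that produces it.\<close>

locale cayley_der = cayley +
  fixes T :: "vec7 \<Rightarrow> form" and A :: "vec7 \<Rightarrow> vec7 \<Rightarrow> vec7"
  assumes A_so: "\<And>x. A x \<in> so_alg h"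
    and T_eq: "\<And>x u v w. T x [u, v, w] = f [A x u, v, w] + f [u, A x v, w] + f [u, v, A x w]"
    and T_lin: "\<And>u v w. linear (\<lambda>x. T x [u, v, w])"
begin

definition r :: "vec7 \<Rightarrow> vec7 \<Rightarrow> real" where
  "r x y = 1 / 4 * form_inner h 3 (T x) (interior_prod y star)"

definition xi :: "vec7 \<Rightarrow> vec7 \<Rightarrow> vec7" where
  "xi x y = - (1 / 3) *\<^sub>R (\<Sum>i\<in>UNIV. r x (e i) *\<^sub>R cross_prod h f (e i) y)"

lemma T_e: "T x [e a, e b, e c] = der_fano (\<lambda>a d. h (A x (e a)) (e d)) a b c"
  unfolding T_eq by (rule sum_der_e)

lemma T_lin_args: "linear (\<lambda>u. T x [u, v, w])" "linear (\<lambda>v. T x [u, v, w])"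
    "linear (\<lambda>w. T x [u, v, w])"
  unfolding T_eq using multilinear_der[OF so_alg_linear[OF A_so]] by simp_all

lemma T_multilinear: "multilinear_form 3 (T x)"
  by (rule multilinear_3I) (rule T_lin_args)+

lemma interior_star_multilinear: "multilinear_form 3 (interior_prod y star)"
  using alternating_imp_multilinear[OF alternating_star] by (intro multilinear_interior_prod) simp

lemma r_e: "r x (e k) = r_fano (\<lambda>a d. h (A x (e a)) (e d)) k"
  unfolding r_def r_fano_def form_inner_frame[OF e_orth T_multilinear interior_star_multilinear]
  using sum_der_fano_star[of "\<lambda>a d. h (A x (e a)) (e d)" k]
  by (simp add: sum_lists_3 T_e interior_prod_def star_fano fact_numeral)

lemma r_lin: "linear (\<lambda>x. r x y)" "linear (\<lambda>y. r x y)"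
proof -
  have "linear (\<lambda>x. T x vs)" "linear (\<lambda>y. interior_prod y star vs)" if "length vs = 3" for vs
    using that T_lin star_linear1 by (auto simp: length_3_conv interior_prod_def)
  then show "linear (\<lambda>x. r x y)" "linear (\<lambda>y. r x y)"
    unfolding r_def by (intro linear_scale_fun linear_form_inner; simp)+
qed

lemma T_star: "T x [e a, e b, e c] = (\<Sum>k\<in>UNIV. r x (e k) * fano_star k a b c)"
  unfolding T_e r_e by (rule der_fano_decomp[OF so_alg_skew[OF A_so]])

text \<open>The sum is the trace of a map bilinear in the two occurrences of the frame. Thus the
  frame in the theorem may differ from the smooth local frame in which the covariant derivative is
  expressed.\<close>

lemma xi_frame:
  assumes "orthonormal_frame h E"
  shows "xi x y = - (1 / 3) *\<^sub>R (\<Sum>i\<in>UNIV. r x (E i) *\<^sub>R cross_prod h f (E i) y)"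
proof -
  have "(\<Sum>i\<in>UNIV. r x (E i) *\<^sub>R cross_prod h f (E i) y)
      = (\<Sum>i\<in>UNIV. r x (e i) *\<^sub>R cross_prod h f (e i) y)"
  proof (rule sum_frame_bilinear[OF assms e_orth, of "\<lambda>u v. r x u *\<^sub>R cross_prod h f v y"])
    show "linear (\<lambda>u. r x u *\<^sub>R cross_prod h f v y)" for v
      by (rule linearI) (simp_all add: linear_add[OF r_lin(2)] linear_cmul[OF r_lin(2)]
          scaleR_add_left)
    show "linear (\<lambda>v. r x u *\<^sub>R cross_prod h f v y)" for u
      by (intro linear_compose_scale_right cross_lin)
  qed
  then show ?thesis by (simp add: xi_def)
qed

lemma xi_lin: "linear (\<lambda>x. xi x y)" "linear (xi x)"
proof -
  show "linear (\<lambda>x. xi x y)"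
    unfolding xi_def by (intro linear_compose_scale_right linear_compose_sum ballI)
      (rule linearI, simp_all add: linear_add[OF r_lin(1)] linear_cmul[OF r_lin(1)] scaleR_add_left)
  show "linear (xi x)"
    unfolding xi_def[abs_def] by (intro linear_compose_scale_right linear_compose_sum ballI
        cross_lin)
qed

lemma h_xi: "h (xi x u) v = - (1 / 3) * (\<Sum>i\<in>UNIV. r x (e i) * f [e i, u, v])"
  unfolding xi_def linear_cmul[OF lin1] linear_sum[OF lin1] by (simp add: h_cross)

lemma xi_so: "xi x \<in> so_alg h"
  unfolding so_alg_def
proof (intro CollectI conjI xi_lin(2) allI)
  fix u v
  have "h (xi x v) u = - h (xi x u) v"
    unfolding h_xi f_swap(2)[of _ v u] by (simp add: sum_negf)
  then show "h (xi x u) v = - h u (xi x v)" using sym[of u] by simp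
qed

lemma xi_T: "f [xi x u, v, w] + f [u, xi x v, w] + f [u, v, xi x w] = T x [u, v, w]"
proof (rule trilinear_eq_on_frame[where F = "\<lambda>u v w. f [xi x u, v, w] + f [u, xi x v, w]
    + f [u, v, xi x w]"])
  fix a b c
  have "h (xi x (e a)) (e d) = - (1 / 3) * (\<Sum>i\<in>UNIV. r x (e i) * fano i a d)" for a d
    by (simp add: h_xi f_e)
  then show "f [xi x (e a), e b, e c] + f [e a, xi x (e b), e c] + f [e a, e b, xi x (e c)]
      = T x [e a, e b, e c]"
    by (simp only: sum_der_e T_star der_fano_cross)
qed (rule multilinear_der[OF xi_lin(2)] T_lin_args)+

lemma xi_perp: "xi x \<in> g2_perp h f"
proof -
  have "form_inner h 2 (two_form_of h (xi x)) (two_form_of h C) = 0" if C: "C \<in> g2_alg h f" for C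
  proof -
    have so: "C \<in> so_alg h" using C by (simp add: g2_alg_def)
    define c where "c a d = h (C (e a)) (e d)" for a d
    have "der_fano c a b d = 0" for a b d
      unfolding c_def using sum_der_e[of C a b d] C by (simp add: g2_alg_def)
    \<comment> \<open>The action of \<open>C\<close> vanishes, and its contraction with the dual is
      -12 times this sum.\<close>
    then have z: "(\<Sum>a\<in>UNIV. \<Sum>d\<in>UNIV. c a d * fano k a d) = 0" for k
      using sum_der_fano_star[of c k] by simp
    have "(\<Sum>a\<in>UNIV. \<Sum>b\<in>UNIV. h (xi x (e a)) (e b) * c a b)
      = (\<Sum>a\<in>UNIV. \<Sum>b\<in>UNIV. \<Sum>i\<in>UNIV. - (1 / 3) * r x (e i) * (c a b * fano i a b))"
      unfolding h_xi sum_distrib_left sum_distrib_right by (simp add: f_e mult_ac)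
    also have "\<dots> = (\<Sum>i\<in>UNIV. - (1 / 3) * r x (e i) * (\<Sum>a\<in>UNIV. \<Sum>b\<in>UNIV. c a b * fano i a b))"
      unfolding sum_distrib_left by (rule sum3_rot)
    finally show ?thesis
      unfolding form_inner_two_form[OF xi_lin(2) so_alg_linear[OF so]] c_def[symmetric] z by simp
  qed
  then show ?thesis using xi_so by (simp add: g2_perp_def)
qed

lemma xi_unique:
  assumes B: "B \<in> g2_perp h f"
      and eq: "\<And>u v w. f [B u, v, w] + f [u, B v, w] + f [u, v, B w] = T x [u, v, w]"
  shows "B y = xi x y"
proof -
  have Bso: "B \<in> so_alg h" using B by (simp add: g2_perp_def)
  note Bl = so_alg_linear[OF Bso]
  let ?D = "\<lambda>y. B y - xi x y"
  have lD: "linear ?D" by (intro linear_compose_sub Bl xi_lin(2))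
  have Dso: "?D \<in> so_alg h"
    using Bso xi_so[of x] lD by (simp add: so_alg_def linear_diff[OF lin1] linear_diff[OF lin2])
  have "?D \<in> g2_alg h f"
    unfolding g2_alg_def using Dso eq xi_T[of x]
    by (simp add: linear_diff[OF f_lin(1)] linear_diff[OF f_lin(2)] linear_diff[OF f_lin(3)]
        algebra_simps)
  moreover have "?D \<in> g2_perp h f"
    unfolding g2_perp_def
  proof (intro CollectI conjI ballI Dso)
    fix C assume C: "C \<in> g2_alg h f"
    then have l: "linear C" by (simp add: g2_alg_def so_alg_def)
    have "form_inner h 2 (two_form_of h B) (two_form_of h C) = 0"
        "form_inner h 2 (two_form_of h (xi x)) (two_form_of h C) = 0"
      using B xi_perp C by (simp_all add: g2_perp_def)
    then show "form_inner h 2 (two_form_of h ?D) (two_form_of h C) = 0"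
      by (simp add: form_inner_two_form Bl xi_lin(2) lD l linear_diff[OF lin1] left_diff_distrib
          sum_subtractf)
  qed
  ultimately show ?thesis using g2_perp_inter[of ?D y] by simp
qed

text \<open>Both sides are bilinear in x and y, so it suffices to compare them on frame vectors,
  where \<open>r_from_ext\<close> applies. \<open>D\<close> plays the exterior derivative, and the
  separate frame \<open>E\<close> matches the one picked inside \<open>coderiv\<close>.\<close>

lemma r_identity:
  assumes E: "orthonormal_frame h E"
    and D: "\<And>a b c d. D [a, b, c, d] = T a [b, c, d] - T b [a, c, d] + T c [a, b, d]
        - T d [a, b, c]"
  shows "4 * r x y = form_inner h 3 (interior_prod x D) (interior_prod y star)
    - form_inner h 4 (interior_prod y (vec_wedge h x star)) D - 2 * (\<Sum>i\<in>UNIV. T (E i) [E i, x, y])"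
proof -
  have D_lin: "linear (\<lambda>a. D [a, b, c, d])" "linear (\<lambda>b. D [a, b, c, d])"
      "linear (\<lambda>c. D [a, b, c, d])" "linear (\<lambda>d. D [a, b, c, d])" for a b c d
    unfolding D by (intro linear_compose_add linear_compose_sub T_lin T_lin_args)+
  have D_int: "multilinear_form 3 (interior_prod x D)" for x
    by (rule multilinear_3I) (simp_all add: interior_prod_def D_lin)
  have D_mult: "multilinear_form 4 D"
    unfolding multilinear_form_def length_4_conv using D_lin
        by (auto simp: numeral_eq_Suc less_Suc_eq)
  have W_alt: "alternating_form 5 (vec_wedge h x star)" for x
    using alternating_vec_wedge[of h x 4, OF lin2 alternating_star] by simp
  have W_mult: "multilinear_form 4 (interior_prod y (vec_wedge h x star))" for x y
    using alternating_imp_multilinear[OF W_alt] by (intro multilinear_interior_prod) simp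
  have tr: "(\<Sum>i\<in>UNIV. T (E i) [E i, x, y]) = (\<Sum>i\<in>UNIV. T (e i) [e i, x, y])" for x y
    by (rule sum_frame_bilinear[OF E e_orth, of "\<lambda>u v. T u [v, x, y]"]) (rule T_lin T_lin_args)+
  let ?R = "\<lambda>x y. form_inner h 3 (interior_prod x D) (interior_prod y star)
    - form_inner h 4 (interior_prod y (vec_wedge h x star)) D - 2 * (\<Sum>i\<in>UNIV. T (e i) [e i, x, y])"
  have R1: "linear (\<lambda>x. ?R x y)" for y
  proof (intro linear_compose_sub linear_scale_fun linear_compose_sum ballI T_lin_args
      linear_form_inner)
    fix vs :: "vec7 list"
    show "linear (\<lambda>x. interior_prod x D vs)" if "length vs = 3"
      using that D_lin by (auto simp: length_3_conv interior_prod_def)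
    show "linear (\<lambda>x. interior_prod y (vec_wedge h x star) vs)"
      unfolding interior_prod_def vec_wedge_def
          by (intro linear_compose_sum ballI linear_scale_fun lin1)
  qed
  have R2: "linear (\<lambda>y. ?R x y)" for x
  proof (intro linear_compose_sub linear_scale_fun linear_compose_sum ballI T_lin_args
      linear_form_inner)
    fix vs :: "vec7 list"
    show "linear (\<lambda>y. interior_prod y star vs)" if "length vs = 3"
      using that star_linear1 by (auto simp: length_3_conv interior_prod_def)
    show "linear (\<lambda>y. interior_prod y (vec_wedge h x star) vs)" if "length vs = 4"
      unfolding interior_prod_def using alternating_imp_multilinear[OF W_alt] that
      by (intro multilinear_form_Cons[of 4]) simp_all
  qed
  have 0: "4 * r (e x) (e y) = ?R (e x) (e y)" for x y
  proof -
    have "vec_wedge h (e x) star [e y, e a, e b, e c, e d] =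
        kron x y * fano_star a b c d - kron x a * fano_star y b c d
      + kron x b * fano_star y a c d - kron x c * fano_star y a b d + kron x d * fano_star y a b
          c" for a b c d
      by (simp add: vec_wedge_def omit_def lessThan_Suc h_e star_fano)
    then show ?thesis
      unfolding form_inner_frame[OF e_orth D_int interior_star_multilinear]
          form_inner_frame[OF e_orth W_mult D_mult]
      using r_from_ext[of "\<lambda>i a b c. T (e i) [e a, e b, e c]" "\<lambda>i k. r (e i) (e k)" x y, OF T_star]
      by (simp add: sum_lists_3 sum_lists_4 interior_prod_def star_fano D fact_numeral)
  qed
  have 1: "4 * r x (e y) = ?R x (e y)" for x y
    by (rule linear_eq_on_frame[OF e_orth linear_scale_fun(1)[OF r_lin(1)] R1]) (rule 0)
  have "4 * r x y = ?R x y"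
    by (rule linear_eq_on_frame[OF e_orth linear_scale_fun(1)[OF r_lin(2)] R2]) (rule 1)
  then show ?thesis unfolding tr .
qed

end

section \<open>Smooth functions on open sets\<close>

lemma differentiable_cong_open:
  assumes "open S" "x \<in> S" "\<And>y. y \<in> S \<Longrightarrow> f y = g y" "f differentiable (at x)"
  shows "g differentiable (at x)" "frechet_derivative g (at x) = frechet_derivative f (at x)"
proof -
  have "(f has_derivative frechet_derivative f (at x)) (at x)"
    using assms(4) by (simp add: frechet_derivative_works)
  then have *: "(g has_derivative frechet_derivative f (at x)) (at x)"
    using has_derivative_transform_within_open[OF _ assms(1,2)] assms(3) by blast
  then show "g differentiable (at x)" by (auto simp: differentiable_def)
  show "frechet_derivative g (at x) = frechet_derivative f (at x)"
    using frechet_derivative_at[OF *] by simp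
qed

lemma has_derivative_imp_frechet:
  assumes "(f has_derivative f') (at x)"
  shows "f differentiable (at x)" "frechet_derivative f (at x) = f'"
  using assms frechet_derivative_at[OF assms] by (auto simp: differentiable_def)

lemma Ck_on_cong:
  assumes "open S" "\<And>x. x \<in> S \<Longrightarrow> f x = g x" "Ck_on k f S"
  shows "Ck_on k g S"
  using assms(2,3)
proof (induction k arbitrary: f g)
  case 0
  then show ?case using continuous_on_cong[of S S f g] by simp
next
  case (Suc k)
  have "Ck_on k (\<lambda>x. frechet_derivative g (at x) v) S" for v
  proof (rule Suc.IH)
    show "Ck_on k (\<lambda>x. frechet_derivative f (at x) v) S" using Suc.prems by simp
    show "frechet_derivative f (at x) v = frechet_derivative g (at x) v" if "x \<in> S" for x
      using differentiable_cong_open(2)[OF assms(1) that, of f g] Suc.prems that by simp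
  qed
  then show ?case using differentiable_cong_open(1)[OF assms(1), of _ f g] Suc.prems by simp
qed

lemma Ck_on_subset: "Ck_on k f S \<Longrightarrow> T \<subseteq> S \<Longrightarrow> Ck_on k f T"
  by (induction k arbitrary: f) (auto intro: continuous_on_subset)

lemma Ck_on_Suc: "Ck_on (Suc k) f S \<Longrightarrow> Ck_on k f S"
proof (induction k arbitrary: f)
  case 0
  then show ?case
    by (auto intro!: continuous_at_imp_continuous_on differentiable_imp_continuous_within)
next
  case (Suc k)
  then show ?case by (metis Ck_on.simps(2))
qed

lemma Ck_on_local:
  assumes "open S" "\<And>x. x \<in> S \<Longrightarrow> \<exists>T. open T \<and> x \<in> T \<and> Ck_on k f (S \<inter> T)"
  shows "Ck_on k f S"
  using assms(2)
proof (induction k arbitrary: f)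
  case 0
  have "continuous (at x) f" if "x \<in> S" for x
  proof -
    obtain T where "open T" "x \<in> T" "continuous_on (S \<inter> T) f" using 0[OF \<open>x \<in> S\<close>] by auto
    then show ?thesis
      using continuous_on_interior[of "S \<inter> T" f x] assms(1) that
          by (simp add: interior_open open_Int)
  qed
  then show ?case by (simp add: continuous_at_imp_continuous_on)
next
  case (Suc k)
  have "f differentiable (at x)" if "x \<in> S" for x
    using Suc.prems[OF that] that by auto
  moreover have "Ck_on k (\<lambda>x. frechet_derivative f (at x) v) S" for v
    by (rule Suc.IH) (use Suc.prems in fastforce)
  ultimately show ?case by simp
qed

lemma Ck_on_const: "Ck_on k (\<lambda>_. c) S"
proof (induction k arbitrary: c)
  case (Suc k)
  then show ?case by (simp add: frechet_derivative_const)
qed simp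

lemma Ck_on_add:
  assumes S: "open S"
  shows "Ck_on k f S \<Longrightarrow> Ck_on k g S \<Longrightarrow> Ck_on k (\<lambda>x. f x + g x) S"
proof (induction k arbitrary: f g)
  case 0
  then show ?case by (simp add: continuous_on_add)
next
  case (Suc k)
  have "Ck_on k (\<lambda>x. frechet_derivative (\<lambda>x. f x + g x) (at x) v) S" for v
  proof (rule Ck_on_cong[OF S])
    show "Ck_on k (\<lambda>x. frechet_derivative f (at x) v + frechet_derivative g (at x) v) S"
      using Suc by simp
    show "frechet_derivative f (at x) v + frechet_derivative g (at x) v
        = frechet_derivative (\<lambda>x. f x + g x) (at x) v"
      if "x \<in> S" for x
    proof -
      have "((\<lambda>x. f x + g x) has_derivative (\<lambda>v. frechet_derivative f (at x) v
          + frechet_derivative g (at x) v)) (at x)"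
        using Suc.prems that by (intro has_derivative_add) (simp_all add: frechet_derivative_works)
      from has_derivative_imp_frechet(2)[OF this] show ?thesis by simp
    qed
  qed
  then show ?case using Suc.prems by (simp add: differentiable_add)
qed

lemma frechet_derivative_linear_comp:
  assumes "bounded_linear L" "f differentiable (at x)"
  shows "(\<lambda>x. L (f x)) differentiable (at x)"
    "frechet_derivative (\<lambda>x. L (f x)) (at x) v = L (frechet_derivative f (at x) v)"
proof -
  have "((\<lambda>x. L (f x)) has_derivative (\<lambda>v. L (frechet_derivative f (at x) v))) (at x)"
    using assms(2) by (intro bounded_linear.has_derivative[OF assms(1)])
        (simp only: frechet_derivative_works)
  from has_derivative_imp_frechet[OF this]
  show "(\<lambda>x. L (f x)) differentiable (at x)"
    "frechet_derivative (\<lambda>x. L (f x)) (at x) v = L (frechet_derivative f (at x) v)" by simp_all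
qed

lemma Ck_on_linear:
  assumes S: "open S" and L: "bounded_linear L"
  shows "Ck_on k f S \<Longrightarrow> Ck_on k (\<lambda>x. L (f x)) S"
proof (induction k arbitrary: f)
  case 0
  then show ?case by (simp add: bounded_linear.continuous_on[OF L])
next
  case (Suc k)
  have "Ck_on k (\<lambda>x. frechet_derivative (\<lambda>x. L (f x)) (at x) v) S" for v
  proof (rule Ck_on_cong[OF S])
    show "Ck_on k (\<lambda>x. L (frechet_derivative f (at x) v)) S"
      using Suc by simp
    show "L (frechet_derivative f (at x) v) = frechet_derivative (\<lambda>x. L (f x)) (at x) v"
        if "x \<in> S" for x
      using Suc.prems that frechet_derivative_linear_comp(2)[OF L, of f x] by simp
  qed
  then show ?case using Suc.prems frechet_derivative_linear_comp(1)[OF L, of f] by simp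
qed

lemma frechet_derivative_scaleR:
  fixes f :: "'a::real_normed_vector \<Rightarrow> real"
  assumes "f differentiable (at x)" "g differentiable (at x)"
  shows "(\<lambda>x. f x *\<^sub>R g x) differentiable (at x)"
    "frechet_derivative (\<lambda>x. f x *\<^sub>R g x) (at x) v =
      f x *\<^sub>R frechet_derivative g (at x) v + frechet_derivative f (at x) v *\<^sub>R g x"
proof -
  have "((\<lambda>x. f x *\<^sub>R g x) has_derivative
      (\<lambda>v. f x *\<^sub>R frechet_derivative g (at x) v + frechet_derivative f (at x) v *\<^sub>R g x)) (at x)"
    using assms by (intro has_derivative_scaleR) (simp_all add: frechet_derivative_works)
  from has_derivative_imp_frechet[OF this]
  show "(\<lambda>x. f x *\<^sub>R g x) differentiable (at x)"
    "frechet_derivative (\<lambda>x. f x *\<^sub>R g x) (at x) v =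
      f x *\<^sub>R frechet_derivative g (at x) v + frechet_derivative f (at x) v *\<^sub>R g x" by simp_all
qed

text \<open>The product rule differentiates one factor and leaves the other at its original order,
  so \<open>Ck_on_Suc\<close> is used to lower the latter.\<close>

lemma Ck_on_scaleR:
  fixes f :: "'a::real_normed_vector \<Rightarrow> real"
  assumes S: "open S"
  shows "Ck_on k f S \<Longrightarrow> Ck_on k g S \<Longrightarrow> Ck_on k (\<lambda>x. f x *\<^sub>R g x) S"
proof (induction k arbitrary: f g)
  case 0
  then show ?case by (simp add: continuous_on_scaleR)
next
  case (Suc k)
  have "Ck_on k (\<lambda>x. frechet_derivative (\<lambda>x. f x *\<^sub>R g x) (at x) v) S" for v
  proof (rule Ck_on_cong[OF S])
    show "Ck_on k (\<lambda>x. f x *\<^sub>R frechet_derivative g (at x) v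
        + frechet_derivative f (at x) v *\<^sub>R g x) S"
      using Suc.prems Ck_on_Suc[OF Suc.prems(1)] Ck_on_Suc[OF Suc.prems(2)]
          by (intro Ck_on_add[OF S] Suc.IH) simp_all
    show "f x *\<^sub>R frechet_derivative g (at x) v + frechet_derivative f (at x) v *\<^sub>R g x
      = frechet_derivative (\<lambda>x. f x *\<^sub>R g x) (at x) v" if "x \<in> S" for x
      using Suc.prems that frechet_derivative_scaleR(2)[of f x g] by simp
  qed
  then show ?case using Suc.prems frechet_derivative_scaleR(1) by simp
qed

lemma Ck_on_sum:
  assumes S: "open S"
  shows "(\<And>i. i \<in> I \<Longrightarrow> Ck_on k (f i) S) \<Longrightarrow> Ck_on k (\<lambda>x. \<Sum>i\<in>I. f i x) S"
  by (induction I rule: infinite_finite_induct) (simp_all add: Ck_on_const Ck_on_add[OF S])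

lemma frechet_derivative_chain:
  assumes "g differentiable (at x)" "f differentiable (at (g x))"
  shows "(f \<circ> g) differentiable (at x)"
    "frechet_derivative (f \<circ> g) (at x) v = frechet_derivative f (at (g x)) (frechet_derivative g
        (at x) v)"
proof -
  have "(f \<circ> g has_derivative frechet_derivative f (at (g x)) \<circ> frechet_derivative g (at x)) (at x)"
    using assms by (intro diff_chain_at) (simp_all add: frechet_derivative_works)
  from has_derivative_imp_frechet[OF this]
  show "(f \<circ> g) differentiable (at x)"
    "frechet_derivative (f \<circ> g) (at x) v = frechet_derivative f (at (g x)) (frechet_derivative g
        (at x) v)"
    by simp_all
qed

lemma axis_expansion: "v = (\<Sum>i\<in>UNIV. (v $ i) *\<^sub>R axis i 1)" for v :: "real ^ 'n"
  using basis_expansion[of v] by (simp add: scalar_mult_eq_scaleR)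

text \<open>The chain rule differentiates f in a direction that moves with x, whereas
  \<open>Ck_on\<close> speaks of fixed directions. Expanding the moving direction in the standard
  basis of \<open>vec7\<close> gives fixed directions with coefficients of the right
  regularity.\<close>

lemma Ck_on_compose:
  fixes g :: "'a::real_normed_vector \<Rightarrow> vec7"
  assumes S: "open S" and T: "open T" and gS: "g ` S \<subseteq> T"
  shows "Ck_on k f T \<Longrightarrow> Ck_on k g S \<Longrightarrow> Ck_on k (f \<circ> g) S"
proof (induction k arbitrary: f)
  case 0
  then show ?case using gS continuous_on_compose[of S g f] continuous_on_subset[of T f] by simp
next
  case (Suc k)
  have d: "g differentiable (at x)" "f differentiable (at (g x))" if "x \<in> S" for x
    using Suc.prems gS that by auto
  have "Ck_on k (\<lambda>x. frechet_derivative (f \<circ> g) (at x) v) S" for v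
  proof (rule Ck_on_cong[OF S])
    have "Ck_on k ((\<lambda>y. frechet_derivative f (at y) (axis i 1)) \<circ> g) S" for i
      using Suc.prems Ck_on_Suc[OF Suc.prems(2)] by (intro Suc.IH) simp_all
    then show "Ck_on k (\<lambda>x. \<Sum>i\<in>UNIV. (frechet_derivative g (at x) v $ i) *\<^sub>R
        ((\<lambda>y. frechet_derivative f (at y) (axis i 1)) \<circ> g) x) S"
      using Suc.prems(2)
      by (intro Ck_on_sum[OF S] Ck_on_scaleR[OF S] Ck_on_linear[OF S bounded_linear_vec_nth])
          (simp_all add: o_def)
    show "(\<Sum>i\<in>UNIV. (frechet_derivative g (at x) v $ i) *\<^sub>R
        ((\<lambda>y. frechet_derivative f (at y) (axis i 1)) \<circ> g) x) = frechet_derivative (f \<circ> g)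
            (at x) v" if "x \<in> S" for x
    proof -
      have l: "linear (frechet_derivative f (at (g x)))"
        using d(2)[OF that] by (rule linear_frechet_derivative)
      have "frechet_derivative (f \<circ> g) (at x) v
          = frechet_derivative f (at (g x)) (frechet_derivative g (at x) v)"
        using frechet_derivative_chain(2) d[OF that] by blast
      also have
          "frechet_derivative g (at x) v = (\<Sum>i\<in>UNIV. (frechet_derivative g (at x) v $ i) *\<^sub>R axis
          i 1)"
        by (rule axis_expansion)
      finally show ?thesis by (simp add: linear_sum[OF l] linear_cmul[OF l] o_def)
    qed
  qed
  then show ?case using frechet_derivative_chain(1)[OF d] unfolding Ck_on.simps by blast
qed

lemma smooth_on_cong: "open S \<Longrightarrow> (\<And>x. x \<in> S \<Longrightarrow> f x = g x) \<Longrightarrow> smooth_on f S \<Longrightarrow> smooth_on g S"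
  unfolding smooth_on_def using Ck_on_cong by blast

lemma smooth_on_subset: "smooth_on f S \<Longrightarrow> T \<subseteq> S \<Longrightarrow> smooth_on f T"
  unfolding smooth_on_def using Ck_on_subset by blast

lemma smooth_on_local:
  assumes "open S" "\<And>x. x \<in> S \<Longrightarrow> \<exists>T. open T \<and> x \<in> T \<and> smooth_on f (S \<inter> T)"
  shows "smooth_on f S"
  unfolding smooth_on_def using assms by (auto simp: smooth_on_def intro!: Ck_on_local)

lemma smooth_on_differentiable: "smooth_on f S \<Longrightarrow> x \<in> S \<Longrightarrow> f differentiable (at x)"
  unfolding smooth_on_def by (metis Ck_on.simps(2))

lemma smooth_on_derivative: "smooth_on f S \<Longrightarrow> smooth_on (\<lambda>x. frechet_derivative f (at x) v) S"
  unfolding smooth_on_def by (metis Ck_on.simps(2))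

lemma smooth_on_const: "smooth_on (\<lambda>_. c) S"
  by (simp add: smooth_on_def Ck_on_const)

lemma smooth_on_add: "open S \<Longrightarrow> smooth_on f S \<Longrightarrow> smooth_on g S \<Longrightarrow> smooth_on (\<lambda>x. f x + g x) S"
  by (simp add: smooth_on_def Ck_on_add)

lemma smooth_on_scaleR: "open S \<Longrightarrow> smooth_on f S \<Longrightarrow> smooth_on g S \<Longrightarrow> smooth_on (\<lambda>x. f x *\<^sub>R g x) S"
  by (simp add: smooth_on_def Ck_on_scaleR)

lemma smooth_on_nth: "open S \<Longrightarrow> smooth_on f S \<Longrightarrow> smooth_on (\<lambda>x. f x $ i) S"
  unfolding smooth_on_def using Ck_on_linear[OF _ bounded_linear_vec_nth] by blast

lemma smooth_on_compose:
  "open S \<Longrightarrow> open T \<Longrightarrow> g ` S \<subseteq> T \<Longrightarrow> smooth_on f T \<Longrightarrow> smooth_on g S \<Longrightarrow> smooth_on (f \<circ> g) S"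
  for g :: "'a::real_normed_vector \<Rightarrow> vec7"
  by (simp add: smooth_on_def Ck_on_compose)

section \<open>Charts, coordinate fields and tensoriality\<close>

locale atlas =
  fixes A :: "'m::{t2_space, second_countable_topology} chart set"
  assumes atlas: "smooth_atlas A"
begin

lemma chart_at_mem: "chart_at A p \<in> A" "p \<in> fst (chart_at A p)"
proof -
  have "p \<in> (\<Union>(U, c)\<in>A. U)" using atlas by (simp add: smooth_atlas_def)
  then have "\<exists>C. C \<in> A \<and> p \<in> fst C" by (auto simp: case_prod_beta)
  then have "chart_at A p \<in> A \<and> p \<in> fst (chart_at A p)"
    unfolding chart_at_def by (rule someI_ex)
  then show "chart_at A p \<in> A" "p \<in> fst (chart_at A p)" by simp_all
qed

lemma chart:
  assumes "C \<in> A"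
  shows "open (fst C)" "open (snd C ` fst C)" "inj_on (snd C) (fst C)"
    "continuous_on (fst C) (snd C)" "continuous_on (snd C ` fst C) (chart_inv C)"
  using atlas assms by (auto simp: smooth_atlas_def case_prod_beta)

lemma chart_inv [simp]: "C \<in> A \<Longrightarrow> q \<in> fst C \<Longrightarrow> chart_inv C (snd C q) = q"
  using chart(3) by (simp add: inv_into_f_f)

lemma transition_smooth:
  "C \<in> A \<Longrightarrow> D \<in> A \<Longrightarrow> smooth_on (snd D \<circ> chart_inv C) (snd C ` (fst C \<inter> fst D))"
  using atlas by (fastforce simp: smooth_atlas_def case_prod_beta)

lemma open_chart_image:
  assumes C: "C \<in> A" and W: "open W"
  shows "open (snd C ` (fst C \<inter> W))"
proof -
  have "snd C ` (fst C \<inter> W) = snd C ` fst C \<inter> chart_inv C -` W"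
    using C by auto
  then show ?thesis
    using continuous_open_preimage[OF chart(5)[OF C] chart(2)[OF C] W] by simp
qed

text \<open>The change of components of a tangent vector at q between two charts. Both
  \<open>chart_components\<close> and \<open>coord_field\<close> are instances, so their rules
  reduce to the cocycle identity \<open>dtrans_chain\<close>.\<close>

definition dtrans :: "'m chart \<Rightarrow> 'm chart \<Rightarrow> 'm \<Rightarrow> vec7 \<Rightarrow> vec7" where
  "dtrans C D q = frechet_derivative (snd D \<circ> chart_inv C) (at (snd C q))"

lemma transition_differentiable:
  assumes "C \<in> A" "D \<in> A" "q \<in> fst C" "q \<in> fst D"
  shows "(snd D \<circ> chart_inv C) differentiable (at (snd C q))"
  using smooth_on_differentiable[OF transition_smooth[OF assms(1,2)]] assms by blast

lemma dtrans_linear: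
  assumes "C \<in> A" "D \<in> A" "q \<in> fst C" "q \<in> fst D"
  shows "linear (dtrans C D q)"
  unfolding dtrans_def by (rule linear_frechet_derivative[OF transition_differentiable[OF assms]])

lemma dtrans_id:
  assumes C: "C \<in> A" and q: "q \<in> fst C"
  shows "dtrans C C q v = v"
proof -
  have "frechet_derivative (snd C \<circ> chart_inv C) (at (snd C q))
      = frechet_derivative (\<lambda>x. x) (at (snd C q))"
    by (rule differentiable_cong_open(2)[OF chart(2)[OF C]]) (use C q in \<open>auto simp: f_inv_into_f\<close>)
  then show ?thesis by (simp add: dtrans_def)
qed

lemma dtrans_chain:
  assumes C: "C \<in> A" and D: "D \<in> A" and E: "E \<in> A" and q: "q \<in> fst C" "q \<in> fst D" "q \<in> fst E"
  shows "dtrans D E q (dtrans C D q v) = dtrans C E q v"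
proof -
  let ?f = "snd D \<circ> chart_inv C" and ?g = "snd E \<circ> chart_inv D"
  have fq: "?f (snd C q) = snd D q" using C q by simp
  have g: "?g differentiable (at (?f (snd C q)))"
    unfolding fq using transition_differentiable[OF D E q(2,3)] .
  note f = transition_differentiable[OF C D q(1,2)]
  have "frechet_derivative (?g \<circ> ?f) (at (snd C q))
      = frechet_derivative (snd E \<circ> chart_inv C) (at (snd C q))"
  proof (rule differentiable_cong_open(2)[symmetric])
    show "open (snd C ` (fst C \<inter> fst D))" by (rule open_chart_image[OF C chart(1)[OF D]])
    show "snd C q \<in> snd C ` (fst C \<inter> fst D)" using q by simp
    show "(?g \<circ> ?f) y = (snd E \<circ> chart_inv C) y" if "y \<in> snd C ` (fst C \<inter> fst D)" for y
      using that C D by auto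
    show "(?g \<circ> ?f) differentiable (at (snd C q))" by (rule frechet_derivative_chain(1)[OF f g])
  qed
  moreover have "frechet_derivative (?g \<circ> ?f) (at (snd C q)) v
      = frechet_derivative ?g (at (?f (snd C q))) (frechet_derivative ?f (at (snd C q)) v)"
    by (rule frechet_derivative_chain(2)[OF f g])
  ultimately show ?thesis by (simp only: fq dtrans_def)
qed

lemma chart_components_dtrans: "chart_components A C q v = dtrans (chart_at A q) C q v"
  by (simp add: chart_components_def dtrans_def)

lemma chart_components_linear: "C \<in> A \<Longrightarrow> q \<in> fst C \<Longrightarrow> linear (chart_components A C q)"
  unfolding chart_components_dtrans using dtrans_linear chart_at_mem by blast

lemma chart_components_self: "chart_components A (chart_at A p) p v = v"
  unfolding chart_components_dtrans by (rule dtrans_id[OF chart_at_mem])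

lemma coord_field_dtrans: "coord_field A p v q = dtrans (chart_at A p) (chart_at A q) q v"
  by (simp add: coord_field_def dtrans_def)

lemma coord_field_linear: "q \<in> fst (chart_at A p) \<Longrightarrow> linear (\<lambda>v. coord_field A p v q)"
  unfolding coord_field_dtrans using dtrans_linear chart_at_mem by blast

lemma coord_field_self [simp]: "coord_field A p v p = v"
  unfolding coord_field_dtrans by (rule dtrans_id[OF chart_at_mem])

lemma chart_components_coord_field:
  assumes "C \<in> A" "q \<in> fst C" "q \<in> fst (chart_at A p)"
  shows "chart_components A C q (coord_field A p v q) = dtrans (chart_at A p) C q v"
  unfolding chart_components_dtrans coord_field_dtrans
  by (rule dtrans_chain) (use assms chart_at_mem in auto)

lemma coord_field_chart_components:
  assumes "q \<in> fst (chart_at A p)"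
  shows "coord_field A p (chart_components A (chart_at A p) q v) q = v"
  unfolding chart_components_dtrans coord_field_dtrans
  by (subst dtrans_chain) (use assms chart_at_mem dtrans_id in auto)

lemma field_in_chart: "C \<in> A \<Longrightarrow> q \<in> fst C \<Longrightarrow> field_in_chart A C Y (snd C q)
    = chart_components A C q (Y q)"
  by (simp add: field_in_chart_def)

text \<open>In a chart \<open>C\<close> the field is the derivative, in the fixed direction v, of
  the transition from the preferred chart to \<open>C\<close>, composed with the transition
  back.\<close>

lemma smooth_coord_field: "smooth_field_on A (fst (chart_at A p)) (coord_field A p v)"
  unfolding smooth_field_on_def
proof (intro conjI ballI)
  let ?P = "chart_at A p"
  note P = chart_at_mem(1)[of p]
  show "open (fst ?P)" by (rule chart(1)[OF P])
  fix C assume C: "C \<in> A"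
  let ?S = "snd C ` (fst C \<inter> fst ?P)" and ?T = "snd ?P ` (fst ?P \<inter> fst C)"
  have S: "open ?S" by (rule open_chart_image[OF C chart(1)[OF P]])
  show "smooth_on (field_in_chart A C (coord_field A p v)) ?S"
  proof (rule smooth_on_cong[OF S])
    show "smooth_on ((\<lambda>y. frechet_derivative (snd C \<circ> chart_inv ?P) (at y) v) \<circ> (snd ?P \<circ>
        chart_inv C)) ?S"
    proof (rule smooth_on_compose[OF S open_chart_image[OF P chart(1)[OF C]]])
      show "(snd ?P \<circ> chart_inv C) ` ?S \<subseteq> ?T" using C by auto
    qed (use P C transition_smooth smooth_on_derivative in blast)+
    show "((\<lambda>y. frechet_derivative (snd C \<circ> chart_inv ?P) (at y) v) \<circ> (snd ?P \<circ> chart_inv C)) x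
      = field_in_chart A C (coord_field A p v) x" if x: "x \<in> ?S" for x
    proof -
      obtain q where q: "q \<in> fst C" "q \<in> fst ?P" "x = snd C q" using x by auto
      show ?thesis
        using q C by (simp add: field_in_chart chart_components_coord_field dtrans_def)
    qed
  qed
qed

section \<open>Smooth fields and smooth functions\<close>

lemma smooth_field_cong:
  assumes "smooth_field_on A W Y" "\<And>q. q \<in> W \<Longrightarrow> Y q = Z q"
  shows "smooth_field_on A W Z"
  unfolding smooth_field_on_def
proof (intro conjI ballI)
  show W: "open W" using assms by (simp add: smooth_field_on_def)
  fix C assume C: "C \<in> A"
  show "smooth_on (field_in_chart A C Z) (snd C ` (fst C \<inter> W))"
    by (rule smooth_on_cong[OF open_chart_image[OF C W], of "field_in_chart A C Y"])
      (use assms C in \<open>auto simp: smooth_field_on_def field_in_chart\<close>)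
qed

lemma smooth_field_subset: "smooth_field_on A W Y \<Longrightarrow> open V \<Longrightarrow> V \<subseteq> W \<Longrightarrow> smooth_field_on A V Y"
  unfolding smooth_field_on_def using smooth_on_subset by (meson Int_mono image_mono order_refl)

text \<open>Cayley frames are smooth only near a point, so the smoothness of the torsion term is
  established locally and assembled here.\<close>

lemma smooth_field_local:
  assumes W: "open W" and "\<And>p. p \<in> W \<Longrightarrow> \<exists>V. p \<in> V \<and> V \<subseteq> W \<and> smooth_field_on A V Y"
  shows "smooth_field_on A W Y"
  unfolding smooth_field_on_def
proof (intro conjI ballI W)
  fix C assume C: "C \<in> A"
  show "smooth_on (field_in_chart A C Y) (snd C ` (fst C \<inter> W))"
  proof (rule smooth_on_local[OF open_chart_image[OF C W]])
    fix x assume "x \<in> snd C ` (fst C \<inter> W)"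
    then obtain p where p: "p \<in> fst C" "p \<in> W" "x = snd C p" by auto
    then obtain V where V: "p \<in> V" "V \<subseteq> W" "smooth_field_on A V Y" using assms(2) by blast
    then have "smooth_on (field_in_chart A C Y) (snd C ` (fst C \<inter> V))" "open V"
      using C by (auto simp: smooth_field_on_def)
    then show "\<exists>T. open T \<and> x \<in> T \<and> smooth_on (field_in_chart A C Y) (snd C ` (fst C \<inter> W) \<inter> T)"
      using p V open_chart_image[OF C, of V]
      by (intro exI[of _ "snd C ` (fst C \<inter> V)"]) (auto intro: smooth_on_subset)
  qed
qed

lemma smooth_field_zero: "open W \<Longrightarrow> smooth_field_on A W (\<lambda>_. 0)"
  unfolding smooth_field_on_def
proof (intro conjI ballI)
  fix C assume W: "open W" and C: "C \<in> A"
  show "smooth_on (field_in_chart A C (\<lambda>_. 0)) (snd C ` (fst C \<inter> W))"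
    by (rule smooth_on_cong[OF open_chart_image[OF C W] _ smooth_on_const[of 0]])
      (use C in \<open>auto simp: field_in_chart linear_0[OF chart_components_linear]\<close>)
qed

lemma smooth_field_add:
  assumes "smooth_field_on A W Y" "smooth_field_on A W Z"
  shows "smooth_field_on A W (\<lambda>q. Y q + Z q)"
  unfolding smooth_field_on_def
proof (intro conjI ballI)
  show W: "open W" using assms by (simp add: smooth_field_on_def)
  fix C assume C: "C \<in> A"
  note S = open_chart_image[OF C W]
  show "smooth_on (field_in_chart A C (\<lambda>q. Y q + Z q)) (snd C ` (fst C \<inter> W))"
    by (rule smooth_on_cong[OF S _ smooth_on_add[OF S, of "field_in_chart A C Y" "field_in_chart A
        C Z"]])
      (use assms C in \<open>auto simp: smooth_field_on_def field_in_chart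
          linear_add[OF chart_components_linear]\<close>)
qed

lemma smooth_field_scale:
  assumes "smooth_fun_on A W f" "smooth_field_on A W Y"
  shows "smooth_field_on A W (\<lambda>q. f q *\<^sub>R Y q)"
  unfolding smooth_field_on_def
proof (intro conjI ballI)
  show W: "open W" using assms by (simp add: smooth_field_on_def)
  fix C assume C: "C \<in> A"
  note S = open_chart_image[OF C W]
  show "smooth_on (field_in_chart A C (\<lambda>q. f q *\<^sub>R Y q)) (snd C ` (fst C \<inter> W))"
    by (rule smooth_on_cong[OF S _ smooth_on_scaleR[OF S, of "f \<circ> chart_inv C" "field_in_chart A C
        Y"]])
      (use assms C in \<open>auto simp: smooth_field_on_def smooth_fun_on_def field_in_chart
          linear_cmul[OF chart_components_linear]\<close>)
qed

lemma smooth_fun_const: "open W \<Longrightarrow> smooth_fun_on A W (\<lambda>_. c)"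
  by (simp add: smooth_fun_on_def o_def smooth_on_const)

lemma smooth_fun_add: "smooth_fun_on A W f \<Longrightarrow> smooth_fun_on A W g \<Longrightarrow> smooth_fun_on A W (\<lambda>q. f q
    + g q)"
  unfolding smooth_fun_on_def o_def using smooth_on_add open_chart_image by blast

lemma smooth_fun_mult: "smooth_fun_on A W f \<Longrightarrow> smooth_fun_on A W g
    \<Longrightarrow> smooth_fun_on A W (\<lambda>q. f q * g q)"
  unfolding smooth_fun_on_def o_def
  using smooth_on_scaleR[where 'b = real, unfolded real_scaleR_def] open_chart_image by blast

lemma smooth_fun_sum:
  "open W \<Longrightarrow> (\<And>i. i \<in> I \<Longrightarrow> smooth_fun_on A W (f i)) \<Longrightarrow> smooth_fun_on A W (\<lambda>q. \<Sum>i\<in>I. f i q)"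
  by (induction I rule: infinite_finite_induct) (simp_all add: smooth_fun_const smooth_fun_add)

lemma smooth_field_sum:
  "open W \<Longrightarrow> (\<And>i. i \<in> I \<Longrightarrow> smooth_field_on A W (f i)) \<Longrightarrow> smooth_field_on A W (\<lambda>q. \<Sum>i\<in>I. f i q)"
  by (induction I rule: infinite_finite_induct) (simp_all add: smooth_field_zero smooth_field_add)

lemma smooth_chart_components:
  assumes C: "C \<in> A" and Y: "smooth_field_on A W Y"
  shows "smooth_fun_on A (W \<inter> fst C) (\<lambda>q. chart_components A C q (Y q) $ i)"
  unfolding smooth_fun_on_def
proof (intro conjI ballI)
  have W: "open W" using Y by (simp add: smooth_field_on_def)
  show WC: "open (W \<inter> fst C)" using W chart(1)[OF C] by (rule open_Int)
  fix D assume D: "D \<in> A"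
  let ?S = "snd D ` (fst D \<inter> (W \<inter> fst C))" and ?T = "snd C ` (fst C \<inter> W)"
  note S = open_chart_image[OF D WC] and T = open_chart_image[OF C W]
  show "smooth_on ((\<lambda>q. chart_components A C q (Y q) $ i) \<circ> chart_inv D) ?S"
  proof (rule smooth_on_cong[OF S])
    show "smooth_on ((\<lambda>x. field_in_chart A C Y x $ i) \<circ> (snd C \<circ> chart_inv D)) ?S"
    proof (rule smooth_on_compose[OF S T])
      show "(snd C \<circ> chart_inv D) ` ?S \<subseteq> ?T" using D by auto
      show "smooth_on (\<lambda>x. field_in_chart A C Y x $ i) ?T"
        using smooth_on_nth[OF T, of "field_in_chart A C Y" i] Y C
            by (simp add: smooth_field_on_def)
      show "smooth_on (snd C \<circ> chart_inv D) ?S"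
        by (rule smooth_on_subset[OF transition_smooth[OF D C]]) auto
    qed
  qed (use C D in \<open>auto simp: field_in_chart\<close>)
qed

lemma field_expansion:
  assumes "q \<in> fst (chart_at A p)"
  shows "Y q = (\<Sum>i\<in>UNIV. (chart_components A (chart_at A p) q (Y q) $ i) *\<^sub>R coord_field A p (axis
      i 1) q)"
proof -
  let ?v = "chart_components A (chart_at A p) q (Y q)"
  have "Y q = coord_field A p ?v q" using coord_field_chart_components[OF assms] by simp
  also have "?v = (\<Sum>i\<in>UNIV. (?v $ i) *\<^sub>R axis i 1)"
    by (rule axis_expansion)
  finally show ?thesis
    by (simp add: linear_sum[OF coord_field_linear[OF assms]]
        linear_cmul[OF coord_field_linear[OF assms]])
qed

text \<open>A local operation on vector fields that is linear over the smooth functions is evaluated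
  pointwise, because a field is a combination of coordinate fields with smooth coefficients.\<close>

lemma tensorial:
  fixes T :: "('m \<Rightarrow> vec7) \<Rightarrow> 'b::real_vector"
  assumes p: "p \<in> W" and Y: "smooth_field_on A W Y"
  defines "V \<equiv> W \<inter> fst (chart_at A p)"
  assumes add: "\<And>Y Z. smooth_field_on A V Y \<Longrightarrow> smooth_field_on A V Z \<Longrightarrow> T (\<lambda>q. Y q + Z q) = T Y + T Z"
    and scale: "\<And>f Y. smooth_fun_on A V f \<Longrightarrow> smooth_field_on A V Y \<Longrightarrow> T (\<lambda>q. f q *\<^sub>R Y q)
        = f p *\<^sub>R T Y"
    and local: "\<And>Y Z. smooth_field_on A V Y \<Longrightarrow> (\<forall>q\<in>V. Z q = Y q) \<Longrightarrow> T Z = T Y"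
  shows "T Y = T (coord_field A p (Y p))"
proof -
  let ?P = "chart_at A p"
  let ?c = "\<lambda>i. coord_field A p (axis i 1)"
  have V: "open V" using Y chart(1)[OF chart_at_mem(1)] by (auto simp: V_def smooth_field_on_def)
  have c: "smooth_field_on A V (?c i)" for i
    by (rule smooth_field_subset[OF smooth_coord_field V]) (simp add: V_def)
  have T0: "T (\<lambda>_. 0) = 0"
    using scale[OF smooth_fun_const[OF V, of 0] smooth_field_zero[OF V]] by simp
  have sum: "T (\<lambda>q. \<Sum>i\<in>I. f i q *\<^sub>R ?c i q) = (\<Sum>i\<in>I. f i p *\<^sub>R T (?c i))"
    if f: "\<And>i. smooth_fun_on A V (f i)" and "finite I" for f and I :: "7 set"
    using \<open>finite I\<close>
  proof (induction I rule: finite_induct)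
    case (insert i I)
    have "smooth_field_on A V (\<lambda>q. \<Sum>i\<in>I. f i q *\<^sub>R ?c i q)"
      using f c by (intro smooth_field_sum[OF V] smooth_field_scale)
    then show ?case
      using insert add[OF smooth_field_scale[OF f c]] scale[OF f c] by simp
  qed (simp add: T0)
  have f: "smooth_fun_on A V (\<lambda>q. chart_components A ?P q (Y q) $ i)" for i
    unfolding V_def by (rule smooth_chart_components[OF chart_at_mem(1) Y])
  have "T Y = T (\<lambda>q. \<Sum>i\<in>UNIV. (chart_components A ?P q (Y q) $ i) *\<^sub>R ?c i q)"
    using f c field_expansion[of _ p Y]
    by (intro local smooth_field_sum[OF V] smooth_field_scale ballI) (simp_all add: V_def)
  also have "\<dots> = (\<Sum>i\<in>UNIV. (Y p $ i) *\<^sub>R T (?c i))"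
    by (subst sum[OF f]) (simp_all add: chart_components_self)
  \<comment> \<open>The value depends on the coefficient functions only through their values at p,
    so these functions may be replaced by constants, which gives a coordinate field.\<close>
  also have "\<dots> = T (\<lambda>q. \<Sum>i\<in>UNIV. (Y p $ i) *\<^sub>R ?c i q)"
    by (subst sum[OF smooth_fun_const[OF V]]) simp_all
  also have "\<dots> = T (coord_field A p (Y p))"
  proof (rule local[symmetric])
    show "smooth_field_on A V (\<lambda>q. \<Sum>i\<in>UNIV. (Y p $ i) *\<^sub>R ?c i q)"
      using c by (intro smooth_field_sum[OF V] smooth_field_scale smooth_fun_const[OF V])
    show "\<forall>q\<in>V. coord_field A p (Y p) q = (\<Sum>i\<in>UNIV. (Y p $ i) *\<^sub>R ?c i q)"
    proof
      fix q assume "q \<in> V"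
      then have l: "linear (\<lambda>v. coord_field A p v q)"
          by (intro coord_field_linear) (simp add: V_def)
      have "Y p = (\<Sum>i\<in>UNIV. (Y p $ i) *\<^sub>R axis i 1)"
        by (rule axis_expansion)
      then have "coord_field A p (Y p) q = coord_field A p (\<Sum>i\<in>UNIV. (Y p $ i) *\<^sub>R axis i 1) q"
          by simp
      then show "coord_field A p (Y p) q = (\<Sum>i\<in>UNIV. (Y p $ i) *\<^sub>R ?c i q)"
        by (simp add: linear_sum[OF l] linear_cmul[OF l])
    qed
  qed
  finally show ?thesis .
qed

section \<open>Directional derivatives\<close>

lemma smooth_fun_differentiable:
  assumes "smooth_fun_on A W f" "p \<in> W"
  shows "(f \<circ> chart_inv (chart_at A p)) differentiable (at (snd (chart_at A p) p))"
  using assms chart_at_mem[of p] unfolding smooth_fun_on_def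
  by (intro smooth_on_differentiable[of _ "snd (chart_at A p) ` (fst (chart_at A p) \<inter> W)"]) auto

lemma dir_deriv_linear: "smooth_fun_on A W f \<Longrightarrow> p \<in> W \<Longrightarrow> linear (\<lambda>v. dir_deriv A p v f)"
  unfolding dir_deriv_def by (rule linear_frechet_derivative[OF smooth_fun_differentiable])

lemma dir_deriv_const [simp]: "dir_deriv A p v (\<lambda>_. c) = 0"
  by (simp add: dir_deriv_def o_def frechet_derivative_const)

lemma dir_deriv_cong:
  assumes "smooth_fun_on A W f" "p \<in> W" "\<And>q. q \<in> W \<Longrightarrow> f q = g q"
  shows "dir_deriv A p v g = dir_deriv A p v f"
proof -
  let ?P = "chart_at A p"
  note P = chart_at_mem[of p]
  have W: "open W" using assms by (simp add: smooth_fun_on_def)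
  have "frechet_derivative (g \<circ> chart_inv ?P) (at (snd ?P p))
      = frechet_derivative (f \<circ> chart_inv ?P) (at (snd ?P p))"
    by (rule differentiable_cong_open(2)[OF open_chart_image[OF P(1) W]])
      (use P assms smooth_fun_differentiable[OF assms(1,2)] in auto)
  then show ?thesis by (simp add: dir_deriv_def)
qed

lemma dir_deriv_add:
  assumes "smooth_fun_on A W f" "smooth_fun_on A W g" "p \<in> W"
  shows "dir_deriv A p v (\<lambda>q. f q + g q) = dir_deriv A p v f + dir_deriv A p v g"
proof -
  let ?P = "chart_at A p"
  have "((\<lambda>x. (f \<circ> chart_inv ?P) x + (g \<circ> chart_inv ?P) x) has_derivative
     (\<lambda>v. dir_deriv A p v f + dir_deriv A p v g)) (at (snd ?P p))"
    unfolding dir_deriv_def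
    using smooth_fun_differentiable[OF assms(1,3)] smooth_fun_differentiable[OF assms(2,3)]
    by (intro has_derivative_add) (simp_all only: frechet_derivative_works[symmetric])
  from has_derivative_imp_frechet(2)[OF this] show ?thesis by (simp add: dir_deriv_def o_def)
qed

lemma dir_deriv_mult:
  assumes "smooth_fun_on A W f" "smooth_fun_on A W g" "p \<in> W"
  shows "dir_deriv A p v (\<lambda>q. f q * g q) = dir_deriv A p v f * g p + f p * dir_deriv A p v g"
  using frechet_derivative_scaleR(2)[OF smooth_fun_differentiable[OF assms(1,3)] smooth_fun_differentiable[OF assms(2,3)], of v]
    chart_at_mem[of p]
  by (simp add: dir_deriv_def o_def add.commute)

text \<open>Coordinate fields have constant components in the preferred chart at p.\<close>

lemma lie_bracket_coord_field: "lie_bracket A (coord_field A p u) (coord_field A p v) p = 0"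
proof -
  let ?P = "chart_at A p"
  note P = chart_at_mem[of p]
  have "frechet_derivative (field_in_chart A ?P (coord_field A p v)) (at (snd ?P p))
      = frechet_derivative (\<lambda>_. v) (at (snd ?P p))" for v
    by (rule differentiable_cong_open(2)[OF chart(2)[OF P(1)]])
      (use P in \<open>auto simp: field_in_chart chart_components_coord_field dtrans_id\<close>)
  then show ?thesis by (simp add: lie_bracket_def Let_def frechet_derivative_const)
qed

end

context cayley
begin

text \<open>The right side mentions neither the point nor the frame. Applied at varying points with
  the same coefficients, it shows that the three-form is constant on fields with constant
  coefficients in a Cayley frame; \<open>h_frame_sums\<close> does this for the metric.\<close>

lemma f_frame_sums:
  "f [\<Sum>a\<in>UNIV. \<alpha> a *\<^sub>R e a, \<Sum>b\<in>UNIV. \<beta> b *\<^sub>R e b, \<Sum>c\<in>UNIV. \<gamma> c *\<^sub>R e c]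
    = (\<Sum>a\<in>UNIV. \<Sum>b\<in>UNIV. \<Sum>c\<in>UNIV. \<alpha> a * (\<beta> b * (\<gamma> c * fano a b c)))"
  unfolding linear_sum[OF f_lin(1)] linear_cmul[OF f_lin(1)]
  unfolding linear_sum[OF f_lin(2)] linear_cmul[OF f_lin(2)]
  unfolding linear_sum[OF f_lin(3)] linear_cmul[OF f_lin(3)] f_e
  by (simp add: sum_distrib_left)

lemma h_frame_sums:
  "h (\<Sum>a\<in>UNIV. \<alpha> a *\<^sub>R e a) (\<Sum>b\<in>UNIV. \<beta> b *\<^sub>R e b) = (\<Sum>a\<in>UNIV. \<alpha> a * \<beta> a)"
  unfolding linear_sum[OF lin1] linear_cmul[OF lin1]
  unfolding linear_sum[OF lin2] linear_cmul[OF lin2] h_e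
  by (simp add: sum_kron)

lemma cross_expand: "cross_prod h f x y = (\<Sum>k\<in>UNIV. f [x, y, e k] *\<^sub>R e k)"
  using orthonormal_expand[OF e_orth, of "cross_prod h f x y"] by (simp add: h_cross)

end

context atlas
begin

section \<open>Affine connections on local fields\<close>

lemma affine_connectionD:
  assumes "affine_connection A D" "smooth_field_on A W Y" "p \<in> W"
  shows "linear (\<lambda>v. D p v Y)"
    "smooth_field_on A W Z \<Longrightarrow> D p v (\<lambda>q. Y q + Z q) = D p v Y + D p v Z"
    "smooth_fun_on A W f \<Longrightarrow> D p v (\<lambda>q. f q *\<^sub>R Y q) = dir_deriv A p v f *\<^sub>R Y p + f p *\<^sub>R D p v Y"
    "(\<And>q. q \<in> W \<Longrightarrow> Z q = Y q) \<Longrightarrow> D p v Z = D p v Y"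
proof -
  note c = assms(1)[unfolded affine_connection_def, rule_format, OF assms(2)]
  note c2 = c[THEN conjunct2] and c3 = c[THEN conjunct2, THEN conjunct2]
  show "linear (\<lambda>v. D p v Y)" using c[THEN conjunct1] assms(3) by blast
  show "D p v (\<lambda>q. Y q + Z q) = D p v Y + D p v Z" if "smooth_field_on A W Z"
    using c2[THEN conjunct1, rule_format, OF assms(3) that] .
  show "D p v (\<lambda>q. f q *\<^sub>R Y q) = dir_deriv A p v f *\<^sub>R Y p + f p *\<^sub>R D p v Y"
      if "smooth_fun_on A W f"
    using c3[THEN conjunct1, rule_format, OF assms(3) that] .
  show "D p v Z = D p v Y" if "\<And>q. q \<in> W \<Longrightarrow> Z q = Y q"
    using c3[THEN conjunct2, THEN conjunct1, rule_format, OF assms(3), of Z v] that by blast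
qed

lemma affine_connection_smooth:
  assumes "affine_connection A D" "smooth_field_on A W X" "smooth_field_on A W Y"
  shows "smooth_field_on A W (\<lambda>q. D q (X q) Y)"
  using assms(1)[unfolded affine_connection_def, rule_format, OF assms(3)] assms(2) by blast

lemma smooth_field_open: "smooth_field_on A W Y \<Longrightarrow> open W"
  by (simp add: smooth_field_on_def)

lemma affine_connection_sum:
  assumes D: "affine_connection A D" and Y: "\<And>i. smooth_field_on A W (Y i)"
      and W: "open W" "p \<in> W" and "finite I"
  shows "D p v (\<lambda>q. \<Sum>i\<in>I. c i *\<^sub>R Y i q) = (\<Sum>i\<in>I. c i *\<^sub>R D p v (Y i))"
  using \<open>finite I\<close>
proof (induction I rule: finite_induct)
  case empty
  show ?case
    using affine_connectionD(3)[OF D smooth_field_zero[OF W(1)] W(2) smooth_fun_const[OF W(1), of 0]] by simp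
next
  case (insert i I)
  have "smooth_field_on A W (\<lambda>q. c i *\<^sub>R Y i q)" for i
    by (intro smooth_field_scale smooth_fun_const[OF W(1)] Y)
  moreover from this have "smooth_field_on A W (\<lambda>q. \<Sum>i\<in>I. c i *\<^sub>R Y i q)"
    by (intro smooth_field_sum[OF W(1)])
  ultimately show ?case
    using insert affine_connectionD(2)[OF D, of W "\<lambda>q. c i *\<^sub>R Y i q" p "\<lambda>q. \<Sum>i\<in>I. c i *\<^sub>R Y i q"]
      affine_connectionD(3)[OF D Y W(2) smooth_fun_const[OF W(1)]] W(2)
    by simp
qed

text \<open>The derivative term of the Leibniz rule is common to both connections and cancels, so
  their difference is linear over the smooth functions.\<close>

lemma connection_difference:
  assumes D: "affine_connection A D" and L: "affine_connection A L" and Y: "smooth_field_on A W Y"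
      and p: "p \<in> W"
  shows "D p x Y - L p x Y = D p x (coord_field A p (Y p)) - L p x (coord_field A p (Y p))"
proof (rule tensorial[OF p Y, where T = "\<lambda>Y. D p x Y - L p x Y"])
  let ?V = "W \<inter> fst (chart_at A p)"
  have p: "p \<in> ?V" using p chart_at_mem by simp
  fix Y assume Y: "smooth_field_on A ?V Y"
  show "D p x (\<lambda>q. Y q + Z q) - L p x (\<lambda>q. Y q + Z q) = D p x Y - L p x Y + (D p x Z - L p x Z)"
    if "smooth_field_on A ?V Z" for Z
    using affine_connectionD(2)[OF D Y p that] affine_connectionD(2)[OF L Y p that] by simp
  show "D p x (\<lambda>q. f q *\<^sub>R Y q) - L p x (\<lambda>q. f q *\<^sub>R Y q) = f p *\<^sub>R (D p x Y - L p x Y)"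
    if "smooth_fun_on A ?V f" for f
    using affine_connectionD(3)[OF D Y p that] affine_connectionD(3)[OF L Y p that]
        by (simp add: algebra_simps)
  show "D p x Z - L p x Z = D p x Y - L p x Y" if "\<forall>q\<in>?V. Z q = Y q" for Z
    using affine_connectionD(4)[OF D Y p, of Z] affine_connectionD(4)[OF L Y p, of Z] that by simp
qed

lemma dir_deriv_uminus:
  assumes "smooth_fun_on A W f" "p \<in> W"
  shows "dir_deriv A p v (\<lambda>q. - f q) = - dir_deriv A p v f"
proof -
  have "open W" using assms by (simp add: smooth_fun_on_def)
  from dir_deriv_mult[OF smooth_fun_const[OF this, of "-1"] assms, of v] show ?thesis by simp
qed

end

section \<open>The minimal connection\<close>

locale g2_manifold = atlas A
  for A :: "'m::{t2_space, second_countable_topology} chart set" +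
  fixes g :: "'m \<Rightarrow> vec7 \<Rightarrow> vec7 \<Rightarrow> real" and \<phi> :: "'m \<Rightarrow> form" and L :: "'m connection"
  assumes metric: "riemannian_metric A g" and g2: "g2_structure A g \<phi>" and LC: "levi_civita A g L"
begin

lemma phi_alt: "alternating_form 3 (\<phi> p)"
  using g2 by (simp add: g2_structure_def smooth_form_def)

lemma phi_linear: "linear (\<lambda>u. \<phi> p [u, v, w])" "linear (\<lambda>v. \<phi> p [u, v, w])"
    "linear (\<lambda>w. \<phi> p [u, v, w])"
  using alternating_form_linear[OF phi_alt, of "[]" "[v, w]"]
      alternating_form_linear[OF phi_alt, of "[u]" "[w]"]
    alternating_form_linear[OF phi_alt, of "[u, v]" "[]"] by simp_all

lemma phi_swap: "\<phi> p [v, u, w] = - \<phi> p [u, v, w]" "\<phi> p [u, w, v] = - \<phi> p [u, v, w]"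
  using alternating_form_swap[OF phi_alt, of "[]" "[w]" p v u]
      alternating_form_swap[OF phi_alt, of "[u]" "[]" p w v]
  by simp_all

lemma phi_smooth:
  assumes "smooth_field_on A W X" "smooth_field_on A W Y" "smooth_field_on A W Z"
  shows "smooth_fun_on A W (\<lambda>q. \<phi> q [X q, Y q, Z q])"
proof -
  have "\<forall>W Ys. open W \<and> length Ys = 3 \<and> (\<forall>Y\<in>set Ys. smooth_field_on A W Y) \<longrightarrow>
      smooth_fun_on A W (\<lambda>q. \<phi> q (map (\<lambda>Y. Y q) Ys))"
    using g2 unfolding g2_structure_def smooth_form_def by blast
  from this[rule_format, of W "[X, Y, Z]"] show ?thesis
    using smooth_field_open[OF assms(1)] assms by simp
qed

lemma g_smooth:
  "smooth_field_on A W X \<Longrightarrow> smooth_field_on A W Y \<Longrightarrow> smooth_fun_on A W (\<lambda>q. g q (X q) (Y q))"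
  using metric by (simp add: riemannian_metric_def)

lemma frame_g: "frame (g p)"
  using metric by unfold_locales (auto simp: riemannian_metric_def)

lemma cayley_at: "cayley_frame (g p) (\<phi> p) e \<Longrightarrow> cayley (g p) (\<phi> p) e"
  by (intro cayley.intro cayley_axioms.intro frame_g phi_alt)

lemma metric_L: "metric_connection A g L"
  using LC by (simp add: levi_civita_def)

lemma affine_L: "affine_connection A L"
  using metric_L by (simp add: metric_connection_def)

text \<open>The covariant derivative with fields as arguments. \<open>cov_deriv_form\<close>
  differentiates coordinate fields, whereas the proof needs frame fields;
  \<open>cov_deriv_fields\<close> connects the two.\<close>

definition cov_fields ::
    "'m connection \<Rightarrow> 'm \<Rightarrow> vec7 \<Rightarrow> ('m \<Rightarrow> vec7) \<Rightarrow> ('m \<Rightarrow> vec7) \<Rightarrow> ('m \<Rightarrow> vec7) \<Rightarrow> real" where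
  "cov_fields D p v X Y Z = dir_deriv A p v (\<lambda>q. \<phi> q [X q, Y q, Z q])
    - (\<phi> p [D p v X, Y p, Z p] + \<phi> p [X p, D p v Y, Z p] + \<phi> p [X p, Y p, D p v Z])"

lemma cov_deriv_coord:
  "cov_deriv_form A D \<phi> p v [x, y, z] =
    cov_fields D p v (coord_field A p x) (coord_field A p y) (coord_field A p z)"
  by (simp add: cov_deriv_form_def cov_fields_def lessThan_Suc)

lemma cov_fields_swap:
  assumes "smooth_field_on A W X" "smooth_field_on A W Y" "smooth_field_on A W Z" "p \<in> W"
  shows "cov_fields D p v Y X Z = - cov_fields D p v X Y Z"
      "cov_fields D p v X Z Y = - cov_fields D p v X Y Z"
proof -
  note s = phi_smooth[OF assms(1-3)]
  have "dir_deriv A p v (\<lambda>q. \<phi> q [Y q, X q, Z q]) = - dir_deriv A p v (\<lambda>q. \<phi> q [X q, Y q, Z q])"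
    using dir_deriv_uminus[OF s assms(4), of v] by (simp add: phi_swap(1)[of _ "Y _" "X _"])
  then show "cov_fields D p v Y X Z = - cov_fields D p v X Y Z"
    unfolding cov_fields_def
        using phi_swap(1)[of p "D p v Y" "X p" "Z p"] phi_swap(1)[of p "Y p" "D p v X" "Z p"]
      phi_swap(1)[of p "Y p" "X p" "D p v Z"] by simp
  have "dir_deriv A p v (\<lambda>q. \<phi> q [X q, Z q, Y q]) = - dir_deriv A p v (\<lambda>q. \<phi> q [X q, Y q, Z q])"
    using dir_deriv_uminus[OF s assms(4), of v] by (simp add: phi_swap(2)[of _ _ "Z _" "Y _"])
  then show "cov_fields D p v X Z Y = - cov_fields D p v X Y Z"
    unfolding cov_fields_def
        using phi_swap(2)[of p "D p v X" "Z p" "Y p"] phi_swap(2)[of p "X p" "D p v Z" "Y p"]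
      phi_swap(2)[of p "X p" "Z p" "D p v Y"] by simp
qed

lemma cov_fields_tensorial:
  assumes D: "affine_connection A D" and p: "p \<in> W"
      and "smooth_field_on A W X" "smooth_field_on A W Y" "smooth_field_on A W Z"
  shows "cov_fields D p v X Y Z = cov_fields D p v (coord_field A p (X p)) Y Z"
proof (rule tensorial[OF p assms(3), where T = "\<lambda>X. cov_fields D p v X Y Z"])
  let ?V = "W \<inter> fst (chart_at A p)"
  have p: "p \<in> ?V" using p chart_at_mem by simp
  have V: "open ?V" using smooth_field_open[OF assms(3)] chart(1)[OF chart_at_mem(1)] by blast
  have YZ: "smooth_field_on A ?V Y" "smooth_field_on A ?V Z"
    using assms(4,5) smooth_field_subset[OF _ V] by blast+
  fix X assume X: "smooth_field_on A ?V X"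
  note s = phi_smooth[OF X YZ]
  show "cov_fields D p v (\<lambda>q. X q + X' q) Y Z = cov_fields D p v X Y Z + cov_fields D p v X' Y Z"
    if X': "smooth_field_on A ?V X'" for X'
    unfolding cov_fields_def affine_connectionD(2)[OF D X p X'] linear_add[OF phi_linear(1)]
      dir_deriv_add[OF s phi_smooth[OF X' YZ] p] by simp
  show "cov_fields D p v (\<lambda>q. f q *\<^sub>R X q) Y Z = f p *\<^sub>R cov_fields D p v X Y Z"
    if f: "smooth_fun_on A ?V f" for f
    using dir_deriv_mult[OF f s p, of v]
    unfolding cov_fields_def affine_connectionD(3)[OF D X p f] linear_add[OF phi_linear(1)]
        linear_cmul[OF phi_linear(1)]
    by (simp add: algebra_simps)
  show "cov_fields D p v X' Y Z = cov_fields D p v X Y Z" if "\<forall>q\<in>?V. X' q = X q" for X'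
    unfolding cov_fields_def
    using affine_connectionD(4)[OF D X p, of X']
        dir_deriv_cong[OF s p, of "\<lambda>q. \<phi> q [X' q, Y q, Z q]"] that p
    by simp
qed

text \<open>Tensoriality is proved in the first slot only. Antisymmetry brings each field there in
  turn, where it is replaced by a coordinate field, and finally restores the order.\<close>

lemma cov_deriv_fields:
  assumes D: "affine_connection A D" and p: "p \<in> W"
      and "smooth_field_on A W X" "smooth_field_on A W Y" "smooth_field_on A W Z"
  shows "cov_deriv_form A D \<phi> p v [X p, Y p, Z p] = cov_fields D p v X Y Z"
proof -
  let ?V = "W \<inter> fst (chart_at A p)"
  let ?c = "coord_field A p"
  have p: "p \<in> ?V" using p chart_at_mem by simp
  have V: "open ?V" using smooth_field_open[OF assms(3)] chart(1)[OF chart_at_mem(1)] by blast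
  have s: "smooth_field_on A ?V X" "smooth_field_on A ?V Y" "smooth_field_on A ?V Z"
    using assms(3-5) smooth_field_subset[OF _ V] by blast+
  have c: "smooth_field_on A ?V (?c u)" for u
    by (rule smooth_field_subset[OF smooth_coord_field V]) simp
  note t = cov_fields_tensorial[OF D p]
  have sw1: "cov_fields D p v (?c y) (?c x) (?c z) = - cov_fields D p v (?c x) (?c y) (?c z)"
      for x y z
    by (rule cov_fields_swap(1)[OF c c c p])
  have "cov_fields D p v X Y Z = cov_fields D p v (?c (X p)) Y Z" by (rule t[OF s])
  also have "\<dots> = - cov_fields D p v Y (?c (X p)) Z" by (rule cov_fields_swap(1)[OF s(2) c s(3) p])
  also have "\<dots> = - cov_fields D p v (?c (Y p)) (?c (X p)) Z" by (simp only: t[OF s(2) c s(3)])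
  also have "\<dots> = cov_fields D p v (?c (Y p)) Z (?c (X p))"
      by (simp only: cov_fields_swap(2)[OF c c s(3) p])
  also have "\<dots> = - cov_fields D p v Z (?c (Y p)) (?c (X p))"
      by (rule cov_fields_swap(1)[OF s(3) c c p])
  also have "\<dots> = - cov_fields D p v (?c (Z p)) (?c (Y p)) (?c (X p))" by (simp only: t[OF s(3) c c])
  also have "\<dots> = cov_fields D p v (?c (Y p)) (?c (Z p)) (?c (X p))"
    using sw1[of "Z p" "Y p" "X p"] by simp
  also have "\<dots> = - cov_fields D p v (?c (Y p)) (?c (X p)) (?c (Z p))"
    by (rule cov_fields_swap(2)[OF c c c p])
  also have "\<dots> = cov_fields D p v (?c (X p)) (?c (Y p)) (?c (Z p))"
    using sw1[of "X p" "Y p" "Z p"] by simp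
  finally show ?thesis by (simp only: cov_deriv_coord)
qed

text \<open>The fields with constant coefficients in a local Cayley frame have constant products under the
  metric and the three-form. Hence the covariant derivative of the three-form acts through the skew
  endomorphism given by the connection coefficients of the frame.\<close>

definition conn_endo :: "(7 \<Rightarrow> 'm \<Rightarrow> vec7) \<Rightarrow> 'm \<Rightarrow> vec7 \<Rightarrow> vec7 \<Rightarrow> vec7" where
  "conn_endo E p x u = - (\<Sum>a\<in>UNIV. g p u (E a p) *\<^sub>R L p x (E a))"

context
  fixes W :: "'m set" and E :: "7 \<Rightarrow> 'm \<Rightarrow> vec7"
  assumes E_smooth: "\<And>i. smooth_field_on A W (E i)"
    and E_cayley: "\<And>q. q \<in> W \<Longrightarrow> cayley_frame (g q) (\<phi> q) (\<lambda>i. E i q)"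
begin

lemma W_open: "open W"
  using smooth_field_open[OF E_smooth] .

lemma cayley_der_at:
  assumes p: "p \<in> W"
  shows "cayley_der (g p) (\<phi> p) (\<lambda>i. E i p) (cov_deriv_form A L \<phi> p) (conn_endo E p)"
proof -
  interpret cayley "g p" "\<phi> p" "\<lambda>i. E i p" by (rule cayley_at[OF E_cayley[OF p]])
  \<comment> \<open>The extension of u with constant coefficients in the frame. The metric and the
    three-form are constant on such fields, so only connection terms survive; the minus sign in
    \<open>conn_endo\<close> makes them enter with a plus sign.\<close>
  define Y where "Y u q = (\<Sum>a\<in>UNIV. g p u (E a p) *\<^sub>R E a q)" for u q
  have Y_p: "Y u p = u" for u unfolding Y_def using orthonormal_expand[OF e_orth, of u] by simp
  have Y_smooth: "smooth_field_on A W (Y u)" for u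
    unfolding Y_def[abs_def] by (intro smooth_field_sum smooth_field_scale smooth_fun_const
        E_smooth W_open)
  have L_Y: "L p x (Y u) = - conn_endo E p x u" for x u
    unfolding Y_def[abs_def] conn_endo_def
        using affine_connection_sum[where Y = E and I = UNIV, OF affine_L E_smooth W_open p] by simp
  have L_lin: "linear (\<lambda>x. L p x (Y u))" for u
    by (rule affine_connectionD(1)[OF affine_L Y_smooth p])
  have endo_x: "linear (\<lambda>x. conn_endo E p x u)" for u
    using linear_compose_neg[OF L_lin[of u]] by (simp add: L_Y)
  have endo_u: "linear (conn_endo E p x)" for x
    unfolding conn_endo_def[abs_def]
    by (intro linear_compose_neg linear_compose_sum ballI linearI)
      (simp_all add: linear_add[OF lin1] linear_cmul[OF lin1] scaleR_add_left)
  show ?thesis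
  proof (intro cayley_der.intro cayley_axioms cayley_der_axioms.intro)
    fix x
    show "conn_endo E p x \<in> so_alg (g p)"
      unfolding so_alg_def
    proof (intro CollectI conjI endo_u allI)
      fix u v
      have "g q (Y u q) (Y v q) = g p u v" if "q \<in> W" for q
      proof -
        interpret q: cayley "g q" "\<phi> q" "\<lambda>i. E i q" by (rule cayley_at[OF E_cayley[OF that]])
        show ?thesis
          using h_frame_sums[of "\<lambda>a. g p u (E a p)" "\<lambda>a. g p v (E a p)"]
          by (simp add: Y_def q.h_frame_sums flip: orthonormal_expand[OF e_orth])
      qed
      then have "dir_deriv A p x (\<lambda>q. g q (Y u q) (Y v q)) = 0"
        using dir_deriv_cong[OF smooth_fun_const[OF W_open, of "g p u v"] p, of "\<lambda>q. g q (Y u q)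
            (Y v q)"] by simp
      moreover have "dir_deriv A p x (\<lambda>q. g q (Y u q) (Y v q)) = g p (L p x (Y u)) (Y v p)
          + g p (Y u p) (L p x (Y v))"
        using metric_L Y_smooth p unfolding metric_connection_def by blast
      ultimately show "g p (conn_endo E p x u) v = - g p u (conn_endo E p x v)"
        by (simp add: L_Y Y_p linear_neg[OF lin1] linear_neg[OF lin2])
    qed
  next
    fix x u v w
    have "\<phi> q [Y u q, Y v q, Y w q] = \<phi> p [u, v, w]" if "q \<in> W" for q
    proof -
      interpret q: cayley "g q" "\<phi> q" "\<lambda>i. E i q" by (rule cayley_at[OF E_cayley[OF that]])
      show ?thesis
        using f_frame_sums[of "\<lambda>a. g p u (E a p)" "\<lambda>a. g p v (E a p)" "\<lambda>a. g p w (E a p)"]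
        by (simp add: Y_def q.f_frame_sums flip: orthonormal_expand[OF e_orth])
    qed
    then have "dir_deriv A p x (\<lambda>q. \<phi> q [Y u q, Y v q, Y w q]) = 0"
      using dir_deriv_cong[OF smooth_fun_const[OF W_open, of "\<phi> p [u, v, w]"] p, of "\<lambda>q. \<phi> q [Y u
          q, Y v q, Y w q]"]
      by simp
    then show "cov_deriv_form A L \<phi> p x [u, v, w]
        = \<phi> p [conn_endo E p x u, v, w] + \<phi> p [u, conn_endo E p x v, w] + \<phi> p
            [u, v, conn_endo E p x w]"
      using cov_deriv_fields[OF affine_L p Y_smooth Y_smooth Y_smooth, of x u v w]
      by (simp add: cov_fields_def L_Y Y_p linear_neg[OF phi_linear(1)]
          linear_neg[OF phi_linear(2)] linear_neg[OF phi_linear(3)])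
  next
    fix u v w
    have "cov_deriv_form A L \<phi> p x [u, v, w] = dir_deriv A p x (\<lambda>q. \<phi> q [Y u q, Y v q, Y w q])
        - (\<phi> p [L p x (Y u), v, w] + \<phi> p [u, L p x (Y v), w] + \<phi> p [u, v, L p x (Y w)])" for x
      using cov_deriv_fields[OF affine_L p Y_smooth Y_smooth Y_smooth, of x u v w]
          by (simp add: cov_fields_def Y_p)
    moreover have "linear (\<lambda>x. dir_deriv A p x (\<lambda>q. \<phi> q [Y u q, Y v q, Y w q])
        - (\<phi> p [L p x (Y u), v, w] + \<phi> p [u, L p x (Y v), w] + \<phi> p [u, v, L p x (Y w)]))"
      using linear_compose[OF L_lin phi_linear(1)] linear_compose[OF L_lin phi_linear(2)]
          linear_compose[OF L_lin phi_linear(3)]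
      by (intro linear_compose_sub linear_compose_add
          dir_deriv_linear[OF phi_smooth[OF Y_smooth Y_smooth Y_smooth] p])
        (simp_all add: o_def)
    ultimately show "linear (\<lambda>x. cov_deriv_form A L \<phi> p x [u, v, w])" by simp
  qed
qed

lemma xi_g2_eq:
  assumes p: "p \<in> W" and e: "orthonormal_frame (g p) e"
  shows "xi_g2 A g \<phi> L p e x y = cayley_der.xi (g p) (\<phi> p) (\<lambda>i. E i p) (cov_deriv_form A L \<phi> p) x y"
proof -
  interpret cayley_der "g p" "\<phi> p" "\<lambda>i. E i p" "cov_deriv_form A L \<phi> p" "conn_endo E p"
    by (rule cayley_der_at[OF p])
  show ?thesis
    unfolding xi_g2_def xi_frame[OF e] r_def star_def r_form_def star_phi_def ..
qed

text \<open>The frames \<open>e q\<close> may vary arbitrarily with q, so smoothness cannot be read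
  off them. Frame independence allows the term to be rewritten in the smooth frame
  \<open>E\<close>.\<close>

lemma xi_g2_smooth:
  assumes X: "smooth_field_on A W X" and Y: "smooth_field_on A W Y"
    and e: "\<And>q. orthonormal_frame (g q) (e q)"
  shows "smooth_field_on A W (\<lambda>q. xi_g2 A g \<phi> L q (e q) (X q) (Y q))"
proof (rule smooth_field_cong)
  \<comment> \<open>The factor -1/2 comes from \<open>r_fano\<close> and the factor -1 from the sign
    of \<open>conn_endo\<close>; both appear as constant multipliers so that closure under products
    applies.\<close>
  let ?F = "\<lambda>q. - (1 / 3) *\<^sub>R (\<Sum>i\<in>UNIV.
      (- (1 / 2) * (\<Sum>a\<in>UNIV. \<Sum>d\<in>UNIV. (- 1) * g q (L q (X q) (E a)) (E d q) * fano i a d)) *\<^sub>R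
      (\<Sum>k\<in>UNIV. \<phi> q [E i q, Y q, E k q] *\<^sub>R E k q))"
  show "smooth_field_on A W ?F"
    by (intro smooth_field_scale smooth_field_sum smooth_fun_const smooth_fun_mult smooth_fun_sum
        g_smooth
        phi_smooth affine_connection_smooth[OF affine_L] E_smooth X Y W_open)
  fix q assume q: "q \<in> W"
  interpret cayley_der "g q" "\<phi> q" "\<lambda>i. E i q" "cov_deriv_form A L \<phi> q" "conn_endo E q"
    by (rule cayley_der_at[OF q])
  have "conn_endo E q x (E a q) = - L q x (E a)" for x a
    unfolding conn_endo_def h_e by (simp add: kron_def if_distrib[of "\<lambda>c. c *\<^sub>R _"] cong: if_cong)
  then show "?F q = xi_g2 A g \<phi> L q (e q) (X q) (Y q)"
    unfolding xi_g2_eq[OF q e] xi_def r_e r_fano_def cross_expand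
    by (simp add: linear_neg[OF lin1])
qed

end

lemma local_frame:
  obtains W E where "p \<in> W" "\<And>i. smooth_field_on A W (E i)"
    "\<And>q. q \<in> W \<Longrightarrow> cayley_frame (g q) (\<phi> q) (\<lambda>i. E i q)"
  using g2 unfolding g2_structure_def by blast

text \<open>The pointwise results are exported for an arbitrary orthonormal frame; the local Cayley
  frame appears only inside the proof.\<close>

lemma xi_g2_props:
  assumes e: "orthonormal_frame (g p) e"
  shows "linear (\<lambda>x. xi_g2 A g \<phi> L p e x y)" "linear (xi_g2 A g \<phi> L p e x)"
    "xi_g2 A g \<phi> L p e x \<in> so_alg (g p)" "xi_g2 A g \<phi> L p e x \<in> g2_perp (g p) (\<phi> p)"
    "\<phi> p [xi_g2 A g \<phi> L p e x u, v, w] + \<phi> p [u, xi_g2 A g \<phi> L p e x v, w]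
        + \<phi> p [u, v, xi_g2 A g \<phi> L p e x w]
      = cov_deriv_form A L \<phi> p x [u, v, w]"
    "\<And>B. B \<in> g2_perp (g p) (\<phi> p) \<Longrightarrow>
      (\<And>u v w. \<phi> p [B u, v, w] + \<phi> p [u, B v, w] + \<phi> p [u, v, B w] = cov_deriv_form A L \<phi> p x
          [u, v, w]) \<Longrightarrow>
      B y = xi_g2 A g \<phi> L p e x y"
proof -
  obtain W E where WE: "p \<in> W" "\<And>i. smooth_field_on A W (E i)"
    "\<And>q. q \<in> W \<Longrightarrow> cayley_frame (g q) (\<phi> q) (\<lambda>i. E i q)"
    using local_frame by blast
  interpret cayley_der "g p" "\<phi> p" "\<lambda>i. E i p" "cov_deriv_form A L \<phi> p" "conn_endo E p"
    by (rule cayley_der_at[OF WE(2,3,1)])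
  have eq: "xi_g2 A g \<phi> L p e = xi"
    by (intro ext xi_g2_eq[OF WE(2,3,1) e])
  show "linear (\<lambda>x. xi_g2 A g \<phi> L p e x y)" "linear (xi_g2 A g \<phi> L p e x)"
    "xi_g2 A g \<phi> L p e x \<in> so_alg (g p)" "xi_g2 A g \<phi> L p e x \<in> g2_perp (g p) (\<phi> p)"
    "\<phi> p [xi_g2 A g \<phi> L p e x u, v, w] + \<phi> p [u, xi_g2 A g \<phi> L p e x v, w]
        + \<phi> p [u, v, xi_g2 A g \<phi> L p e x w]
      = cov_deriv_form A L \<phi> p x [u, v, w]"
    unfolding eq by (fact xi_lin xi_so xi_perp xi_T)+
  show "B y = xi_g2 A g \<phi> L p e x y"
    if "B \<in> g2_perp (g p) (\<phi> p)"
      "\<And>u v w. \<phi> p [B u, v, w] + \<phi> p [u, B v, w] + \<phi> p [u, v, B w]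
          = cov_deriv_form A L \<phi> p x [u, v, w]" for B
    unfolding eq using that by (rule xi_unique)
qed

lemma minimal_connection:
  assumes "\<And>p. cayley_frame (g p) (\<phi> p) (e p)"
  shows "minimal_g2_connection A g \<phi> L (\<lambda>p x Y. L p x Y + xi_g2 A g \<phi> L p (e p) x (Y p))"
proof -
  let ?xi = "\<lambda>p. xi_g2 A g \<phi> L p (e p)"
  let ?D = "\<lambda>p x Y. L p x Y + ?xi p x (Y p)"
  have e: "orthonormal_frame (g p) (e p)" for p
    using assms by (simp add: cayley_frame_def)
  note xi = xi_g2_props[OF e]
  have "affine_connection A ?D"
    unfolding affine_connection_def
  proof (intro allI impI conjI ballI)
    fix W Y assume Y: "smooth_field_on A W Y"
    {
      fix p assume p: "p \<in> W"
      note D = affine_connectionD[OF affine_L Y p]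
      show "linear (\<lambda>v. ?D p v Y)" by (intro linear_compose_add D(1) xi(1))
      show "?D p v (\<lambda>q. Y q + Z q) = ?D p v Y + ?D p v Z" if "smooth_field_on A W Z" for v Z
        by (simp add: D(2)[OF that] linear_add[OF xi(2)])
      show "?D p v (\<lambda>q. f q *\<^sub>R Y q) = dir_deriv A p v f *\<^sub>R Y p + f p *\<^sub>R ?D p v Y"
          if "smooth_fun_on A W f" for v f
        by (simp add: D(3)[OF that] linear_cmul[OF xi(2)] scaleR_add_right)
      show "?D p v Z = ?D p v Y" if "\<forall>q\<in>W. Z q = Y q" for v Z
        using D(4)[of Z] that p by simp
    }
    fix X assume X: "smooth_field_on A W X"
    have "smooth_field_on A W (\<lambda>q. ?xi q (X q) (Y q))"
    \<comment> \<open>A smooth Cayley frame is available on the smaller set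
      \<open>W \<inter> V\<close> around each point.\<close>
    proof (rule smooth_field_local[OF smooth_field_open[OF Y]])
      fix p assume p: "p \<in> W"
      obtain V E where VE: "p \<in> V" "\<And>i. smooth_field_on A V (E i)"
        "\<And>q. q \<in> V \<Longrightarrow> cayley_frame (g q) (\<phi> q) (\<lambda>i. E i q)"
        using local_frame by blast
      have WV: "open (W \<inter> V)" using smooth_field_open[OF Y] smooth_field_open[OF VE(2)] by blast
      have "smooth_field_on A (W \<inter> V) X" "smooth_field_on A (W \<inter> V) Y"
          "smooth_field_on A (W \<inter> V) (E i)" for i
        by (rule smooth_field_subset[OF _ WV], fact X Y VE(2), simp)+
      then have "smooth_field_on A (W \<inter> V) (\<lambda>q. ?xi q (X q) (Y q))"
        by (intro xi_g2_smooth[of "W \<inter> V" E]) (use VE(3) e in auto)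
      then show "\<exists>V. p \<in> V \<and> V \<subseteq> W \<and> smooth_field_on A V (\<lambda>q. ?xi q (X q) (Y q))"
        using p VE(1) by (intro exI[of _ "W \<inter> V"]) simp
    qed
    then show "smooth_field_on A W (\<lambda>q. ?D q (X q) Y)"
      by (intro smooth_field_add affine_connection_smooth[OF affine_L X Y])
  qed
  moreover have "dir_deriv A p v (\<lambda>q. g q (Y q) (Z q)) = g p (?D p v Y) (Z p)
      + g p (Y p) (?D p v Z)"
    if "smooth_field_on A W Y" "smooth_field_on A W Z" "p \<in> W" for W Y Z p v
  proof -
    interpret frame "g p" by (rule frame_g)
    have "dir_deriv A p v (\<lambda>q. g q (Y q) (Z q)) = g p (L p v Y) (Z p) + g p (Y p) (L p v Z)"
      using metric_L that unfolding metric_connection_def by blast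
    moreover have "g p (?xi p v (Y p)) (Z p) = - g p (Y p) (?xi p v (Z p))"
      using xi(3)[of p v] by (simp add: so_alg_def)
    ultimately show ?thesis by (simp add: linear_add[OF lin1] linear_add[OF lin2])
  qed
  ultimately have "metric_connection A g ?D" unfolding metric_connection_def by blast
  moreover have "cov_deriv_form A ?D \<phi> p v vs = 0" if vs3: "length vs = 3" for p v vs
  proof -
    obtain x y z where vs: "vs = [x, y, z]" using vs3 unfolding length_3_conv by blast
    have "cov_deriv_form A ?D \<phi> p v [x, y, z] = cov_deriv_form A L \<phi> p v [x, y, z]
        - (\<phi> p [?xi p v x, y, z] + \<phi> p [x, ?xi p v y, z] + \<phi> p [x, y, ?xi p v z])"
      by (simp add: cov_deriv_coord cov_fields_def linear_add[OF phi_linear(1)]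
          linear_add[OF phi_linear(2)]
          linear_add[OF phi_linear(3)])
    then show ?thesis by (simp add: vs xi(5))
  qed
  ultimately show ?thesis
    using xi(4) by (simp add: minimal_g2_connection_def)
qed

text \<open>That the three-form is parallel for \<open>D\<close> means that \<open>?B\<close> acts
  on it as its Levi-Civita derivative, which determines \<open>?B\<close>. Tensoriality of the
  difference then passes from the coordinate field to \<open>Y\<close>.\<close>

lemma minimal_connection_unique:
  assumes D: "minimal_g2_connection A g \<phi> L D" and Y: "smooth_field_on A W Y" and p: "p \<in> W"
    and e: "cayley_frame (g p) (\<phi> p) e"
  shows "D p x Y = L p x Y + xi_g2 A g \<phi> L p e x (Y p)"
proof -
  let ?B = "\<lambda>y. D p x (coord_field A p y) - L p x (coord_field A p y)"
  have o: "orthonormal_frame (g p) e" using e by (simp add: cayley_frame_def)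
  have aD: "affine_connection A D" using D
      by (simp add: minimal_g2_connection_def metric_connection_def)
  have "?B (Y p) = xi_g2 A g \<phi> L p e x (Y p)"
  proof (rule xi_g2_props(6)[OF o])
    show "?B \<in> g2_perp (g p) (\<phi> p)" using D by (simp add: minimal_g2_connection_def)
    fix u v w
    have "cov_deriv_form A D \<phi> p x [u, v, w] = 0" using D by (simp add: minimal_g2_connection_def)
    then show "\<phi> p [?B u, v, w] + \<phi> p [u, ?B v, w] + \<phi> p [u, v, ?B w]
        = cov_deriv_form A L \<phi> p x [u, v, w]"
      by (simp add: cov_deriv_coord cov_fields_def linear_diff[OF phi_linear(1)]
          linear_diff[OF phi_linear(2)]
          linear_diff[OF phi_linear(3)])
  qed
  then show ?thesis using connection_difference[OF aD affine_L Y p, of x]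
      by (simp add: algebra_simps)
qed

text \<open>The brackets of coordinate fields vanish at p, so torsion-freeness makes
  \<open>L p u (?c v)\<close> symmetric in u and v, and the twelve connection terms cancel in six
  pairs.\<close>

lemma ext_deriv_cov:
  "ext_deriv A \<phi> p [a, b, c, d] = cov_deriv_form A L \<phi> p a [b, c, d]
      - cov_deriv_form A L \<phi> p b [a, c, d]
    + cov_deriv_form A L \<phi> p c [a, b, d] - cov_deriv_form A L \<phi> p d [a, b, c]"
proof -
  let ?c = "coord_field A p"
  have tf: "L p u (?c v) = L p v (?c u)" for u v
  proof -
    have "L p (?c u p) (?c v) - L p (?c v p) (?c u) = lie_bracket A (?c u) (?c v) p"
      using LC smooth_coord_field chart_at_mem(2) unfolding levi_civita_def by blast
    then show ?thesis by (simp add: lie_bracket_coord_field)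
  qed
  show ?thesis
    unfolding cov_deriv_coord cov_fields_def coord_field_self
    using tf[of b a] tf[of c a] tf[of d a] tf[of c b] tf[of d b] tf[of d c]
      phi_swap(1)[of p "L p a (?c b)"] phi_swap(1)[of p "L p a (?c c)"]
          phi_swap(1)[of p "L p a (?c d)"]
      phi_swap(1)[of p "L p b (?c c)"] phi_swap(1)[of p "L p b (?c d)"]
          phi_swap(1)[of p "L p c (?c d)"]
      phi_swap(2)[of p _ "L p a (?c b)"] phi_swap(2)[of p _ "L p a (?c c)"]
          phi_swap(2)[of p _ "L p a (?c d)"]
      phi_swap(2)[of p _ "L p b (?c c)"] phi_swap(2)[of p _ "L p b (?c d)"]
          phi_swap(2)[of p _ "L p c (?c d)"]
    by (simp add: ext_deriv_def omit_def lessThan_Suc)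
qed

text \<open>The last term changes sign against \<open>r_identity\<close> because
  \<open>coderiv\<close> is minus the trace.\<close>

lemma r_form_identity:
  "4 * r_form A g \<phi> L p x y =
    form_inner (g p) 3 (interior_prod x (ext_deriv A \<phi> p)) (interior_prod y (star_phi g \<phi> p))
    - form_inner (g p) 4 (interior_prod y (vec_wedge (g p) x (star_phi g \<phi> p))) (ext_deriv A \<phi> p)
    + 2 * coderiv A g L \<phi> p [x, y]"
proof -
  obtain W E where WE: "p \<in> W" "\<And>i. smooth_field_on A W (E i)"
    "\<And>q. q \<in> W \<Longrightarrow> cayley_frame (g q) (\<phi> q) (\<lambda>i. E i q)"
    using local_frame by blast
  interpret cayley_der "g p" "\<phi> p" "\<lambda>i. E i p" "cov_deriv_form A L \<phi> p" "conn_endo E p"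
    by (rule cayley_der_at[OF WE(2,3,1)])
  have "star = star_phi g \<phi> p" "r x y = r_form A g \<phi> L p x y"
    by (simp_all add: star_def star_phi_def r_def r_form_def)
  then show ?thesis
    using r_identity[OF some_orthonormal_frame[OF e_orth] ext_deriv_cov, of x y]
    by (simp add: coderiv_def Let_def interior_prod_def)
qed

end

text \<open>Existence allows any pointwise selection of Cayley frames, smooth or not. Uniqueness is
  tested on smooth fields, since the value of a \<open>connection\<close> on other arguments is
  unconstrained.\<close>

theorem theorem3p2:
  fixes A :: "'m::{t2_space, second_countable_topology} chart set"
    and g :: "'m \<Rightarrow> vec7 \<Rightarrow> vec7 \<Rightarrow> real"
    and \<phi> :: "'m \<Rightarrow> form"
    and L :: "'m connection"
  assumes "smooth_atlas A"
    and "riemannian_metric A g"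
    and "g2_structure A g \<phi>"
    and "levi_civita A g L"
  shows "(\<forall>e. (\<forall>p. cayley_frame (g p) (\<phi> p) (e p)) \<longrightarrow>
            minimal_g2_connection A g \<phi> L (\<lambda>p x Y. L p x Y + xi_g2 A g \<phi> L p (e p) x (Y p)))
       \<and> (\<forall>D. minimal_g2_connection A g \<phi> L D \<longrightarrow>
            (\<forall>W Y p e x. smooth_field_on A W Y \<and> p \<in> W \<and> cayley_frame (g p) (\<phi> p) e \<longrightarrow>
               D p x Y = L p x Y + xi_g2 A g \<phi> L p e x (Y p)))
       \<and> (\<forall>p x y.
            4 * r_form A g \<phi> L p x y =
              form_inner (g p) 3 (interior_prod x (ext_deriv A \<phi> p)) (interior_prod y (star_phi g \<phi> p))
              - form_inner (g p) 4 (interior_prod y (vec_wedge (g p) x (star_phi g \<phi> p))) (ext_deriv A \<phi> p)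
              + 2 * coderiv A g L \<phi> p [x, y])"
proof -
  interpret g2_manifold A g \<phi> L
    using assms by unfold_locales
  show ?thesis
    using minimal_connection minimal_connection_unique r_form_identity by blast
qed

end
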